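(* Let $\mathfrak{A}$ be a C*-algebra with a non-decreasing sequence of C*-subalgebras $\mathcal{U}=(\mathfrak{A}_n)_{n\in\mathbb{N}}$ such that $\mathfrak{A}=\overline{\bigcup_{n\in\mathbb{N}}\mathfrak{A}_n}^{\|\cdot\|_{\mathfrak{A}}}$. Then the Fell topology $Fell$ on $\mathrm{Ideal}(\mathfrak{A})$ is contained in the topology $Fell_{i(\mathcal{U})}$ on $\mathrm{Ideal}(\mathfrak{A})$.
   Context: $\mathbb{N}=\{0,1,2,\dots\}$. For a C*-algebra $\mathfrak{B}$, $\mathrm{Ideal}(\mathfrak{B})$ is the set of norm-closed two-sided ideals of $\mathfrak{B}$, including $\{0\}$ and $\mathfrak{B}$; $\mathrm{Prim}(\mathfrak{B})$ is the set of kernels of non-zero irreducible *-representations of $\mathfrak{B}$. The Jacobson topology on $\mathrm{Prim}(\mathfrak{B})$ is the topology whose closed sets are the sets $\{J\in\mathrm{Prim}(\mathfrak{B}): J\supseteq I\}$, $I\in\mathrm{Ideal}(\mathfrak{B})$. For a topological space $X$, let $\mathcal{C}l(X)$ be the set of its closed subsets; the Fell topology on $\mathcal{C}l(X)$ has as basis the sets $U(K,F)=\{Y\in\mathcal{C}l(X): Y\cap K=\emptyset \text{ and } Y\cap A\neq\emptyset \text{ for all } A\in F\}$, where $K\subseteq X$ is compact and $F$ is a finite family of non-empty open subsets of $X$. The Fell topology, $Fell$, on $\mathrm{Ideal}(\mathfrak{B})$ is the initial topology induced by the bijection $I\in\mathrm{Ideal}(\mathfrak{B})\mapsto\{J\in\mathrm{Prim}(\mathfrak{B}):J\supseteq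 I\}\in\mathcal{C}l(\mathrm{Prim}(\mathfrak{B}))$, where $\mathrm{Prim}(\mathfrak{B})$ carries the Jacobson topology and $\mathcal{C}l(\mathrm{Prim}(\mathfrak{B}))$ its Fell topology. Given $\mathfrak{A}$ and $\mathcal{U}=(\mathfrak{A}_n)_{n\in\mathbb{N}}$ as in the claim, let $\mathrm{Ideal}(\mathfrak{A})_\infty=\{(J_n)_{n}\in\prod_{n\in\mathbb{N}}\mathrm{Ideal}(\mathfrak{A}_n): J_{n+1}\cap\mathfrak{A}_n=J_n\text{ for all }n\in\mathbb{N}\}$, equipped with the topology $Fell_\infty$, the relative topology from the product of the Fell topologies on the $\mathrm{Ideal}(\mathfrak{A}_n)$. Let $i(\cdot,\mathcal{U}):I\in\mathrm{Ideal}(\mathfrak{A})\mapsto(I\cap\mathfrak{A}_n)_{n\in\mathbb{N}}\in\mathrm{Ideal}(\mathfrak{A})_\infty$. The topology $Fell_{i(\mathcal{U})}$ on $\mathrm{Ideal}(\mathfrak{A})$ is the initial topology induced by $i(\cdot,\mathcal{U})$ and $(\mathrm{Ideal}(\mathfrak{A})_\infty,Fell_\infty)$. *)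

theory Defs
  imports "HOL-Analysis.Analysis" "HOL-Library.Function_Algebras"
begin

section \<open>Complex vector spaces and C*-algebras\<close>

class scaleC =
  fixes scaleC :: "complex \<Rightarrow> 'a \<Rightarrow> 'a"  (infixr \<open>*\<^sub>C\<close> 75)

class complex_vector = ab_group_add + scaleC +
  assumes scaleC_add_right: "c *\<^sub>C (x + y) = c *\<^sub>C x + c *\<^sub>C y"
    and scaleC_add_left: "(c + d) *\<^sub>C x = c *\<^sub>C x + d *\<^sub>C x"
    and scaleC_scaleC: "c *\<^sub>C d *\<^sub>C x = (c * d) *\<^sub>C x"
    and scaleC_one: "1 *\<^sub>C x = x"
begin

lemma scaleC_zero_left: "0 *\<^sub>C x = 0"
  using scaleC_add_left[of 0 0 x] by simp

lemma scaleC_minus_left: "(- c) *\<^sub>C x = - (c *\<^sub>C x)"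
  using scaleC_add_left[of c "- c" x] by (simp add: scaleC_zero_left eq_neg_iff_add_eq_0 add_commute)

lemma scaleC_minus_one: "(- 1) *\<^sub>C x = - x"
  by (simp add: scaleC_minus_left scaleC_one)

end

instantiation complex :: complex_vector
begin
definition scaleC_complex_def: "c *\<^sub>C (x::complex) = c * x"
instance by standard (simp_all add: scaleC_complex_def algebra_simps)
end

instantiation "fun" :: (type, complex_vector) complex_vector
begin
definition scaleC_fun_def: "c *\<^sub>C f = (\<lambda>x. c *\<^sub>C f x)"
instance
  by standard
    (simp_all add: scaleC_fun_def plus_fun_def scaleC_add_right scaleC_add_left
      scaleC_scaleC scaleC_one)
end

text \<open>C*-algebras are complex and not assumed to be unital; the zero algebra is allowed.\<close>

class cstar_algebra = banach + real_normed_algebra + complex_vector +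
  fixes star :: "'a \<Rightarrow> 'a"
  assumes scaleR_scaleC: "r *\<^sub>R x = complex_of_real r *\<^sub>C x"
    and norm_scaleC: "norm (c *\<^sub>C x) = cmod c * norm x"
    and mult_scaleC_left: "(c *\<^sub>C x) * y = c *\<^sub>C (x * y)"
    and mult_scaleC_right: "x * (c *\<^sub>C y) = c *\<^sub>C (x * y)"
    and star_star: "star (star x) = x"
    and star_add: "star (x + y) = star x + star y"
    and star_scaleC: "star (c *\<^sub>C x) = cnj c *\<^sub>C star x"
    and star_mult: "star (x * y) = star y * star x"
    and norm_star_mult_self: "norm (star x * x) = (norm x)\<^sup>2"

text \<open>
  In what follows a C*-algebra is the carrier set \<open>B\<close> of a C*-subalgebra of an ambient C*-algebra;
  the ambient algebra itself is \<open>UNIV\<close>.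
\<close>

definition cstar_subalgebra :: "'a::cstar_algebra set \<Rightarrow> bool" where
  "cstar_subalgebra B \<longleftrightarrow>
     0 \<in> B \<and> (\<forall>x\<in>B. \<forall>y\<in>B. x + y \<in> B) \<and> (\<forall>c. \<forall>x\<in>B. c *\<^sub>C x \<in> B) \<and>
     (\<forall>x\<in>B. \<forall>y\<in>B. x * y \<in> B) \<and> (\<forall>x\<in>B. star x \<in> B) \<and> closed B"

definition Ideal :: "'a::cstar_algebra set \<Rightarrow> 'a set set" where
  "Ideal B = {I. I \<subseteq> B \<and> 0 \<in> I \<and> (\<forall>x\<in>I. \<forall>y\<in>I. x + y \<in> I) \<and> (\<forall>c. \<forall>x\<in>I. c *\<^sub>C x \<in> I) \<and>
     (\<forall>b\<in>B. \<forall>x\<in>I. b * x \<in> I \<and> x * b \<in> I) \<and> closed I}"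


section \<open>Irreducible representations\<close>

definition ip_norm :: "('h \<Rightarrow> 'h \<Rightarrow> complex) \<Rightarrow> 'h \<Rightarrow> real" where
  "ip_norm ip x = sqrt (Re (ip x x))"

text \<open>
  A Hilbert space is a subspace \<open>S\<close> of some complex vector space together with an inner product
  (linear in the first argument) for which \<open>S\<close> is complete.  The inner product is unrelated to any
  norm or topology on the ambient type.
\<close>

locale complex_hilbert_space =
  fixes S :: "'h::complex_vector set" and ip :: "'h \<Rightarrow> 'h \<Rightarrow> complex"
  assumes zero_mem: "0 \<in> S"
    and add_mem: "\<lbrakk>x \<in> S; y \<in> S\<rbrakk> \<Longrightarrow> x + y \<in> S"
    and scaleC_mem: "x \<in> S \<Longrightarrow> c *\<^sub>C x \<in> S"
    and ip_add_left: "\<lbrakk>x \<in> S; y \<in> S; z \<in> S\<rbrakk> \<Longrightarrow> ip (x + y) z = ip x z + ip y z"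
    and ip_scaleC_left: "\<lbrakk>x \<in> S; y \<in> S\<rbrakk> \<Longrightarrow> ip (c *\<^sub>C x) y = c * ip x y"
    and ip_commute: "\<lbrakk>x \<in> S; y \<in> S\<rbrakk> \<Longrightarrow> ip y x = cnj (ip x y)"
    and ip_self_nonneg: "x \<in> S \<Longrightarrow> 0 \<le> Re (ip x x)"
    and ip_self_eq_0: "\<lbrakk>x \<in> S; ip x x = 0\<rbrakk> \<Longrightarrow> x = 0"
    and complete: "\<lbrakk>\<And>n. X n \<in> S; \<And>e. e > 0 \<Longrightarrow> \<exists>N::nat. \<forall>m\<ge>N. \<forall>n\<ge>N. ip_norm ip (X m - X n) < e\<rbrakk>
      \<Longrightarrow> \<exists>l\<in>S. (\<lambda>n. ip_norm ip (X n - l)) \<longlonglongrightarrow> 0"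
begin

definition closed_linear_subspace :: "'h set \<Rightarrow> bool" where
  "closed_linear_subspace T \<longleftrightarrow>
     T \<subseteq> S \<and> 0 \<in> T \<and> (\<forall>x\<in>T. \<forall>y\<in>T. x + y \<in> T) \<and> (\<forall>c. \<forall>x\<in>T. c *\<^sub>C x \<in> T) \<and>
     (\<forall>X. \<forall>l\<in>S. (\<forall>n::nat. X n \<in> T) \<and> (\<lambda>n. ip_norm ip (X n - l)) \<longlonglongrightarrow> 0 \<longrightarrow> l \<in> T)"

lemma diff_mem: "\<lbrakk>x \<in> S; y \<in> S\<rbrakk> \<Longrightarrow> x - y \<in> S"
  using add_mem[of x "(- 1) *\<^sub>C y"] scaleC_mem[of y "- 1"] by (simp add: scaleC_minus_one)

lemma ip_diff_left: "\<lbrakk>x \<in> S; y \<in> S; z \<in> S\<rbrakk> \<Longrightarrow> ip (x - y) z = ip x z - ip y z"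
  using ip_add_left[of x "(- 1) *\<^sub>C y" z] scaleC_mem[of y "- 1"] ip_scaleC_left[of y z "- 1"]
  by (simp add: scaleC_minus_one)

lemma ip_diff_right: "\<lbrakk>x \<in> S; y \<in> S; z \<in> S\<rbrakk> \<Longrightarrow> ip z (x - y) = ip z x - ip z y"
  using ip_diff_left[of x y z] ip_commute[of "x - y" z] ip_commute[of x z] ip_commute[of y z] diff_mem
  by simp

lemma ip_scaleC_right: "\<lbrakk>x \<in> S; y \<in> S\<rbrakk> \<Longrightarrow> ip x (c *\<^sub>C y) = cnj c * ip x y"
  using ip_commute[of "c *\<^sub>C y" x] ip_commute[of y x] ip_scaleC_left[of y x c] scaleC_mem by simp

lemma ip_zero_left: "x \<in> S \<Longrightarrow> ip 0 x = 0"
  using ip_scaleC_left[of 0 x 0] zero_mem by (simp add: scaleC_zero_left)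

lemma ip_self_real: "x \<in> S \<Longrightarrow> ip x x = of_real (Re (ip x x))"
  using ip_commute[of x x] by (simp add: complex_eq_iff)

lemma ip_norm_nonneg: "x \<in> S \<Longrightarrow> 0 \<le> ip_norm ip x"
  using ip_self_nonneg by (simp add: ip_norm_def)

lemma ip_norm_eq_0: "\<lbrakk>x \<in> S; ip_norm ip x = 0\<rbrakk> \<Longrightarrow> x = 0"
  using ip_self_eq_0[of x] ip_self_real[of x] by (simp add: ip_norm_def)

lemma Cauchy_Schwarz:
  assumes x: "x \<in> S" and y: "y \<in> S"
  shows "cmod (ip x y) \<le> ip_norm ip x * ip_norm ip y"
proof (cases "y = 0")
  case True
  then show ?thesis using ip_commute[of 0 x] ip_zero_left[of x] zero_mem x
    by (simp add: ip_norm_nonneg)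
next
  case False
  define p where "p = Re (ip y y)"
  define a where "a = ip x y"
  have yy: "ip y y = of_real p" using ip_self_real[OF y] by (simp add: p_def)
  have "p \<noteq> 0" using False ip_self_eq_0[OF y] yy by auto
  then have p: "p > 0" using ip_self_nonneg[OF y] by (simp add: p_def)
  have cy: "(a / p) *\<^sub>C y \<in> S" using y scaleC_mem by blast
  have yx: "ip y x = cnj a" using ip_commute[OF x y] by (simp add: a_def)
  have "ip (x - (a / p) *\<^sub>C y) (x - (a / p) *\<^sub>C y)
      = ip x x - cnj (a / p) * a - (a / p) * (cnj a - cnj (a / p) * p)"
    using x y cy
    by (simp add: ip_diff_left ip_diff_right diff_mem ip_scaleC_left ip_scaleC_right yy yx
        flip: a_def)
  also have "\<dots> = ip x x - a * cnj a / p"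
    using p by (simp add: field_simps)
  also have "\<dots> = of_real (Re (ip x x) - (cmod a)\<^sup>2 / p)"
    by (subst ip_self_real[OF x]) (simp add: complex_norm_square[symmetric])
  finally have "0 \<le> Re (ip x x) - (cmod a)\<^sup>2 / p"
    using ip_self_nonneg[OF diff_mem[OF x cy]] by simp
  then have "(cmod a)\<^sup>2 \<le> Re (ip x x) * p"
    using p by (simp add: field_simps)
  then have "sqrt ((cmod a)\<^sup>2) \<le> sqrt (Re (ip x x) * p)"
    by (rule real_sqrt_le_mono)
  then show ?thesis by (simp add: ip_norm_def real_sqrt_mult a_def p_def)
qed

end

locale star_representation = complex_hilbert_space S ip
  for S :: "'h::complex_vector set" and ip :: "'h \<Rightarrow> 'h \<Rightarrow> complex" +
  fixes B :: "'a::cstar_algebra set" and \<pi> :: "'a \<Rightarrow> 'h \<Rightarrow> 'h"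
  assumes op_mem: "\<lbrakk>b \<in> B; x \<in> S\<rbrakk> \<Longrightarrow> \<pi> b x \<in> S"
    and op_add: "\<lbrakk>b \<in> B; x \<in> S; y \<in> S\<rbrakk> \<Longrightarrow> \<pi> b (x + y) = \<pi> b x + \<pi> b y"
    and op_scaleC: "\<lbrakk>b \<in> B; x \<in> S\<rbrakk> \<Longrightarrow> \<pi> b (c *\<^sub>C x) = c *\<^sub>C \<pi> b x"
    and op_bounded: "b \<in> B \<Longrightarrow> \<exists>C. \<forall>x\<in>S. ip_norm ip (\<pi> b x) \<le> C * ip_norm ip x"
    and rep_add: "\<lbrakk>b \<in> B; d \<in> B; x \<in> S\<rbrakk> \<Longrightarrow> \<pi> (b + d) x = \<pi> b x + \<pi> d x"
    and rep_scaleC: "\<lbrakk>b \<in> B; x \<in> S\<rbrakk> \<Longrightarrow> \<pi> (c *\<^sub>C b) x = c *\<^sub>C \<pi> b x"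
    and rep_mult: "\<lbrakk>b \<in> B; d \<in> B; x \<in> S\<rbrakk> \<Longrightarrow> \<pi> (b * d) x = \<pi> b (\<pi> d x)"
    and rep_star: "\<lbrakk>b \<in> B; x \<in> S; y \<in> S\<rbrakk> \<Longrightarrow> ip (\<pi> (star b) x) y = ip x (\<pi> b y)"

locale irreducible_representation = star_representation S ip B \<pi>
  for S :: "'h::complex_vector set" and ip :: "'h \<Rightarrow> 'h \<Rightarrow> complex"
    and B :: "'a::cstar_algebra set" and \<pi> :: "'a \<Rightarrow> 'h \<Rightarrow> 'h" +
  assumes nonzero: "\<exists>b\<in>B. \<exists>x\<in>S. \<pi> b x \<noteq> 0"
    and irreducible: "\<lbrakk>closed_linear_subspace T; \<And>b x. \<lbrakk>b \<in> B; x \<in> T\<rbrakk> \<Longrightarrow> \<pi> b x \<in> T\<rbrakk>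
      \<Longrightarrow> T = {0} \<or> T = S"

definition rep_kernel :: "'h::complex_vector set \<Rightarrow> 'a::cstar_algebra set \<Rightarrow> ('a \<Rightarrow> 'h \<Rightarrow> 'h) \<Rightarrow> 'a set"
  where "rep_kernel S B \<pi> = {b \<in> B. \<forall>x\<in>S. \<pi> b x = 0}"

text \<open>
  A definition cannot quantify over all types of Hilbert spaces.  The type \<open>'a \<Rightarrow> complex\<close> is large
  enough: lemma \<open>rep_kernel_in_Prim\<close> below shows that the kernel of an irreducible representation on
  a Hilbert space of any type is already in \<open>Prim B\<close>.
\<close>

definition Prim :: "'a::cstar_algebra set \<Rightarrow> 'a set set" where
  "Prim B = {rep_kernel S B \<pi> | (S :: ('a \<Rightarrow> complex) set) ip \<pi>. irreducible_representation S ip B \<pi>}"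

lemma rep_kernel_in_Prim:
  fixes S :: "'h::complex_vector set" and B :: "'a::cstar_algebra set"
  assumes B: "cstar_subalgebra B" and irr: "irreducible_representation S ip B \<pi>"
  shows "rep_kernel S B \<pi> \<in> Prim B"
proof -
  interpret irreducible_representation S ip B \<pi> by (rule irr)
  obtain b0 \<xi> where b0: "b0 \<in> B" and \<xi>: "\<xi> \<in> S" and nz: "\<pi> b0 \<xi> \<noteq> 0" using nonzero by blast
  define N where "N = {h \<in> S. \<forall>b\<in>B. ip h (\<pi> b \<xi>) = 0}"
  have "closed_linear_subspace N"
    unfolding closed_linear_subspace_def
  proof (intro conjI allI ballI impI)
    fix X l assume l: "l \<in> S" and X: "(\<forall>n::nat. X n \<in> N) \<and> (\<lambda>n. ip_norm ip (X n - l)) \<longlonglongrightarrow> 0"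
    have "ip l (\<pi> b \<xi>) = 0" if b: "b \<in> B" for b
    proof -
      have "cmod (ip l (\<pi> b \<xi>)) \<le> ip_norm ip (X n - l) * ip_norm ip (\<pi> b \<xi>)" for n
        using Cauchy_Schwarz[of "X n - l" "\<pi> b \<xi>"] ip_diff_left[of "X n" l "\<pi> b \<xi>"] X l b \<xi>
          op_mem[OF b \<xi>] diff_mem[of "X n" l]
        by (auto simp: N_def)
      moreover have "(\<lambda>n. ip_norm ip (X n - l) * ip_norm ip (\<pi> b \<xi>)) \<longlonglongrightarrow> 0"
        using X tendsto_mult_left_zero by blast
      ultimately have "cmod (ip l (\<pi> b \<xi>)) \<le> 0"
        by (meson LIMSEQ_le_const)
      then show ?thesis by simp
    qed
    then show "l \<in> N" using l by (simp add: N_def)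
  qed (auto simp: N_def zero_mem add_mem scaleC_mem ip_zero_left ip_add_left ip_scaleC_left op_mem \<xi>)
  moreover have "\<pi> c h \<in> N" if c: "c \<in> B" and h: "h \<in> N" for c h
  proof -
    have "ip (\<pi> c h) (\<pi> b \<xi>) = 0" if b: "b \<in> B" for b
    proof -
      have sc: "star c \<in> B" "star c * b \<in> B" using B b c by (auto simp: cstar_subalgebra_def)
      have "ip (\<pi> c h) (\<pi> b \<xi>) = ip h (\<pi> (star c * b) \<xi>)"
        using rep_star[of "star c" h "\<pi> b \<xi>"] sc h \<xi> b
        by (simp add: star_star op_mem N_def rep_mult)
      then show ?thesis using h sc by (simp add: N_def)
    qed
    then show ?thesis using c h by (simp add: N_def op_mem)
  qed
  ultimately have "N = {0} \<or> N = S" using irreducible by blast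
  moreover have "N \<noteq> S"
    using ip_self_eq_0[OF op_mem[OF b0 \<xi>]] nz op_mem[OF b0 \<xi>] b0 by (auto simp: N_def)
  ultimately have N: "N = {0}" by blast

  define \<Phi> :: "'h \<Rightarrow> 'a \<Rightarrow> complex" where "\<Phi> h = (\<lambda>b. if b \<in> B then ip h (\<pi> b \<xi>) else 0)" for h
  have \<Phi>_add: "\<Phi> (x + y) = \<Phi> x + \<Phi> y" if "x \<in> S" "y \<in> S" for x y
    using that by (auto simp: \<Phi>_def ip_add_left op_mem \<xi> plus_fun_def)
  have \<Phi>_scale: "\<Phi> (c *\<^sub>C x) = c *\<^sub>C \<Phi> x" if "x \<in> S" for x c
    using that by (auto simp: \<Phi>_def ip_scaleC_left op_mem \<xi> scaleC_fun_def scaleC_complex_def)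
  have \<Phi>_diff: "\<Phi> (x - y) = \<Phi> x - \<Phi> y" if "x \<in> S" "y \<in> S" for x y
    using \<Phi>_add[of "x - y" y] that by (simp add: diff_mem)
  have \<Phi>_zero: "\<Phi> 0 = 0" using \<Phi>_diff[of 0 0] zero_mem by simp
  have inj: "inj_on \<Phi> S"
  proof (rule inj_onI)
    fix x y assume x: "x \<in> S" and y: "y \<in> S" and eq: "\<Phi> x = \<Phi> y"
    have "ip (x - y) (\<pi> b \<xi>) = 0" if "b \<in> B" for b
      using fun_cong[OF eq, of b] x y that by (simp add: \<Phi>_def ip_diff_left op_mem \<xi>)
    then have "x - y \<in> N" using x y by (simp add: N_def diff_mem)
    then show "x = y" using N by simp
  qed
  define \<Psi> where "\<Psi> = inv_into S \<Phi>"
  have \<Psi>\<Phi>: "\<Psi> (\<Phi> x) = x" if "x \<in> S" for x using inj that by (simp add: \<Psi>_def)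
  have \<Psi>_add: "\<Psi> (\<Phi> x + \<Phi> y) = x + y" if "x \<in> S" "y \<in> S" for x y
    using \<Psi>\<Phi>[of "x + y"] \<Phi>_add that by (simp add: add_mem)
  have \<Psi>_diff: "\<Psi> (\<Phi> x - \<Phi> y) = x - y" if "x \<in> S" "y \<in> S" for x y
    using \<Psi>\<Phi>[of "x - y"] \<Phi>_diff that by (simp add: diff_mem)
  have \<Psi>_scale: "\<Psi> (c *\<^sub>C \<Phi> x) = c *\<^sub>C x" if "x \<in> S" for x c
    using \<Psi>\<Phi>[of "c *\<^sub>C x"] \<Phi>_scale that by (simp add: scaleC_mem)
  define ip' where "ip' f g = ip (\<Psi> f) (\<Psi> g)" for f g
  define \<pi>' where "\<pi>' b f = \<Phi> (\<pi> b (\<Psi> f))" for b f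
  have nrm: "ip_norm ip' f = ip_norm ip (\<Psi> f)" for f by (simp add: ip_norm_def ip'_def)
  note trans = \<Psi>\<Phi> \<Psi>_add \<Psi>_diff \<Psi>_scale ip'_def \<pi>'_def nrm

  interpret H: complex_hilbert_space "\<Phi> ` S" ip'
  proof
    show "0 \<in> \<Phi> ` S" using \<Phi>_zero zero_mem by (metis imageI)
  next
    fix f g assume "f \<in> \<Phi> ` S" "g \<in> \<Phi> ` S" then show "f + g \<in> \<Phi> ` S"
      by (auto simp: \<Phi>_add[symmetric] add_mem)
  next
    fix f c assume "f \<in> \<Phi> ` S" then show "c *\<^sub>C f \<in> \<Phi> ` S"
      by (auto simp: \<Phi>_scale[symmetric] scaleC_mem)
  next
    fix f assume "f \<in> \<Phi> ` S" "ip' f f = 0"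
    then obtain x where "x \<in> S" "f = \<Phi> x" "ip x x = 0" by (auto simp: trans)
    then show "f = 0" using ip_self_eq_0[of x] \<Phi>_zero by simp
  next
    fix X assume X: "\<And>n. X n \<in> \<Phi> ` S"
      and C: "\<And>e. e > 0 \<Longrightarrow> \<exists>N::nat. \<forall>m\<ge>N. \<forall>n\<ge>N. ip_norm ip' (X m - X n) < e"
    have "\<forall>n. \<exists>x\<in>S. X n = \<Phi> x" using X by blast
    then obtain Y where Y: "\<And>n. Y n \<in> S" "\<And>n. X n = \<Phi> (Y n)" by metis
    have "\<exists>l\<in>S. (\<lambda>n. ip_norm ip (Y n - l)) \<longlonglongrightarrow> 0"
      by (rule complete) (use Y C in \<open>auto simp: trans\<close>)
    then show "\<exists>l\<in>\<Phi> ` S. (\<lambda>n. ip_norm ip' (X n - l)) \<longlonglongrightarrow> 0"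
      using Y by (auto simp: trans)
  qed (auto simp: trans ip_add_left ip_scaleC_left ip_self_nonneg add_mem scaleC_mem intro: ip_commute)

  have "irreducible_representation (\<Phi> ` S) ip' B \<pi>'"
  proof
    fix b assume "b \<in> B"
    then show "\<exists>C. \<forall>x\<in>\<Phi> ` S. ip_norm ip' (\<pi>' b x) \<le> C * ip_norm ip' x"
      using op_bounded[of b] by (auto simp: trans op_mem)
  next
    show "\<exists>b\<in>B. \<exists>x\<in>\<Phi> ` S. \<pi>' b x \<noteq> 0"
      using b0 \<xi> nz \<Psi>\<Phi>[OF op_mem[OF b0 \<xi>]] \<Psi>\<Phi>[OF zero_mem] \<Phi>_zero by (force simp: trans)
  next
    fix T assume T: "H.closed_linear_subspace T"
      and inv: "\<And>b x. \<lbrakk>b \<in> B; x \<in> T\<rbrakk> \<Longrightarrow> \<pi>' b x \<in> T"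
    define T' where "T' = {x \<in> S. \<Phi> x \<in> T}"
    have T_lin: "T \<subseteq> \<Phi> ` S" "0 \<in> T" "\<And>x y. \<lbrakk>x \<in> T; y \<in> T\<rbrakk> \<Longrightarrow> x + y \<in> T"
      "\<And>c x. x \<in> T \<Longrightarrow> c *\<^sub>C x \<in> T"
      using T unfolding H.closed_linear_subspace_def by simp_all
    have T_lim: "l \<in> T" if "l \<in> \<Phi> ` S" "\<forall>n::nat. X n \<in> T" "(\<lambda>n. ip_norm ip' (X n - l)) \<longlonglongrightarrow> 0"
      for X l
    proof -
      have "\<forall>X. \<forall>l\<in>\<Phi> ` S. (\<forall>n::nat. X n \<in> T) \<and> (\<lambda>n. ip_norm ip' (X n - l)) \<longlonglongrightarrow> 0 \<longrightarrow> l \<in> T"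
        using T unfolding H.closed_linear_subspace_def by (elim conjE)
      from this[rule_format, OF that(1), of X] that show ?thesis by simp
    qed
    have TT': "T = \<Phi> ` T'" using T_lin(1) by (auto simp: T'_def)
    have "closed_linear_subspace T'"
      unfolding closed_linear_subspace_def
    proof (intro conjI allI ballI impI)
      fix X l assume l: "l \<in> S" and X: "(\<forall>n::nat. X n \<in> T') \<and> (\<lambda>n. ip_norm ip (X n - l)) \<longlonglongrightarrow> 0"
      have XS: "X n \<in> S" for n using X by (simp add: T'_def)
      have "(\<lambda>n. ip_norm ip' (\<Phi> (X n) - \<Phi> l)) \<longlonglongrightarrow> 0"
        using X l XS by (simp add: trans)
      then have "\<Phi> l \<in> T"
        using T_lim[of "\<Phi> l" "\<lambda>n. \<Phi> (X n)"] X l by (simp add: T'_def)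
      then show "l \<in> T'" using l by (simp add: T'_def)
    qed (use T_lin(2-4) in \<open>simp_all add: T'_def zero_mem add_mem scaleC_mem \<Phi>_zero \<Phi>_add \<Phi>_scale subset_iff\<close>)
    moreover have "\<pi> b x \<in> T'" if "b \<in> B" "x \<in> T'" for b x
      using inv[of b "\<Phi> x"] that by (simp add: T'_def trans op_mem)
    ultimately have "T' = {0} \<or> T' = S" using irreducible by blast
    then show "T = {0} \<or> T = \<Phi> ` S" using TT' \<Phi>_zero by auto
  next
    fix b x y assume "b \<in> B" "x \<in> \<Phi> ` S" "y \<in> \<Phi> ` S"
    then show "ip' (\<pi>' (star b) x) y = ip' x (\<pi>' b y)"
      using B by (auto simp: trans op_mem rep_star cstar_subalgebra_def)
  qed (auto simp: trans op_mem op_add op_scaleC rep_add rep_scaleC rep_mult \<Phi>_add \<Phi>_scale)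
  moreover have "rep_kernel (\<Phi> ` S) B \<pi>' = rep_kernel S B \<pi>"
  proof -
    have "\<Phi> (\<pi> b x) = 0 \<longleftrightarrow> \<pi> b x = 0" if "b \<in> B" "x \<in> S" for b x
      using \<Psi>\<Phi>[OF op_mem[OF that]] \<Psi>\<Phi>[OF zero_mem] \<Phi>_zero by metis
    then show ?thesis by (auto simp: rep_kernel_def trans)
  qed
  ultimately show ?thesis
    unfolding Prim_def mem_Collect_eq
    by (intro exI[of _ "\<Phi> ` S"] exI[of _ ip'] exI[of _ \<pi>']) simp
qed


section \<open>The topologies\<close>

definition prim_hull :: "'a::cstar_algebra set \<Rightarrow> 'a set \<Rightarrow> 'a set set" where
  "prim_hull B I = {J \<in> Prim B. I \<subseteq> J}"

definition jacobson_topology :: "'a::cstar_algebra set \<Rightarrow> 'a set topology" where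
  "jacobson_topology B = topology (\<lambda>U. \<exists>I\<in>Ideal B. U = Prim B - prim_hull B I)"

lemma norm_star: "norm (star x) = norm (x::'a::cstar_algebra)"
proof -
  have le: "norm y \<le> norm (star y)" for y :: 'a
  proof (cases "norm y = 0")
    case False
    have "norm y * norm y \<le> norm (star y) * norm y"
      using norm_mult_ineq[of "star y" y] by (simp add: norm_star_mult_self power2_eq_square)
    then show ?thesis using False by simp
  qed simp
  show ?thesis using le[of x] le[of "star x"] by (simp add: star_star)
qed

lemma star_minus: "star (- x) = - star (x::'a::cstar_algebra)"
  using star_scaleC[of "- 1" x] by (simp add: scaleC_minus_one)

lemma star_diff: "star (x - y) = star x - star (y::'a::cstar_algebra)"
  using star_add[of x "- y"] by (simp add: star_minus)

text \<open>
  The element \<open>y = 1 - sqrt (1 - star x * x)\<close> exists without a unit and without functional calculus,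
  as the fixed point of \<open>y \<mapsto> (star x * x + y * y) / 2\<close>.
\<close>

lemma one_minus_sqrt_exists:
  fixes x :: "'a::cstar_algebra"
  assumes B: "cstar_subalgebra B" and x: "x \<in> B" and lt: "norm x < 1"
  shows "\<exists>y\<in>B. star y = y \<and> y + y = star x * x + y * y"
proof -
  define r where "r = norm x"
  have r: "0 \<le> r" "r < 1" using lt by (auto simp: r_def)
  define s where "s = {y \<in> B. star y = y} \<inter> cball 0 r"
  define f where "f y = (1/2::real) *\<^sub>R (star x * x + y * y)" for y :: 'a
  have scaleR_B: "c *\<^sub>R y \<in> B" if "y \<in> B" for c y
    using B that by (simp add: cstar_subalgebra_def scaleR_scaleC)
  have "closed s"
    unfolding closed_sequential_limits
  proof (intro allI impI)
    fix X l assume X: "(\<forall>n. X n \<in> s) \<and> X \<longlonglongrightarrow> l"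
    have lB: "l \<in> B"
      by (rule closed_sequentially[of B X]) (use X B in \<open>auto simp: s_def cstar_subalgebra_def\<close>)
    have lr: "l \<in> cball 0 r"
      by (rule closed_sequentially[of "cball 0 r" X]) (use X in \<open>auto simp: s_def\<close>)
    have "(\<lambda>n. norm (X n - l)) \<longlonglongrightarrow> 0"
      using X by (simp add: LIM_zero tendsto_norm_zero)
    moreover have "norm (X n - star l) = norm (X n - l)" for n
      using norm_star[of "X n - l"] X by (simp add: star_diff s_def)
    ultimately have "(\<lambda>n. norm (X n - star l)) \<longlonglongrightarrow> 0" by simp
    then have "X \<longlonglongrightarrow> star l"
      by (rule LIM_zero_cancel[OF tendsto_norm_zero_cancel])
    then have "star l = l" by (rule LIMSEQ_unique[OF _ conjunct2[OF X]])
    then show "l \<in> s" using lB lr by (simp add: s_def)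
  qed
  then have "complete s" by (simp add: complete_eq_closed)
  moreover have "0 \<in> s"
    using B r star_diff[of x x] by (simp add: s_def cstar_subalgebra_def)
  then have "s \<noteq> {}" by blast
  moreover have "f ` s \<subseteq> s"
  proof
    fix z assume "z \<in> f ` s"
    then obtain y where y: "y \<in> s" and z: "z = f y" by blast
    have "norm (star x * x + y * y) \<le> r\<^sup>2 + norm y * norm y"
      using norm_triangle_ineq[of "star x * x" "y * y"] norm_mult_ineq[of y y]
      by (simp add: norm_star_mult_self r_def)
    also have "\<dots> \<le> r\<^sup>2 + r * r"
      using y r by (intro add_left_mono mult_mono) (auto simp: s_def)
    also have "\<dots> \<le> 2 * r"
      using r mult_left_le[of r r] by (simp add: power2_eq_square)
    finally have "norm z \<le> r" by (simp add: z f_def)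
    moreover have "star z = z"
      using y by (simp add: z f_def s_def scaleR_scaleC star_scaleC star_add star_mult star_star)
    moreover have "z \<in> B"
      unfolding z f_def by (rule scaleR_B) (use y x B in \<open>auto simp: s_def cstar_subalgebra_def\<close>)
    ultimately show "z \<in> s" by (simp add: s_def)
  qed
  moreover have "dist (f y) (f z) \<le> r * dist y z" if yz: "y \<in> s" "z \<in> s" for y z
  proof -
    have "f y - f z = (1/2::real) *\<^sub>R (y * (y - z) + (y - z) * z)"
      unfolding f_def by (simp add: algebra_simps flip: scaleR_diff_right)
    then have "norm (f y - f z) = norm (y * (y - z) + (y - z) * z) / 2" by simp
    also have "norm (y * (y - z) + (y - z) * z) \<le> norm y * norm (y - z) + norm (y - z) * norm z"
      by (meson add_mono norm_mult_ineq norm_triangle_le)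
    also have "\<dots> \<le> r * norm (y - z) + norm (y - z) * r"
      using yz r by (intro add_mono mult_mono) (auto simp: s_def)
    finally show ?thesis by (simp add: dist_norm)
  qed
  ultimately have "\<exists>!y\<in>s. f y = y"
    using r by (intro Banach_fix[of s r f]) auto
  then obtain y where y: "y \<in> s" "f y = y" by blast
  have "y + y = (2::real) *\<^sub>R f y" using y by (simp add: scaleR_2)
  also have "\<dots> = star x * x + y * y" by (simp add: f_def)
  finally show ?thesis using y by (auto simp: s_def)
qed

lemma (in star_representation) rep_norm_le:
  assumes B: "cstar_subalgebra B" and b: "b \<in> B" and lt: "norm b < 1" and h: "h \<in> S"
  shows "ip_norm ip (\<pi> b h) \<le> ip_norm ip h"
proof -
  obtain y where y: "y \<in> B" "star y = y" "y + y = star b * b + y * y"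
    using one_minus_sqrt_exists[OF B b lt] by blast
  have mem: "star b \<in> B" "star b * b \<in> B" "y * y \<in> B" using B b y by (auto simp: cstar_subalgebra_def)
  have yh: "\<pi> y h \<in> S" using op_mem y h by blast
  have sym: "ip (\<pi> y u) v = ip u (\<pi> y v)" if "u \<in> S" "v \<in> S" for u v
    using rep_star[of y u v] y that by simp
  have "ip (\<pi> y h) h + ip (\<pi> y h) h = ip (\<pi> (y + y) h) h"
    by (simp only: rep_add[OF y(1) y(1) h] ip_add_left[OF yh yh h])
  also have "\<dots> = ip (\<pi> (star b * b) h) h + ip (\<pi> (y * y) h) h"
    by (simp only: y(3) rep_add[OF mem(2,3) h] ip_add_left[OF op_mem[OF mem(2) h] op_mem[OF mem(3) h] h])
  also have "ip (\<pi> (star b * b) h) h = ip (\<pi> b h) (\<pi> b h)"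
    using mem b h op_mem by (simp add: rep_mult rep_star)
  also have "ip (\<pi> (y * y) h) h = ip (\<pi> y h) (\<pi> y h)"
    using y h yh by (simp add: rep_mult sym)
  finally have eq: "ip (\<pi> y h) h + ip (\<pi> y h) h = ip (\<pi> b h) (\<pi> b h) + ip (\<pi> y h) (\<pi> y h)" .
  have "ip (h - \<pi> y h) (h - \<pi> y h)
      = ip h h - (ip (\<pi> y h) h + ip (\<pi> y h) h) + ip (\<pi> y h) (\<pi> y h)"
    using h yh sym[of h h] by (simp add: ip_diff_left ip_diff_right diff_mem)
  also have "\<dots> = ip h h - ip (\<pi> b h) (\<pi> b h)" by (simp add: eq)
  finally have "0 \<le> Re (ip h h - ip (\<pi> b h) (\<pi> b h))"
    using ip_self_nonneg[OF diff_mem[OF h yh]] by simp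
  then show ?thesis by (simp add: ip_norm_def)
qed

lemma (in star_representation) closed_rep_kernel:
  assumes B: "cstar_subalgebra B"
  shows "closed (rep_kernel S B \<pi>)"
  unfolding closed_sequential_limits
proof (intro allI impI)
  fix X l assume X: "(\<forall>n. X n \<in> rep_kernel S B \<pi>) \<and> X \<longlonglongrightarrow> l"
  have XB: "X n \<in> B" for n using X by (simp add: rep_kernel_def)
  have lB: "l \<in> B"
    by (rule closed_sequentially[of B X]) (use X XB B in \<open>auto simp: cstar_subalgebra_def\<close>)
  have "\<pi> l h = 0" if h: "h \<in> S" for h
  proof (rule ccontr)
    assume nz: "\<pi> l h \<noteq> 0"
    define p where "p = ip_norm ip (\<pi> l h)"
    have p: "p > 0"
      using nz ip_norm_eq_0[OF op_mem[OF lB h]] ip_norm_nonneg[OF op_mem[OF lB h]]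
      unfolding p_def by linarith
    define t where "t = (ip_norm ip h + 1) / p"
    have t: "t > 0" "ip_norm ip h < t * p"
      using p ip_norm_nonneg[OF h] by (auto simp: t_def field_simps)
    obtain n where n: "norm (l - X n) < 1 / t"
      using X t LIMSEQ_D[of X l "1 / t"] by (force simp: norm_minus_commute)
    define d where "d = l + (- 1) *\<^sub>C X n"
    have dB: "d \<in> B" "(- 1) *\<^sub>C X n \<in> B" using lB XB B by (auto simp: d_def cstar_subalgebra_def)
    have "norm (complex_of_real t *\<^sub>C d) = t * norm (l - X n)"
      using t by (simp add: norm_scaleC d_def scaleC_minus_one)
    also have "\<dots> < 1" using n t by (simp add: field_simps)
    finally have "ip_norm ip (\<pi> (complex_of_real t *\<^sub>C d) h) \<le> ip_norm ip h"
      using dB B h by (intro rep_norm_le) (auto simp: cstar_subalgebra_def)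
    moreover have "\<pi> d h = \<pi> l h"
    proof -
      have "\<pi> (X n) h = 0" using X h by (simp add: rep_kernel_def)
      then have "\<pi> ((- 1) *\<^sub>C X n) h = 0"
        using rep_scaleC[OF XB[of n] h, of "- 1"] by (simp add: scaleC_minus_one)
      then show ?thesis unfolding d_def using rep_add[OF lB dB(2) h] by simp
    qed
    moreover have "ip_norm ip (complex_of_real t *\<^sub>C \<pi> l h) = t * p"
      using t op_mem[OF lB h] scaleC_mem[OF op_mem[OF lB h], of t]
      by (simp add: p_def ip_norm_def ip_scaleC_left ip_scaleC_right real_sqrt_mult)
    ultimately show False using t dB h by (simp add: rep_scaleC)
  qed
  then show "l \<in> rep_kernel S B \<pi>" using lB by (simp add: rep_kernel_def)
qed

lemma Prim_subset_Ideal: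
  assumes B: "cstar_subalgebra B"
  shows "Prim B \<subseteq> Ideal B"
proof
  fix J assume "J \<in> Prim B"
  then obtain S :: "('a \<Rightarrow> complex) set" and ip \<pi> where irr: "irreducible_representation S ip B \<pi>"
    and J: "J = rep_kernel S B \<pi>" by (auto simp: Prim_def)
  interpret irreducible_representation S ip B \<pi> by (rule irr)
  have zero: "c *\<^sub>C (0 :: 'a \<Rightarrow> complex) = 0" for c
    by (simp add: scaleC_fun_def scaleC_complex_def zero_fun_def)
  have \<pi>0: "\<pi> b 0 = 0" if "b \<in> B" for b
    using op_add[OF that zero_mem zero_mem] by simp
  have 0: "\<pi> 0 x = 0" if "x \<in> S" for x
    using rep_add[of 0 0 x] that B by (simp add: cstar_subalgebra_def)
  have "\<pi> (b * x) h = 0 \<and> \<pi> (x * b) h = 0" if "b \<in> B" "x \<in> J" "h \<in> S" for b x h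
    using that by (simp add: J rep_kernel_def rep_mult \<pi>0 op_mem)
  then show "J \<in> Ideal B"
    using closed_rep_kernel[OF B] B
    by (auto simp: J Ideal_def rep_kernel_def rep_add rep_scaleC cstar_subalgebra_def 0 zero)
qed

lemma Prim_Int_subset:
  assumes B: "cstar_subalgebra B" and J: "J \<in> Prim B"
    and I: "I1 \<in> Ideal B" "I2 \<in> Ideal B" and sub: "I1 \<inter> I2 \<subseteq> J"
  shows "I1 \<subseteq> J \<or> I2 \<subseteq> J"
proof -
  obtain S :: "('a \<Rightarrow> complex) set" and ip \<pi> where irr: "irreducible_representation S ip B \<pi>"
    and J_eq: "J = rep_kernel S B \<pi>" using J by (auto simp: Prim_def)
  interpret irreducible_representation S ip B \<pi> by (rule irr)
  have I2: "y \<in> B" if "y \<in> I2" for y using that I by (auto simp: Ideal_def)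
  have I1: "y \<in> B" if "y \<in> I1" for y using that I by (auto simp: Ideal_def)
  have \<pi>0: "\<pi> b 0 = 0" if "b \<in> B" for b
    using op_add[OF that zero_mem zero_mem] by simp
  have \<pi>_diff: "\<pi> b (x - y) = \<pi> b x - \<pi> b y" if "b \<in> B" "x \<in> S" "y \<in> S" for b x y
    using op_add[of b "x - y" y] that by (simp add: diff_mem)
  define N where "N = {h \<in> S. \<forall>y\<in>I2. \<pi> y h = 0}"
  have "closed_linear_subspace N"
    unfolding closed_linear_subspace_def
  proof (intro conjI allI ballI impI)
    fix X l assume l: "l \<in> S" and X: "(\<forall>n::nat. X n \<in> N) \<and> (\<lambda>n. ip_norm ip (X n - l)) \<longlonglongrightarrow> 0"
    have "\<pi> y l = 0" if y: "y \<in> I2" for y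
    proof -
      have yB: "y \<in> B" using y I2 by blast
      obtain C where C: "\<And>x. x \<in> S \<Longrightarrow> ip_norm ip (\<pi> y x) \<le> C * ip_norm ip x"
        using op_bounded[OF yB] by blast
      have "ip_norm ip (\<pi> y l) \<le> C * ip_norm ip (X n - l)" for n
      proof -
        have Xn: "X n \<in> S" "\<pi> y (X n) = 0" using X y by (auto simp: N_def)
        have "\<pi> y (X n - l) = - \<pi> y l" using \<pi>_diff[OF yB Xn(1) l] Xn by simp
        moreover have "ip_norm ip (- \<pi> y l) = ip_norm ip (\<pi> y l)"
          using ip_scaleC_left[of "\<pi> y l" "- \<pi> y l" "- 1"] ip_scaleC_right[of "\<pi> y l" "\<pi> y l" "- 1"]
            op_mem[OF yB l] scaleC_mem[of "\<pi> y l" "- 1"]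
          by (simp add: ip_norm_def scaleC_minus_one)
        ultimately show ?thesis using C[OF diff_mem[OF Xn(1) l]] by simp
      qed
      moreover have "(\<lambda>n. C * ip_norm ip (X n - l)) \<longlonglongrightarrow> 0"
        using X tendsto_mult_right_zero by blast
      ultimately have "ip_norm ip (\<pi> y l) \<le> 0"
        by (meson LIMSEQ_le_const)
      then show ?thesis using op_mem[OF yB l] ip_norm_nonneg ip_norm_eq_0 by (metis order_antisym)
    qed
    then show "l \<in> N" using l by (simp add: N_def)
  next
    fix c x assume "x \<in> N" then show "c *\<^sub>C x \<in> N"
      using I2 by (auto simp: N_def scaleC_mem op_scaleC) (simp add: scaleC_fun_def scaleC_complex_def zero_fun_def)
  qed (auto simp: N_def zero_mem add_mem op_add \<pi>0 I2)
  moreover have "\<pi> b h \<in> N" if "b \<in> B" "h \<in> N" for b h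
  proof -
    have "\<pi> y (\<pi> b h) = 0" if y: "y \<in> I2" for y
    proof -
      have "y * b \<in> I2" using y I \<open>b \<in> B\<close> by (auto simp: Ideal_def)
      then show ?thesis using rep_mult[of y b h] y I2 \<open>b \<in> B\<close> \<open>h \<in> N\<close> by (simp add: N_def)
    qed
    then show ?thesis using that by (simp add: N_def op_mem)
  qed
  ultimately have "N = {0} \<or> N = S" using irreducible by blast
  then show ?thesis
  proof
    assume N: "N = {0}"
    have "\<pi> x h = 0" if x: "x \<in> I1" and h: "h \<in> S" for x h
    proof -
      have "\<pi> y (\<pi> x h) = 0" if y: "y \<in> I2" for y
      proof -
        have "y * x \<in> I1 \<inter> I2" using x y I I1 I2 unfolding Ideal_def by blast
        then have "y * x \<in> J" using sub by blast
        then show ?thesis using rep_mult[OF I2[OF y] I1[OF x] h] h by (simp add: J_eq rep_kernel_def)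
      qed
      then have "\<pi> x h \<in> N" using op_mem[OF I1[OF x] h] by (simp add: N_def)
      then show ?thesis using N by simp
    qed
    then show ?thesis using I1 by (auto simp: J_eq rep_kernel_def)
  next
    assume "N = S"
    then show ?thesis using I2 by (auto simp: J_eq rep_kernel_def N_def)
  qed
qed

lemma openin_jacobson_topology:
  assumes B: "cstar_subalgebra B"
  shows "openin (jacobson_topology B) U \<longleftrightarrow> (\<exists>I\<in>Ideal B. U = Prim B - prim_hull B I)"
proof -
  have "istopology (\<lambda>U. \<exists>I\<in>Ideal B. U = Prim B - prim_hull B I)"
    unfolding istopology_def
  proof (intro conjI allI impI)
    fix U V assume "\<exists>I\<in>Ideal B. U = Prim B - prim_hull B I" "\<exists>I\<in>Ideal B. V = Prim B - prim_hull B I"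
    then obtain I1 I2 where I: "I1 \<in> Ideal B" "I2 \<in> Ideal B"
      and UV: "U = Prim B - prim_hull B I1" "V = Prim B - prim_hull B I2" by blast
    have "I1 \<inter> I2 \<in> Ideal B" using I by (auto simp: Ideal_def)
    moreover have "U \<inter> V = Prim B - prim_hull B (I1 \<inter> I2)"
      using Prim_Int_subset[OF B _ I] by (auto simp: UV prim_hull_def)
    ultimately show "\<exists>I\<in>Ideal B. U \<inter> V = Prim B - prim_hull B I" by blast
  next
    fix \<U> assume \<U>: "\<forall>U\<in>\<U>. \<exists>I\<in>Ideal B. U = Prim B - prim_hull B I"
    define G where "G = \<Union>{I \<in> Ideal B. Prim B - prim_hull B I \<in> \<U>}"
    define K where "K = \<Inter>{I \<in> Ideal B. G \<subseteq> I}"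
    have BI: "B \<in> Ideal B" using B by (auto simp: cstar_subalgebra_def Ideal_def)
    have GB: "G \<subseteq> B" by (auto simp: G_def Ideal_def)
    have "K \<in> Ideal B"
    proof -
      have "K \<subseteq> B" using BI GB by (auto simp: K_def)
      moreover have "closed K" unfolding K_def by (rule closed_Inter) (auto simp: Ideal_def)
      ultimately show ?thesis by (auto simp: Ideal_def K_def)
    qed
    moreover have "\<Union>\<U> = Prim B - prim_hull B K"
    proof -
      have "J \<in> \<Union>\<U> \<longleftrightarrow> \<not> K \<subseteq> J" if J: "J \<in> Prim B" for J
      proof -
        have "K \<subseteq> J \<longleftrightarrow> G \<subseteq> J"
          using J Prim_subset_Ideal[OF B] by (auto simp: K_def)
        moreover have "G \<subseteq> J \<longleftrightarrow> J \<notin> \<Union>\<U>"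
        proof
          assume "G \<subseteq> J"
          show "J \<notin> \<Union>\<U>"
          proof
            assume "J \<in> \<Union>\<U>"
            then obtain U where U: "U \<in> \<U>" "J \<in> U" by blast
            then obtain I where I: "I \<in> Ideal B" "U = Prim B - prim_hull B I" using \<U> by blast
            have "I \<subseteq> G" using I U(1) unfolding G_def by blast
            then show False using \<open>G \<subseteq> J\<close> U(2) J I(2) by (auto simp: prim_hull_def)
          qed
        next
          assume "J \<notin> \<Union>\<U>"
          show "G \<subseteq> J"
          proof
            fix x assume "x \<in> G"
            then obtain I where I: "I \<in> Ideal B" "Prim B - prim_hull B I \<in> \<U>" "x \<in> I"
              unfolding G_def by blast
            have "J \<notin> Prim B - prim_hull B I" using \<open>J \<notin> \<Union>\<U>\<close> I(2) by blast
            then show "x \<in> J" using J I(3) by (auto simp: prim_hull_def)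
          qed
        qed
        ultimately show ?thesis by argo
      qed
      moreover have "J \<in> Prim B" if "J \<in> \<Union>\<U>" for J using \<U> that by force
      ultimately show ?thesis unfolding prim_hull_def by blast
    qed
    ultimately show "\<exists>I\<in>Ideal B. \<Union>\<U> = Prim B - prim_hull B I" by blast
  qed
  then show ?thesis by (simp add: jacobson_topology_def)
qed

lemma topspace_jacobson_topology:
  assumes B: "cstar_subalgebra B"
  shows "topspace (jacobson_topology B) = Prim B"
proof -
  have "prim_hull B B = {}"
    by (auto simp: prim_hull_def Prim_def rep_kernel_def dest!: irreducible_representation.nonzero)
  moreover have "B \<in> Ideal B" using B by (auto simp: cstar_subalgebra_def Ideal_def)
  ultimately have "openin (jacobson_topology B) (Prim B)"
    by (auto simp: openin_jacobson_topology[OF B])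
  moreover have "U \<subseteq> Prim B" if "openin (jacobson_topology B) U" for U
    using that by (auto simp: openin_jacobson_topology[OF B])
  ultimately show ?thesis by (metis openin_subset openin_topspace subset_antisym)
qed

lemma closedin_jacobson_topology:
  assumes B: "cstar_subalgebra B"
  shows "closedin (jacobson_topology B) C \<longleftrightarrow> (\<exists>I\<in>Ideal B. C = prim_hull B I)"
  unfolding closedin_def topspace_jacobson_topology[OF B] openin_jacobson_topology[OF B]
  by (auto simp: prim_hull_def)

definition fell_basic :: "'x topology \<Rightarrow> 'x set \<Rightarrow> 'x set set \<Rightarrow> 'x set set" where
  "fell_basic X K F = {Y. closedin X Y \<and> Y \<inter> K = {} \<and> (\<forall>A\<in>F. Y \<inter> A \<noteq> {})}"

definition fell_topology :: "'x topology \<Rightarrow> 'x set topology" where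
  "fell_topology X = topology (arbitrary union_of
     (\<lambda>V. \<exists>K F. compactin X K \<and> finite F \<and> (\<forall>A\<in>F. openin X A \<and> A \<noteq> {}) \<and> V = fell_basic X K F))"

lemma openin_fell_topology:
  "openin (fell_topology X) = arbitrary union_of
     (\<lambda>V. \<exists>K F. compactin X K \<and> finite F \<and> (\<forall>A\<in>F. openin X A \<and> A \<noteq> {}) \<and> V = fell_basic X K F)"
  unfolding fell_topology_def
proof (rule topology_inverse', rule istopology_base)
  fix V W
  assume "\<exists>K F. compactin X K \<and> finite F \<and> (\<forall>A\<in>F. openin X A \<and> A \<noteq> {}) \<and> V = fell_basic X K F"
    and "\<exists>K F. compactin X K \<and> finite F \<and> (\<forall>A\<in>F. openin X A \<and> A \<noteq> {}) \<and> W = fell_basic X K F"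
  then obtain K F K' F' where
    *: "compactin X K" "finite F" "\<forall>A\<in>F. openin X A \<and> A \<noteq> {}" "V = fell_basic X K F"
      "compactin X K'" "finite F'" "\<forall>A\<in>F'. openin X A \<and> A \<noteq> {}" "W = fell_basic X K' F'"
    by blast
  have "V \<inter> W = fell_basic X (K \<union> K') (F \<union> F')"
    unfolding * fell_basic_def by blast
  moreover have "compactin X (K \<union> K')" using * compactin_Un by blast
  ultimately show "\<exists>K F. compactin X K \<and> finite F \<and> (\<forall>A\<in>F. openin X A \<and> A \<noteq> {}) \<and> V \<inter> W = fell_basic X K F"
    using * by (metis Un_iff finite_UnI)
qed

definition fell_ideal :: "'a::cstar_algebra set \<Rightarrow> 'a set topology" where
  "fell_ideal B = pullback_topology (Ideal B) (prim_hull B) (fell_topology (jacobson_topology B))"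

definition Ideal_inf :: "(nat \<Rightarrow> 'a::cstar_algebra set) \<Rightarrow> (nat \<Rightarrow> 'a set) set" where
  "Ideal_inf \<A> = {J \<in> (\<Pi>\<^sub>E n\<in>UNIV. Ideal (\<A> n)). \<forall>n. J (Suc n) \<inter> \<A> n = J n}"

definition fell_inf :: "(nat \<Rightarrow> 'a::cstar_algebra set) \<Rightarrow> (nat \<Rightarrow> 'a set) topology" where
  "fell_inf \<A> = subtopology (product_topology (\<lambda>n. fell_ideal (\<A> n)) UNIV) (Ideal_inf \<A>)"

definition ideal_trace :: "(nat \<Rightarrow> 'a set) \<Rightarrow> 'a set \<Rightarrow> nat \<Rightarrow> 'a set" where
  "ideal_trace \<A> I = (\<lambda>n. I \<inter> \<A> n)"

text \<open>The initial topology on the ideals of the ambient algebra \<open>UNIV\<close> induced by \<open>I \<mapsto> (I \<inter> \<A> n)\<^sub>n\<close>.\<close>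

definition fell_trace :: "(nat \<Rightarrow> 'a::cstar_algebra set) \<Rightarrow> 'a set topology" where
  "fell_trace \<A> = pullback_topology (Ideal UNIV) (ideal_trace \<A>) (fell_inf \<A>)"

end

theory Submission
  imports Defs
begin

text \<open>
  The Fell topology on the ideals of a C*-algebra is generated by two kinds of sets: ``hit'' sets of all \<open>I\<close> that
  lie below some primitive ideal from a given open set, and ``miss'' sets of all \<open>I\<close> that lie below no
  primitive ideal from a given compact set.  Both have to be recognised as open from the traces of
  \<open>I\<close> on the subalgebras \<open>\<A> n\<close>.

  Two tools make this possible.  The first one is the lemma \<open>ideal_threshold_element\<close>: for a
  self-adjoint \<open>h\<close> and \<open>\<delta> > 0\<close> there is an \<open>f\<close>, up to an invertible factor the positive part of
  \<open>h\<^sup>2 - \<delta>\<close>, which lies in an ideal \<open>I\<close> if the distance of \<open>h\<^sup>2\<close> to \<open>I\<close> is less than \<open>\<delta>\<close>, and outside \<open>I\<close> if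
  that distance is greater than \<open>\<delta>\<close>.  As \<open>f\<close> belongs to every C*-subalgebra that contains \<open>h\<close>, a metric
  statement about an ideal is turned into a membership statement about its trace.  In particular, an ideal
  \<open>L\<close> that is not contained in a primitive ideal \<open>J\<close> has a trace \<open>L \<inter> \<A> n\<close> that is not contained in \<open>J\<close>
  (\<open>ideal_subset_primitive_if_traces\<close>): approximate a square in \<open>L - J\<close> by squares from the
  subalgebras and take their threshold elements.

  The second tool is the theorem \<open>primitive_ideal_attaining_distance\<close>: the distance of \<open>h\<^sup>2\<close> to an ideal \<open>I\<close>
  is attained by a primitive ideal above \<open>I\<close>.  It gives enough primitive ideals in all the algebras
  involved, and, because the distance is attained, the sets \<open>{J. \<delta> \<le> infdist (h\<^sup>2) J}\<close> of primitive ideals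
  are compact (\<open>compactin_infdist_ge\<close>).

  Now let \<open>I\<^sub>0\<close> be in a hit set given by the primitive ideals not containing \<open>L\<close>, say \<open>I\<^sub>0 \<subseteq> J\<^sub>0\<close> and
  \<open>\<not> L \<subseteq> J\<^sub>0\<close>.  Then \<open>\<not> L \<inter> \<A> n \<subseteq> J\<^sub>0\<close> for some \<open>n\<close>, and the ideals whose trace on \<open>\<A> n\<close> hits the primitive
  ideals of \<open>\<A> n\<close> not containing \<open>L \<inter> \<A> n\<close> are a neighbourhood of \<open>I\<^sub>0\<close> inside the hit set.  If \<open>I\<^sub>0\<close>
  is in the miss set of a compact \<open>K\<close>, then each \<open>J \<in> K\<close> omits some \<open>h\<^sup>2 \<in> I\<^sub>0 \<inter> \<A> n\<close>, and hence also a
  threshold element \<open>f\<close> of \<open>h\<^sup>2\<close>.  Finitely many \<open>f\<close> suffice for all of \<open>K\<close>.  If the traces of \<open>I\<close> miss the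
  corresponding compact sets \<open>{J. \<delta> \<le> infdist (h\<^sup>2) J}\<close>, then every primitive ideal above \<open>I\<close> contains all
  these \<open>f\<close>, and so is not in \<open>K\<close>.

  Threshold elements are obtained from square roots, which are limits of an iteration.  So is the positivity
  of \<open>y\<^sup>* y\<close>, which turns functionals of norm one into states.  Both are proved in an algebra with unit, to
  which the general case is reduced by the type of unitizations.  The primitive ideals come from the GNS construction for a functional that is
  extreme among those dominated by the distance to \<open>I\<close>.  That such a functional can be chosen to attain
  the distance of \<open>h\<^sup>2\<close> to \<open>I\<close> again follows from threshold elements, which replace the
  C*-identity in the quotient by \<open>I\<close>.
\<close>

section \<open>Square roots and positivity without functional calculus\<close>

lemma star_zero [simp]: "star (0::'a::cstar_algebra) = 0"
  using star_diff[of "0::'a" 0] by simp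

lemma star_scaleR: "star (r *\<^sub>R x) = r *\<^sub>R star (x::'a::cstar_algebra)"
  by (simp add: scaleR_scaleC star_scaleC)

lemma star_one [simp]: "star (1::'a::{cstar_algebra,real_normed_algebra_1}) = 1"
  using star_mult[of "star 1::'a" 1] by (simp add: star_star)

lemma scaleC_diff_right: "c *\<^sub>C (x - y) = c *\<^sub>C x - c *\<^sub>C (y::'a::complex_vector)"
  using scaleC_add_right[of c "x - y" y] by (simp add: algebra_simps)

lemma scaleC_zero_right [simp]: "c *\<^sub>C 0 = (0::'a::complex_vector)"
  using scaleC_diff_right[of c 0 0] by simp

lemma scaleC_minus_right: "c *\<^sub>C (- x) = - (c *\<^sub>C (x::'a::complex_vector))"
  using scaleC_diff_right[of c 0 x] by simp

lemma bounded_linear_star: "bounded_linear (star :: 'a::cstar_algebra \<Rightarrow> 'a)"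
  by (rule bounded_linear_intro[where K = 1]) (simp_all add: star_add star_scaleR norm_star)

lemma continuous_on_star: "continuous_on S (star :: 'a::cstar_algebra \<Rightarrow> 'a)"
  by (rule linear_continuous_on[OF bounded_linear_star])

lemma norm_self_adjoint_square:
  "star h = h \<Longrightarrow> norm (h * h) = (norm (h::'a::cstar_algebra))\<^sup>2"
  using norm_star_mult_self[of h] by simp

definition closed_real_subalgebra :: "'a::real_normed_algebra set \<Rightarrow> bool" where
  "closed_real_subalgebra D \<longleftrightarrow> closed D \<and> subspace D \<and> (\<forall>x\<in>D. \<forall>y\<in>D. x * y \<in> D)"

lemma cstar_subalgebra_subspace: "cstar_subalgebra B \<Longrightarrow> subspace B"
  by (auto simp: cstar_subalgebra_def subspace_def scaleR_scaleC)

text \<open>Iterating \<open>w \<mapsto> (z + w\<^sup>2) / 2\<close> from \<open>0\<close> yields polynomials in \<open>z\<close> with nonnegative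
  coefficients, so that for \<open>norm z \<le> 1\<close> all increments are dominated by those of the scalar
  iteration at \<open>1\<close>, which is monotone and bounded.  The limit \<open>w\<close> is \<open>1 - sqrt (1 - z)\<close>.  Unlike
  a contraction argument this covers the case \<open>norm z = 1\<close>.\<close>

lemma one_minus_sqrt_in_subalgebra:
  fixes z :: "'a::{real_normed_algebra,banach}"
  assumes D: "closed_real_subalgebra D" and z: "z \<in> D" "norm z \<le> 1"
  obtains w where "w \<in> D" "norm w \<le> 1" "w + w = z + w * w"
proof -
  define y where "y = rec_nat 0 (\<lambda>_ w. (1/2::real) *\<^sub>R (z + w * w))"
  define t where "t = rec_nat 0 (\<lambda>_ s. (1 + s * s) / 2 :: real)"
  have y0: "y 0 = 0" and yS: "y (Suc n) = (1/2::real) *\<^sub>R (z + y n * y n)" for n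
    by (simp_all add: y_def)
  have t0: "t 0 = 0" and tS: "t (Suc n) = (1 + t n * t n) / 2" for n
    by (simp_all add: t_def)
  have t01: "0 \<le> t n \<and> t n \<le> 1" for n
  proof (induction n)
    case (Suc n)
    then have "t n * t n \<le> 1" by (simp add: mult_le_one)
    then show ?case by (simp add: tS)
  qed (simp add: t0)
  have yt: "norm (y n) \<le> t n" for n
  proof (induction n)
    case (Suc n)
    have "norm (z + y n * y n) \<le> norm z + norm (y n * y n)" by (rule norm_triangle_ineq)
    also have "\<dots> \<le> 1 + norm (y n) * norm (y n)" by (intro add_mono z norm_mult_ineq)
    also have "\<dots> \<le> 1 + t n * t n" using Suc t01[of n] by (intro add_left_mono mult_mono) auto
    finally show ?case by (simp add: yS tS)
  qed (simp add: y0 t0)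
  have tm: "t n \<le> t (Suc n)" for n
    using sum_squares_bound[of "t n" 1] by (simp add: tS power2_eq_square)
  have step: "norm (y (Suc n) - y n) \<le> t (Suc n) - t n" for n
  proof (induction n)
    case 0
    then show ?case using z(2) by (simp add: y0 yS t0 tS)
  next
    case (Suc n)
    have "y (Suc (Suc n)) - y (Suc n)
        = (1/2::real) *\<^sub>R (y (Suc n) * y (Suc n) - y n * y n)"
      by (subst yS, subst (3) yS) (simp add: scaleR_diff_right[symmetric])
    also have "\<dots> = (1/2::real) *\<^sub>R (y (Suc n) * (y (Suc n) - y n) + (y (Suc n) - y n) * y n)"
      by (simp add: algebra_simps)
    finally have "norm (y (Suc (Suc n)) - y (Suc n))
        = norm (y (Suc n) * (y (Suc n) - y n) + (y (Suc n) - y n) * y n) / 2" by simp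
    also have "\<dots> \<le> (norm (y (Suc n)) * norm (y (Suc n) - y n) + norm (y (Suc n) - y n) * norm (y n)) / 2"
      by (intro divide_right_mono order.trans[OF norm_triangle_ineq] add_mono norm_mult_ineq) auto
    also have "\<dots> \<le> (t (Suc n) * (t (Suc n) - t n) + (t (Suc n) - t n) * t n) / 2"
      using Suc yt t01 tm by (intro divide_right_mono add_mono mult_mono) auto
    also have "\<dots> = t (Suc (Suc n)) - t (Suc n)"
      by (subst tS[of "Suc n"], subst (3) tS) (simp add: field_simps)
    finally show ?case .
  qed
  have "incseq t"
    by (rule incseq_SucI) (rule tm)
  then have "convergent t"
    unfolding convergent_def using t01 incseq_convergent[of t 1] by metis
  then have tC: "Cauchy t" by (simp add: convergent_Cauchy)
  have diff: "norm (y (n + k) - y n) \<le> t (n + k) - t n" for n k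
  proof (induction k)
    case (Suc k)
    have "norm (y (n + Suc k) - y n) \<le> norm (y (Suc (n + k)) - y (n + k)) + norm (y (n + k) - y n)"
      using norm_triangle_ineq[of "y (Suc (n + k)) - y (n + k)" "y (n + k) - y n"] by simp
    then show ?case using Suc step[of "n + k"] by simp
  qed simp
  have "Cauchy y"
  proof (rule CauchyI')
    fix e :: real assume "e > 0"
    then obtain M where M: "\<And>m n. m \<ge> M \<Longrightarrow> n \<ge> M \<Longrightarrow> norm (t m - t n) < e"
      using CauchyD[OF tC] by blast
    have "norm (y m - y n) < e" if "m \<ge> M" "n > m" for m n
      using diff[of m "n - m"] M[of n m] that by (simp add: norm_minus_commute)
    then show "\<exists>M. \<forall>m\<ge>M. \<forall>n>m. dist (y m) (y n) < e" by (auto simp: dist_norm)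
  qed
  then obtain w where w: "y \<longlonglongrightarrow> w" using convergent_eq_Cauchy[of y] by blast
  have "y n \<in> D" for n
    by (induction n) (use D z in \<open>auto simp: y0 yS closed_real_subalgebra_def subspace_add subspace_scale subspace_0\<close>)
  then have "w \<in> D"
    using D w closed_sequentially[of D y w] by (auto simp: closed_real_subalgebra_def)
  moreover have "norm w \<le> 1"
    by (rule LIMSEQ_le_const2[OF tendsto_norm[OF w]]) (use yt t01 order.trans in blast)
  moreover have "(\<lambda>n. y (Suc n)) \<longlonglongrightarrow> (1/2::real) *\<^sub>R (z + w * w)"
    unfolding yS by (intro tendsto_intros w)
  then have "w = (1/2::real) *\<^sub>R (z + w * w)"
    using LIMSEQ_unique LIMSEQ_Suc[OF w] by blast
  then have "w + w = z + w * w"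
    by (metis scaleR_half_double scaleR_right_distrib)
  ultimately show ?thesis by (rule that)
qed

text \<open>The solution is \<open>(1 - a)\<^sup>-\<^sup>1 g\<close>, in a form that makes sense in a subspace without unit.\<close>

lemma neumann_equation_in_subspace:
  fixes a :: "'a::{real_normed_algebra,banach}"
  assumes D: "closed D" "subspace D" "\<And>x. x \<in> D \<Longrightarrow> a * x \<in> D" and a: "norm a < 1" and g: "g \<in> D"
  obtains x where "x \<in> D" "x = g + a * x"
proof -
  have "\<exists>!x\<in>D. (\<lambda>x. g + a * x) x = x"
  proof (rule Banach_fix[of D "norm a"])
    show "complete D" using D(1) by (simp add: complete_eq_closed)
    show "D \<noteq> {}" using g by blast
    show "(\<lambda>x. g + a * x) ` D \<subseteq> D" using D g by (auto intro: subspace_add)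
    show "dist (g + a * x) (g + a * y) \<le> norm a * dist x y" for x y
      by (simp add: dist_norm right_diff_distrib[symmetric] norm_mult_ineq)
  qed (use a in auto)
  then show ?thesis using that by metis
qed

text \<open>The self-adjoint part of the bicommutant of \<open>h\<close>, cut down to \<open>B\<close>: a commutative algebra
  closed under all the limits below, which serves as a substitute for functional calculus of \<open>h\<close>.\<close>

definition sa_bicommutant :: "'a::cstar_algebra set \<Rightarrow> 'a \<Rightarrow> 'a set" where
  "sa_bicommutant B h = {x \<in> B. star x = x \<and> (\<forall>u. u * h = h * u \<longrightarrow> u * x = x * u)}"

lemma sa_bicommutantD: "x \<in> sa_bicommutant B h \<Longrightarrow> x \<in> B" "x \<in> sa_bicommutant B h \<Longrightarrow> star x = x"
  by (simp_all add: sa_bicommutant_def)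

lemma sa_bicommutant_self: "h \<in> B \<Longrightarrow> star h = h \<Longrightarrow> h \<in> sa_bicommutant B h"
  by (simp add: sa_bicommutant_def)

lemma sa_bicommutant_commute:
  assumes "x \<in> sa_bicommutant B h" "y \<in> sa_bicommutant B h"
  shows "x * y = y * x"
proof -
  have "h * h = h * h \<longrightarrow> h * x = x * h" using assms(1) by (simp add: sa_bicommutant_def)
  then show ?thesis using assms(2) by (simp add: sa_bicommutant_def)
qed

lemma closed_real_subalgebra_sa_bicommutant:
  assumes B: "cstar_subalgebra B"
  shows "closed_real_subalgebra (sa_bicommutant B h)"
  unfolding closed_real_subalgebra_def
proof (intro conjI ballI)
  have eq: "sa_bicommutant B h = B \<inter> {x. star x = x} \<inter> (\<Inter>u\<in>{u. u * h = h * u}. {x. u * x = x * u})"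
    by (auto simp: sa_bicommutant_def)
  show "closed (sa_bicommutant B h)"
    unfolding eq using B
    by (intro closed_Int closed_INT closed_Collect_eq continuous_on_star continuous_intros ballI)
      (auto simp: cstar_subalgebra_def)
  show "subspace (sa_bicommutant B h)"
    using cstar_subalgebra_subspace[OF B]
    by (auto simp: sa_bicommutant_def subspace_def star_add star_scaleR algebra_simps)
  fix x y assume xy: "x \<in> sa_bicommutant B h" "y \<in> sa_bicommutant B h"
  have "u * (x * y) = x * y * u" if "u * h = h * u" for u
  proof -
    have "u * x = x * u" "u * y = y * u" using xy that by (simp_all add: sa_bicommutant_def)
    then show ?thesis by (metis mult.assoc)
  qed
  moreover have "star (x * y) = x * y"
    using sa_bicommutant_commute[OF xy] by (simp add: star_mult sa_bicommutantD(2)[OF xy(1)] sa_bicommutantD(2)[OF xy(2)])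
  moreover have "x * y \<in> B"
    using B sa_bicommutantD(1)[OF xy(1)] sa_bicommutantD(1)[OF xy(2)] by (simp add: cstar_subalgebra_def)
  ultimately show "x * y \<in> sa_bicommutant B h"
    by (simp add: sa_bicommutant_def)
qed

lemma cstar_subalgebra_UNIV: "cstar_subalgebra UNIV"
  by (simp add: cstar_subalgebra_def)

lemma one_mem_sa_bicommutant:
  "1 \<in> B \<Longrightarrow> (1::'a::{cstar_algebra,real_normed_algebra_1}) \<in> sa_bicommutant B h"
  by (simp add: sa_bicommutant_def)

text \<open>The element \<open>u = h + \<i> k\<close> satisfies \<open>u\<^sup>* u = r\<close>, and \<open>h\<close> is its real part.\<close>

lemma norm_le_of_squares_sum:
  fixes h k :: "'a::{cstar_algebra,real_normed_algebra_1}"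
  assumes sa: "star h = h" "star k = k" and comm: "h * k = k * h"
    and sum: "h * h + k * k = r *\<^sub>R 1" and r: "0 \<le> r"
  shows "(norm h)\<^sup>2 \<le> r"
proof -
  define u where "u = h + \<i> *\<^sub>C k"
  have su: "star u = h - \<i> *\<^sub>C k"
    by (simp add: u_def star_add star_scaleC sa scaleC_minus_left)
  have "star u * u = h * h + k * k"
    unfolding su unfolding u_def
    by (simp add: algebra_simps mult_scaleC_left mult_scaleC_right scaleC_scaleC scaleC_add_right
        scaleC_diff_right comm scaleC_minus_one)
  then have u: "(norm u)\<^sup>2 = r"
    using norm_star_mult_self[of u] sum r by simp
  have "u + star u = 2 *\<^sub>R h" unfolding su by (simp add: u_def scaleR_2)
  then have "2 * norm h = norm (u + star u)" by simp
  also have "\<dots> \<le> norm u + norm u" using norm_triangle_ineq[of u "star u"] by (simp add: norm_star)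
  finally show ?thesis using u by (metis mult_2 mult_le_cancel_left_pos norm_ge_zero power_mono zero_less_numeral)
qed

lemma sqrt_of_scalar_minus:
  fixes z :: "'a::{cstar_algebra,real_normed_algebra_1}"
  assumes D: "closed_real_subalgebra D" "1 \<in> D" and z: "z \<in> D" "norm z \<le> r"
  obtains k where "k \<in> D" "k * k = r *\<^sub>R 1 - z"
proof (cases "r = 0")
  case True
  then show ?thesis using that[of 0] z D by (auto simp: closed_real_subalgebra_def subspace_0)
next
  case False
  then have r: "r > 0" using z norm_ge_zero[of z] by linarith
  have sub: "subspace D" using D by (simp add: closed_real_subalgebra_def)
  obtain w where w: "w \<in> D" "w + w = (1 / r) *\<^sub>R z + w * w"
    by (rule one_minus_sqrt_in_subalgebra[OF D(1), of "(1 / r) *\<^sub>R z"])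
      (use z r sub in \<open>auto simp: subspace_scale field_simps\<close>)
  show ?thesis
  proof (rule that[of "sqrt r *\<^sub>R (1 - w)"])
    show "sqrt r *\<^sub>R (1 - w) \<in> D" using w D sub by (intro subspace_scale subspace_diff)
    have "(1 - w) * (1 - w) = 1 - (w + w) + w * w" by (simp add: algebra_simps)
    also have "\<dots> = 1 - (1 / r) *\<^sub>R z" by (simp add: w(2))
    finally have "(1 - w) * (1 - w) = 1 - (1 / r) *\<^sub>R z" .
    then show "(sqrt r *\<^sub>R (1 - w)) * (sqrt r *\<^sub>R (1 - w)) = r *\<^sub>R 1 - z"
      using r scaleR_diff_right[of r 1 "(1 / r) *\<^sub>R z"]
      by (simp only: mult_scaleR_left mult_scaleR_right scaleR_scaleR) simp
  qed
qed

text \<open>As \<open>r - h\<^sup>2\<close> has a square root \<open>k\<close> that commutes with \<open>h\<close>, the equation \<open>h\<^sup>2 + k\<^sup>2 = r\<close> bounds \<open>k\<close> as well.\<close>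

lemma norm_scalar_minus_square_le:
  fixes h :: "'a::{cstar_algebra,real_normed_algebra_1}"
  assumes h: "star h = h" "(norm h)\<^sup>2 \<le> r"
  shows "norm (r *\<^sub>R 1 - h * h) \<le> r"
proof -
  let ?D = "sa_bicommutant UNIV h"
  have D: "closed_real_subalgebra ?D" "1 \<in> ?D" "h \<in> ?D"
    by (simp_all add: closed_real_subalgebra_sa_bicommutant cstar_subalgebra_UNIV
        one_mem_sa_bicommutant sa_bicommutant_self h)
  then have "h * h \<in> ?D" by (simp add: closed_real_subalgebra_def)
  then obtain k where k: "k \<in> ?D" "k * k = r *\<^sub>R 1 - h * h"
    using sqrt_of_scalar_minus[OF D(1,2), of "h * h" r] norm_self_adjoint_square[OF h(1)] h(2) by auto
  have "(norm k)\<^sup>2 \<le> r"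
    using norm_le_of_squares_sum[OF sa_bicommutantD(2)[OF k(1)] h(1) sa_bicommutant_commute[OF k(1) D(3)]]
      k(2) order.trans[OF zero_le_power2 h(2)] by simp
  then show ?thesis
    using norm_self_adjoint_square[OF sa_bicommutantD(2)[OF k(1)]] k(2) by simp
qed

text \<open>With \<open>k = (1 - v\<^sup>2) / (1 + v\<^sup>2)\<close> the element \<open>f\<close> is the positive function \<open>\<bar>k\<bar> - k\<close> of \<open>v\<close>,
  which vanishes exactly where \<open>v\<^sup>2 \<le> 1\<close>.  The two equations make this readable in every quotient:
  with \<open>norm y \<le> 1\<close>, the first forces \<open>f\<close> to vanish where \<open>norm (v\<^sup>2) < 1\<close> and the second forces
  \<open>norm (v\<^sup>2) \<le> 1\<close> where \<open>f\<close> vanishes.\<close>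

lemma threshold_element_unital:
  fixes v :: "'a::{cstar_algebra,real_normed_algebra_1}"
  assumes B: "cstar_subalgebra B" and v: "v \<in> B" "star v = v"
  obtains f y where "f \<in> B" "y \<in> B" "norm y \<le> 1"
    "f + f = f * y + f * (v * v * y)" "v * v * y + y + f + v * v * f = v * v + v * v"
proof -
  let ?D = "sa_bicommutant B v"
  have D: "closed_real_subalgebra ?D" by (rule closed_real_subalgebra_sa_bicommutant[OF B])
  have sub: "subspace ?D" and closed: "closed ?D" and mult: "\<And>x y. x \<in> ?D \<Longrightarrow> y \<in> ?D \<Longrightarrow> x * y \<in> ?D"
    using D by (auto simp: closed_real_subalgebra_def)
  have vD: "v \<in> ?D" using v by (simp add: sa_bicommutant_self)
  define b where "b = v * v"
  have bD: "b \<in> ?D" using vD mult by (simp add: b_def)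
  define r where "r = (norm v)\<^sup>2"
  have r: "0 \<le> r" by (simp add: r_def)
  define a where "a = (1 / (1 + r)) *\<^sub>R (r *\<^sub>R 1 - b)"
  have "norm (r *\<^sub>R 1 - b) \<le> r"
    unfolding b_def by (rule norm_scalar_minus_square_le) (use v in \<open>auto simp: r_def\<close>)
  then have a: "norm a < 1" using r by (simp add: a_def)
  have aD: "a * x \<in> ?D" if "x \<in> ?D" for x
  proof -
    have "a * x = (1 / (1 + r)) *\<^sub>R (r *\<^sub>R x - b * x)" by (simp add: a_def left_diff_distrib)
    then show ?thesis using that bD sub mult by (auto intro!: subspace_scale subspace_diff)
  qed
  \<comment> \<open>\<open>c = v\<^sup>2 / (1 + v\<^sup>2)\<close>, where \<open>1 + v\<^sup>2 = (1 + r) (1 - a)\<close>\<close>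
  obtain c where c: "c \<in> ?D" "c = (1 / (1 + r)) *\<^sub>R b + a * c"
    by (rule neumann_equation_in_subspace[OF closed sub aD a, of "(1 / (1 + r)) *\<^sub>R b"])
      (use bD sub in \<open>auto intro: subspace_scale\<close>)
  have "(1 + r) *\<^sub>R c = (1 + r) *\<^sub>R ((1 / (1 + r)) *\<^sub>R b + a * c)" using c(2) by metis
  also have "\<dots> = b + r *\<^sub>R c - b * c"
    using r by (simp add: a_def scaleR_right_distrib left_diff_distrib)
  finally have cb: "c + b * c = b" by (simp add: algebra_simps)
  note comm = sa_bicommutant_commute
  have vc: "c * v = v * c" and bc: "c * b = b * c" using comm c(1) vD bD by auto
  \<comment> \<open>\<open>z = 1 - k\<^sup>2\<close> has norm at most \<open>1\<close> because it is the square of \<open>2 v / (1 + v\<^sup>2)\<close>\<close>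
  define e where "e = 2 *\<^sub>R (v - v * c)"
  define k where "k = 1 - 2 *\<^sub>R c"
  define z where "z = 4 *\<^sub>R (c - c * c)"
  have eD: "e \<in> ?D" and zD: "z \<in> ?D"
    using c(1) vD sub mult by (auto simp: e_def z_def intro!: subspace_scale subspace_diff)
  have "(v - v * c) * (v - v * c) = (b - b * c) - (b - b * c) * c"
    by (simp add: b_def algebra_simps) (metis vc mult.assoc)
  also have "b - b * c = c" using cb by (simp add: algebra_simps)
  finally have ee: "e * e = z" by (simp add: e_def z_def)
  have "star c = c" "star e = e" using c(1) eD by (simp_all add: sa_bicommutantD(2))
  moreover have "e * k = k * e"
    using comm[OF eD c(1)] by (simp add: k_def algebra_simps)
  moreover have "e * e + k * k = 1 *\<^sub>R 1"
    by (simp add: ee z_def k_def algebra_simps) (simp add: scaleR_left_distrib[symmetric] scaleR_2[symmetric])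
  ultimately have "(norm e)\<^sup>2 \<le> 1"
    by (intro norm_le_of_squares_sum[of e k 1]) (simp_all add: k_def star_diff star_scaleR)
  then have "norm z \<le> 1" using norm_mult_ineq[of e e] by (simp add: ee power2_eq_square)
  then obtain y where y: "y \<in> ?D" "norm y \<le> 1" "y + y = z + y * y"
    using one_minus_sqrt_in_subalgebra[OF D zD] by blast
  have yc: "y * c = c * y" and yb: "y * b = b * y" using comm c(1) y(1) bD by auto
  define f where "f = 2 *\<^sub>R c - y"
  have fD: "f \<in> ?D" using c(1) y(1) sub by (auto simp: f_def intro!: subspace_scale subspace_diff)
  have fb: "f * b = b * f" and fc: "f * c = c * f" using comm[OF fD] bD c(1) by auto
  have one: "(y + f) + b * (y + f) = 2 *\<^sub>R b"
  proof -
    have "(y + f) + b * (y + f) = 2 *\<^sub>R (c + b * c)" by (simp add: f_def algebra_simps)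
    then show ?thesis by (simp add: cb)
  qed
  have "f + f = 4 *\<^sub>R c - (y + y)" by (simp add: f_def algebra_simps scaleR_left_distrib[symmetric] flip: scaleR_2)
  also have "\<dots> = f * (2 *\<^sub>R c + y)"
    unfolding y(3) z_def f_def by (simp add: algebra_simps yc)
  finally have ff: "f + f = f * (2 *\<^sub>R c + y)" .
  have "f + f + (b * f + b * f) = (f + f) + b * (f + f)" by (simp add: algebra_simps)
  also have "\<dots> = f * (2 *\<^sub>R c + y) + f * (b * (2 *\<^sub>R c + y))"
    unfolding ff by (metis fb mult.assoc)
  also have "\<dots> = f * (2 *\<^sub>R (c + b * c)) + f * y + f * (b * y)" by (simp add: algebra_simps)
  also have "\<dots> = (b * f + b * f) + f * y + f * (b * y)" unfolding cb by (simp add: fb scaleR_2 distrib_left)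
  finally have "f + f = f * y + f * (b * y)" by (simp add: algebra_simps)
  moreover have "b * y + y + f + b * f = b + b" using one by (simp add: algebra_simps scaleR_2)
  ultimately show ?thesis
    using that[of f y] sa_bicommutantD(1)[OF fD] sa_bicommutantD(1)[OF y(1)] y(2) by (simp add: b_def)
qed

lemma real_imaginary_parts:
  fixes x :: "'a::cstar_algebra"
  obtains h k where "star h = h" "star k = k" "x = h + \<i> *\<^sub>C k" "star x = h - \<i> *\<^sub>C k"
proof -
  define h where "h = (1/2::real) *\<^sub>R (x + star x)"
  define k where "k = (1/2::real) *\<^sub>R (- \<i> *\<^sub>C (x - star x))"
  have ik: "\<i> *\<^sub>C k = (1/2::real) *\<^sub>R (x - star x)"
    by (simp add: k_def scaleR_scaleC scaleC_scaleC scaleC_one)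
  have "h + \<i> *\<^sub>C k = (1/2::real) *\<^sub>R (x + x)" "h - \<i> *\<^sub>C k = (1/2::real) *\<^sub>R (star x + star x)"
    unfolding ik h_def by (simp_all add: algebra_simps)
  moreover have "star h = h" by (simp add: h_def star_scaleR star_add star_star add.commute)
  moreover have "star k = k"
    by (simp add: k_def star_scaleR star_scaleC star_diff star_star scaleC_minus_left
        scaleC_diff_right)
  ultimately show ?thesis by (intro that[of h k]) simp_all
qed

text \<open>If \<open>v\<^sup>* v = - e\<^sup>2\<close>, then \<open>v v\<^sup>* = 2 h\<^sup>2 + 2 k\<^sup>2 + e\<^sup>2\<close> is positive, so \<open>\<mu> + v v\<^sup>*\<close> is invertible for
  \<open>\<mu> = norm (e\<^sup>2)\<close>, and hence so is \<open>\<mu> + v\<^sup>* v = \<mu> - e\<^sup>2\<close>.  But an inverse of norm \<open>M\<close> would give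
  \<open>e\<^sup>2 \<le> \<mu> - 1 / M\<close>.\<close>

lemma star_mult_self_not_negative:
  fixes v e :: "'a::{cstar_algebra,real_normed_algebra_1}"
  assumes v: "star v * v = - (e * e)" and e: "star e = e"
  shows "v = 0"
proof (rule ccontr)
  assume "v \<noteq> 0"
  define \<mu> where "\<mu> = (norm e)\<^sup>2"
  have nv: "(norm v)\<^sup>2 = \<mu>"
    using norm_star_mult_self[of v] norm_self_adjoint_square[OF e] by (simp add: v \<mu>_def)
  with \<open>v \<noteq> 0\<close> have \<mu>: "\<mu> > 0" by (metis norm_eq_zero zero_less_power2)
  obtain h k where hk: "star h = h" "star k = k" "v = h + \<i> *\<^sub>C k" "star v = h - \<i> *\<^sub>C k"
    by (rule real_imaginary_parts)
  define P where "P = v * star v"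
  have "star v * v + v * star v = 2 *\<^sub>R (h * h) + 2 *\<^sub>R (k * k)"
    unfolding hk(4) unfolding hk(3)
    by (simp add: algebra_simps mult_scaleC_left mult_scaleC_right scaleC_scaleC scaleC_minus_one
        scaleC_add_right scaleC_diff_right scaleR_2)
  then have P: "P = 2 *\<^sub>R (h * h) + 2 *\<^sub>R (k * k) + e * e" by (simp add: P_def v algebra_simps)
  define T where "T = 2 * (norm h)\<^sup>2 + 2 * (norm k)\<^sup>2 + (norm e)\<^sup>2"
  have T: "T \<ge> 0" by (simp add: T_def)
  have "T *\<^sub>R 1 - P = 2 *\<^sub>R ((norm h)\<^sup>2 *\<^sub>R 1 - h * h) + 2 *\<^sub>R ((norm k)\<^sup>2 *\<^sub>R 1 - k * k)
      + ((norm e)\<^sup>2 *\<^sub>R 1 - e * e)"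
    by (simp add: T_def P algebra_simps)
  also have "norm \<dots> \<le> 2 * (norm h)\<^sup>2 + 2 * (norm k)\<^sup>2 + (norm e)\<^sup>2"
    using norm_scalar_minus_square_le[OF hk(1) order_refl] norm_scalar_minus_square_le[OF hk(2) order_refl]
      norm_scalar_minus_square_le[OF e order_refl]
    by (intro order.trans[OF norm_triangle_ineq] add_mono) simp_all
  finally have TP: "norm (T *\<^sub>R 1 - P) \<le> T" by (simp add: T_def)
  define a where "a = (1 / (\<mu> + T)) *\<^sub>R (T *\<^sub>R 1 - P)"
  have "norm a < 1" using TP T \<mu> by (simp add: a_def)
  then obtain Q where Q: "Q = (1 / (\<mu> + T)) *\<^sub>R 1 + a * Q"
    using neumann_equation_in_subspace[of UNIV a "(1 / (\<mu> + T)) *\<^sub>R 1"] by auto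
  have "(\<mu> + T) *\<^sub>R Q = (\<mu> + T) *\<^sub>R ((1 / (\<mu> + T)) *\<^sub>R 1 + a * Q)" using Q by metis
  also have "\<dots> = 1 + T *\<^sub>R Q - P * Q"
    using T \<mu> by (simp add: a_def scaleR_right_distrib left_diff_distrib)
  finally have Q: "\<mu> *\<^sub>R Q + P * Q = 1" by (simp add: algebra_simps)
  define X where "X = (1 / \<mu>) *\<^sub>R (1 - star v * Q * v)"
  let ?D = "sa_bicommutant UNIV e"
  have D: "closed_real_subalgebra ?D" by (simp add: closed_real_subalgebra_sa_bicommutant cstar_subalgebra_UNIV)
  have D1: "1 \<in> ?D" and eD: "e \<in> ?D" using e by (simp_all add: one_mem_sa_bicommutant sa_bicommutant_self)
  have sub: "subspace ?D" and mult: "\<And>x y. x \<in> ?D \<Longrightarrow> y \<in> ?D \<Longrightarrow> x * y \<in> ?D"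
    using D by (auto simp: closed_real_subalgebra_def)
  obtain s where s: "s \<in> ?D" "s * s = \<mu> *\<^sub>R 1 - e * e"
    using sqrt_of_scalar_minus[OF D D1 mult[OF eD eD], of \<mu>] norm_self_adjoint_square[OF e] by (auto simp: \<mu>_def)
  have "(\<mu> *\<^sub>R 1 + star v * v) * (1 - star v * Q * v)
      = \<mu> *\<^sub>R 1 + star v * v - star v * (\<mu> *\<^sub>R Q + P * Q) * v"
    by (simp add: P_def algebra_simps)
  also have "\<dots> = \<mu> *\<^sub>R 1" by (simp add: Q)
  finally have sX: "s * s * X = 1" using \<mu> by (simp add: X_def s v)
  have ss: "star (s * s) = s * s" using s(1) by (simp add: star_mult sa_bicommutantD(2))
  then have Xs: "star X * (s * s) = 1" using sX star_one star_mult by metis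
  then have X_sa: "star X = X" using sX by (metis mult.assoc mult_1_left mult_1_right)
  have "u * X = X * u" if "u * e = e * u" for u
  proof -
    have us: "u * (s * s) = (s * s) * u"
      using that mult[OF s(1) s(1)] by (simp add: sa_bicommutant_def)
    have "u * X = (X * (s * s)) * (u * X)" using Xs X_sa by simp
    also have "\<dots> = X * ((s * s) * u) * X" by (simp add: mult.assoc)
    also have "\<dots> = X * u * (s * s * X)" by (metis us mult.assoc)
    finally show ?thesis by (simp add: sX)
  qed
  then have XD: "X \<in> ?D" using X_sa by (simp add: sa_bicommutant_def)
  define M where "M = norm X"
  have M: "M > 0" using sX by (auto simp: M_def)
  obtain w where w: "w \<in> ?D" "w * w = M *\<^sub>R 1 - X"
    using sqrt_of_scalar_minus[OF D D1 XD] by (auto simp: M_def)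
  define j where "j = sqrt (1 / M) *\<^sub>R (s * w)"
  have jD: "j \<in> ?D" using s w sub mult by (auto simp: j_def intro: subspace_scale)
  have "j * j = (1 / M) *\<^sub>R ((s * w) * (s * w))" using M by (simp add: j_def)
  also have "(s * w) * (s * w) = (s * s) * (w * w)"
    using sa_bicommutant_commute[OF w(1) s(1)] by (metis mult.assoc)
  also have "(1 / M) *\<^sub>R \<dots> = s * s - (1 / M) *\<^sub>R 1"
    using M by (simp add: w right_diff_distrib sX scaleR_diff_right)
  finally have "e * e + j * j = (\<mu> - 1 / M) *\<^sub>R 1" by (simp add: s algebra_simps)
  moreover have "0 \<le> \<mu> - 1 / M"
  proof -
    have "1 \<le> norm (s * s) * M" using norm_mult_ineq[of "s * s" X] sX by (simp add: M_def)
    also have "\<dots> \<le> \<mu> * M"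
      using norm_scalar_minus_square_le[OF e, of \<mu>] M unfolding s by (intro mult_right_mono) (auto simp: \<mu>_def)
    finally show ?thesis using M by (simp add: field_simps)
  qed
  ultimately have "(norm e)\<^sup>2 \<le> \<mu> - 1 / M"
    using norm_le_of_squares_sum[OF e sa_bicommutantD(2)[OF jD] sa_bicommutant_commute[OF eD jD]] by blast
  then show False using M by (simp add: \<mu>_def)
qed

text \<open>With \<open>a = y\<^sup>* y\<close> and \<open>n = \<bar>a\<bar> - a\<close>, the element \<open>y n\<close> satisfies \<open>(y n)\<^sup>* (y n) = n a n = - \<bar>a\<bar> n\<^sup>2\<close>,
  the negative of a square; so it vanishes, which makes \<open>a = \<bar>a\<bar>\<close> itself a square.\<close>

lemma norm_scalar_minus_star_mult_self_le:
  fixes y :: "'a::{cstar_algebra,real_normed_algebra_1}"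
  shows "norm ((norm y)\<^sup>2 *\<^sub>R 1 - star y * y) \<le> (norm y)\<^sup>2"
proof (cases "y = 0")
  case False
  define a where "a = star y * y"
  define r where "r = (norm y)\<^sup>2"
  have r: "r > 0" using False by (simp add: r_def)
  have a: "star a = a" "norm a = r" by (simp_all add: a_def r_def star_mult star_star norm_star_mult_self)
  let ?D = "sa_bicommutant UNIV a"
  have D: "closed_real_subalgebra ?D" by (simp add: closed_real_subalgebra_sa_bicommutant cstar_subalgebra_UNIV)
  have D1: "1 \<in> ?D" and aD: "a \<in> ?D" using a by (simp_all add: one_mem_sa_bicommutant sa_bicommutant_self)
  have sub: "subspace ?D" and mult: "\<And>x y. x \<in> ?D \<Longrightarrow> y \<in> ?D \<Longrightarrow> x * y \<in> ?D"
    using D by (auto simp: closed_real_subalgebra_def)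
  note comm = sa_bicommutant_commute
  define z where "z = (1 / r\<^sup>2) *\<^sub>R (r\<^sup>2 *\<^sub>R 1 - a * a)"
  have zD: "z \<in> ?D" using aD D1 mult sub by (auto simp: z_def intro!: subspace_scale subspace_diff)
  have "norm (r\<^sup>2 *\<^sub>R 1 - a * a) \<le> r\<^sup>2"
    using norm_scalar_minus_square_le[OF a(1), of "r\<^sup>2"] a(2) by simp
  then have "norm z \<le> 1" using r unfolding z_def norm_scaleR by simp
  then obtain w where w: "w \<in> ?D" "norm w \<le> 1" "w + w = z + w * w"
    using one_minus_sqrt_in_subalgebra[OF D zD] by blast
  \<comment> \<open>the absolute value of \<open>a\<close>, again a square\<close>
  define A where "A = r *\<^sub>R (1 - w)"
  have AD: "A \<in> ?D" using w D1 sub by (auto simp: A_def intro!: subspace_scale subspace_diff)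
  have "(1 - w) * (1 - w) = 1 - (w + w) + w * w" by (simp add: algebra_simps)
  also have "\<dots> = 1 - z" by (simp add: w(3))
  finally have "A * A = r\<^sup>2 *\<^sub>R (1 - z)" by (simp add: A_def power2_eq_square)
  also have "\<dots> = a * a" using r by (simp add: z_def scaleR_diff_right)
  finally have AA: "A * A = a * a" .
  obtain l where l: "l \<in> ?D" "l * l = A"
  proof -
    obtain k where k: "k \<in> ?D" "k * k = 1 *\<^sub>R 1 - w"
      using sqrt_of_scalar_minus[OF D D1 w(1,2)] by blast
    show ?thesis
      by (rule that[of "sqrt r *\<^sub>R k"]) (use k r sub in \<open>auto simp: A_def intro: subspace_scale\<close>)
  qed
  define n where "n = A - a"
  have nD: "n \<in> ?D" using AD aD sub by (simp add: n_def subspace_diff)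
  have aA: "a * A = A * a" by (rule comm[OF aD AD])
  have an: "a * n = - (n * A)" by (simp add: n_def algebra_simps AA aA)
  have nA: "n * A = A * n" by (rule comm[OF nD AD])
  have nl: "n * l = l * n" by (rule comm[OF nD l(1)])
  have "star (y * n) * (y * n) = n * (a * n)"
    by (simp add: star_mult sa_bicommutantD(2)[OF nD] a_def mult.assoc)
  also have "\<dots> = - (n * (n * (l * l)))" by (simp add: an l)
  also have "n * (n * (l * l)) = (n * l) * (n * l)" by (metis nl mult.assoc)
  finally have "y * n = 0"
    by (rule star_mult_self_not_negative)
      (simp add: star_mult sa_bicommutantD(2)[OF nD] sa_bicommutantD(2)[OF l(1)] nl)
  then have "a * n = 0" by (simp add: a_def mult.assoc)
  then have "n * n = 0" using an nA by (simp add: n_def algebra_simps)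
  then have "n = 0" using norm_self_adjoint_square[OF sa_bicommutantD(2)[OF nD]] by simp
  then have al: "a = l * l" using l by (simp add: n_def)
  have "norm (r *\<^sub>R 1 - l * l) \<le> r"
  proof (rule norm_scalar_minus_square_le)
    show "star l = l" by (rule sa_bicommutantD(2)[OF l(1)])
    then show "(norm l)\<^sup>2 \<le> r" using norm_self_adjoint_square[of l] al a(2) by simp
  qed
  then show ?thesis by (simp add: al[symmetric] a_def r_def)
qed simp

section \<open>Extreme linear functionals below a sublinear functional\<close>

definition sublinear_on :: "'v::real_vector set \<Rightarrow> ('v \<Rightarrow> real) \<Rightarrow> bool" where
  "sublinear_on V q \<longleftrightarrow> (\<forall>x\<in>V. \<forall>y\<in>V. q (x + y) \<le> q x + q y) \<and>
     (\<forall>x\<in>V. \<forall>r\<ge>0. q (r *\<^sub>R x) = r * q x)"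

definition real_linear_on :: "'v::real_vector set \<Rightarrow> ('v \<Rightarrow> real) \<Rightarrow> bool" where
  "real_linear_on V f \<longleftrightarrow> (\<forall>x\<in>V. \<forall>y\<in>V. f (x + y) = f x + f y) \<and>
     (\<forall>x\<in>V. \<forall>r. f (r *\<^sub>R x) = r * f x)"

definition dominated_on :: "'v set \<Rightarrow> ('v \<Rightarrow> real) \<Rightarrow> ('v \<Rightarrow> real) \<Rightarrow> bool" where
  "dominated_on V f q \<longleftrightarrow> (\<forall>x\<in>V. f x \<le> q x)"

text \<open>The linear functionals dominated by such a \<open>q\<close> form a face of the convex set of those dominated
  by \<open>p\<close>.  Fixing \<open>q = 0\<close> off \<open>V\<close> makes the pointwise order antisymmetric.\<close>

definition face_functional :: "'v::real_vector set \<Rightarrow> ('v \<Rightarrow> real) \<Rightarrow> ('v \<Rightarrow> real) \<Rightarrow> bool" where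
  "face_functional V p q \<longleftrightarrow> sublinear_on V q \<and> dominated_on V q p \<and> (\<forall>x. x \<notin> V \<longrightarrow> q x = 0) \<and>
     (\<forall>f g t. real_linear_on V f \<and> dominated_on V f p \<and> real_linear_on V g \<and> dominated_on V g p \<and>
        0 < t \<and> t < 1 \<and> dominated_on V (\<lambda>x. t * f x + (1 - t) * g x) q \<longrightarrow>
        dominated_on V f q \<and> dominated_on V g q)"

text \<open>The linear functionals dominated by this one are those that are dominated by \<open>q\<close> and attain
  the value \<open>q a\<close> at \<open>a\<close>; see \<open>dominated_by_attain_at_iff\<close>.\<close>

definition attain_at :: "'v::real_vector set \<Rightarrow> ('v \<Rightarrow> real) \<Rightarrow> 'v \<Rightarrow> 'v \<Rightarrow> real" where
  "attain_at V q a x = (if x \<in> V then INF s\<in>{0..}. q (x + s *\<^sub>R a) - s * q a else 0)"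

lemma sublinear_onI:
  assumes V: "subspace V" and zero: "q 0 = 0"
    and add: "\<And>x y. x \<in> V \<Longrightarrow> y \<in> V \<Longrightarrow> q (x + y) \<le> q x + q y"
    and scale: "\<And>x r. x \<in> V \<Longrightarrow> 0 < r \<Longrightarrow> r * q x \<le> q (r *\<^sub>R x)"
  shows "sublinear_on V q"
proof -
  have "q (r *\<^sub>R x) = r * q x" if x: "x \<in> V" and r: "0 \<le> r" for x r
  proof (cases "r = 0")
    case False
    then have r: "0 < r" using r by simp
    have "(1 / r) * q (r *\<^sub>R x) \<le> q x"
      using scale[of "r *\<^sub>R x" "1 / r"] x V r by (simp add: subspace_scale)
    then show ?thesis using scale[OF x r] r by (simp add: field_simps)
  qed (simp add: zero)
  then show ?thesis using add by (simp add: sublinear_on_def)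
qed

lemma sublinear_on_zero: "subspace V \<Longrightarrow> sublinear_on V q \<Longrightarrow> q 0 = 0"
  unfolding sublinear_on_def using subspace_0[of V] by (metis mult_zero_left order_refl scale_zero_left)

lemma sublinear_on_minus:
  assumes "subspace V" "sublinear_on V q" "x \<in> V"
  shows "- q (- x) \<le> q x"
proof -
  have "q (x + - x) \<le> q x + q (- x)"
    using assms subspace_neg[of V x] unfolding sublinear_on_def by blast
  then show ?thesis using sublinear_on_zero[OF assms(1,2)] by simp
qed

context
  fixes V :: "'v::real_vector set" and q :: "'v \<Rightarrow> real" and a :: 'v
  assumes V: "subspace V" and q: "sublinear_on V q" and a: "a \<in> V"
begin

lemma attain_at_bdd_below:
  assumes "x \<in> V"
  shows "bdd_below ((\<lambda>s. q (x + s *\<^sub>R a) - s * q a) ` {0..})"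
proof (rule bdd_belowI2)
  fix s :: real assume s: "s \<in> {0..}"
  have "q ((x + s *\<^sub>R a) + - x) \<le> q (x + s *\<^sub>R a) + q (- x)"
    using q V a assms unfolding sublinear_on_def by (meson subspace_add subspace_neg subspace_scale)
  moreover have "q (s *\<^sub>R a) = s * q a" using q a s by (simp add: sublinear_on_def)
  ultimately show "- q (- x) \<le> q (x + s *\<^sub>R a) - s * q a" by simp
qed

lemma attain_at_le:
  assumes "x \<in> V" "0 \<le> s"
  shows "attain_at V q a x \<le> q (x + s *\<^sub>R a) - s * q a"
  unfolding attain_at_def using assms attain_at_bdd_below[OF assms(1)] by (auto intro: cINF_lower)

lemma attain_at_greatest:
  assumes "x \<in> V" "\<And>s. 0 \<le> s \<Longrightarrow> m \<le> q (x + s *\<^sub>R a) - s * q a"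
  shows "m \<le> attain_at V q a x"
  unfolding attain_at_def using assms by (auto intro: cINF_greatest)

lemma attain_at_dominated: "dominated_on V (attain_at V q a) q"
  using attain_at_le[where s = 0] by (simp add: dominated_on_def)

lemma attain_at_minus: "attain_at V q a (- a) \<le> - q a"
  using attain_at_le[of "- a" 1] a V sublinear_on_zero[OF V q] by (simp add: subspace_neg)

lemma sublinear_on_attain_at: "sublinear_on V (attain_at V q a)"
proof (rule sublinear_onI[OF V])
  have "q (s *\<^sub>R a) = s * q a" if "0 \<le> s" for s using q a that by (simp add: sublinear_on_def)
  then show "attain_at V q a 0 = 0"
    using attain_at_le[of 0 0] attain_at_greatest[of 0 0] V sublinear_on_zero[OF V q] by (simp add: subspace_0)
next
  fix x y assume x: "x \<in> V" and y: "y \<in> V"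
  have xy: "x + y \<in> V" using x y V by (simp add: subspace_add)
  have "attain_at V q a (x + y) - attain_at V q a x \<le> attain_at V q a y"
  proof (rule attain_at_greatest[OF y])
    fix s :: real assume s: "0 \<le> s"
    have "attain_at V q a (x + y) - (q (y + s *\<^sub>R a) - s * q a) \<le> attain_at V q a x"
    proof (rule attain_at_greatest[OF x])
      fix t :: real assume t: "0 \<le> t"
      have "q ((x + t *\<^sub>R a) + (y + s *\<^sub>R a)) \<le> q (x + t *\<^sub>R a) + q (y + s *\<^sub>R a)"
        using q x y a V unfolding sublinear_on_def by (meson subspace_add subspace_scale)
      moreover have "(x + t *\<^sub>R a) + (y + s *\<^sub>R a) = (x + y) + (t + s) *\<^sub>R a"
        by (simp add: algebra_simps)
      moreover have "attain_at V q a (x + y) \<le> q ((x + y) + (t + s) *\<^sub>R a) - (t + s) * q a"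
        using attain_at_le[OF xy, of "t + s"] s t by simp
      ultimately show "attain_at V q a (x + y) - (q (y + s *\<^sub>R a) - s * q a) \<le> q (x + t *\<^sub>R a) - t * q a"
        by (simp add: algebra_simps)
    qed
    then show "attain_at V q a (x + y) - attain_at V q a x \<le> q (y + s *\<^sub>R a) - s * q a" by simp
  qed
  then show "attain_at V q a (x + y) \<le> attain_at V q a x + attain_at V q a y" by simp
next
  fix x and r :: real assume x: "x \<in> V" and r: "0 < r"
  show "r * attain_at V q a x \<le> attain_at V q a (r *\<^sub>R x)"
  proof (rule attain_at_greatest)
    show rx: "r *\<^sub>R x \<in> V" using x V by (simp add: subspace_scale)
    fix s :: real assume s: "0 \<le> s"
    have "r *\<^sub>R x + s *\<^sub>R a = r *\<^sub>R (x + (s / r) *\<^sub>R a)" using r by (simp add: scaleR_right_distrib)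
    moreover have "x + (s / r) *\<^sub>R a \<in> V" using x a V by (simp add: subspace_add subspace_scale)
    ultimately have "q (r *\<^sub>R x + s *\<^sub>R a) = r * q (x + (s / r) *\<^sub>R a)"
      using q r by (simp add: sublinear_on_def)
    moreover have "r * attain_at V q a x \<le> r * (q (x + (s / r) *\<^sub>R a) - (s / r) * q a)"
      using attain_at_le[OF x, of "s / r"] r s by (intro mult_left_mono) auto
    ultimately show "r * attain_at V q a x \<le> q (r *\<^sub>R x + s *\<^sub>R a) - s * q a"
      using r by (simp add: right_diff_distrib)
  qed
qed

lemma dominated_by_attain_at_iff:
  assumes f: "real_linear_on V f"
  shows "dominated_on V f (attain_at V q a) \<longleftrightarrow> dominated_on V f q \<and> f a = q a"
proof
  assume dom: "dominated_on V f (attain_at V q a)"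
  then have fq: "dominated_on V f q" using attain_at_dominated by (force simp: dominated_on_def)
  have "f (- a) \<le> - q a"
    using dom subspace_neg[OF V a] order.trans[OF _ attain_at_minus] by (simp add: dominated_on_def)
  moreover have "f (- a) = - f a"
    using f a unfolding real_linear_on_def by (metis mult_minus1 scaleR_minus1_left)
  ultimately show "dominated_on V f q \<and> f a = q a" using fq a by (force simp: dominated_on_def)
next
  assume fq: "dominated_on V f q \<and> f a = q a"
  show "dominated_on V f (attain_at V q a)"
    unfolding dominated_on_def
  proof
    fix x assume x: "x \<in> V"
    show "f x \<le> attain_at V q a x"
    proof (rule attain_at_greatest[OF x])
      fix s :: real
      have "f (x + s *\<^sub>R a) = f x + s * q a"
        using f x a V fq by (simp add: real_linear_on_def subspace_scale)
      moreover have "f (x + s *\<^sub>R a) \<le> q (x + s *\<^sub>R a)"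
        using fq x a V by (simp add: dominated_on_def subspace_add subspace_scale)
      ultimately show "f x \<le> q (x + s *\<^sub>R a) - s * q a" by simp
    qed
  qed
qed

end

text \<open>A convex combination of two functionals below \<open>q\<close> attains \<open>q a\<close> at \<open>a\<close> only if both of them do.\<close>

lemma face_functional_attain_at:
  assumes V: "subspace V" and q: "face_functional V p q" and a: "a \<in> V"
  shows "face_functional V p (attain_at V q a)"
proof -
  have sub: "sublinear_on V q" and qp: "dominated_on V q p"
    using q by (simp_all add: face_functional_def)
  have dom: "dominated_on V (attain_at V q a) q"
    by (rule attain_at_dominated[OF V sub a])
  have "dominated_on V f (attain_at V q a) \<and> dominated_on V g (attain_at V q a)"
    if fg: "real_linear_on V f" "dominated_on V f p" "real_linear_on V g" "dominated_on V g p"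
      and t: "0 < t" "t < 1"
      and le: "dominated_on V (\<lambda>x. t * f x + (1 - t) * g x) (attain_at V q a)" for f g t
  proof -
    have lin: "real_linear_on V (\<lambda>x. t * f x + (1 - t) * g x)"
      using fg(1,3) by (simp add: real_linear_on_def algebra_simps)
    have eq: "dominated_on V (\<lambda>x. t * f x + (1 - t) * g x) q" "t * f a + (1 - t) * g a = q a"
      using le dominated_by_attain_at_iff[OF V sub a lin] by auto
    then have fgq: "dominated_on V f q" "dominated_on V g q"
      using q fg t unfolding face_functional_def by blast+
    then have "t * f a \<le> t * q a" "(1 - t) * g a \<le> (1 - t) * q a"
      using a t by (auto simp: dominated_on_def intro: mult_left_mono)
    moreover have "t * q a + (1 - t) * q a = q a" by (simp add: algebra_simps)
    ultimately have "t * f a = t * q a" "(1 - t) * g a = (1 - t) * q a" using eq(2) by linarith+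
    then have "f a = q a" "g a = q a" using t by auto
    then show ?thesis
      using fgq dominated_by_attain_at_iff[OF V sub a] fg(1,3) by blast
  qed
  moreover have "dominated_on V (attain_at V q a) p"
    using dom qp by (force simp: dominated_on_def)
  ultimately show ?thesis
    unfolding face_functional_def using sublinear_on_attain_at[OF V sub a]
    by (auto simp: attain_at_def)
qed

text \<open>The infimum stays subadditive because, of two members of the chain, the smaller one bounds
  the values of both.\<close>

lemma face_functional_Inf_chain:
  assumes V: "subspace V" and p: "sublinear_on V p"
    and C: "C \<noteq> {}" "\<And>q. q \<in> C \<Longrightarrow> face_functional V p q"
    and chain: "\<And>q q'. q \<in> C \<Longrightarrow> q' \<in> C \<Longrightarrow> dominated_on V q q' \<or> dominated_on V q' q"
  defines "m \<equiv> \<lambda>x. INF q\<in>C. q x"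
  shows "face_functional V p m" "\<And>q. q \<in> C \<Longrightarrow> dominated_on V m q"
proof -
  have bdd: "bdd_below ((\<lambda>q. q x) ` C)" if x: "x \<in> V" for x
  proof (rule bdd_belowI2)
    fix q assume q: "q \<in> C"
    have "- q (- x) \<le> q x" using C(2)[OF q] sublinear_on_minus[OF V _ x] by (simp add: face_functional_def)
    moreover have "q (- x) \<le> p (- x)"
      using C(2)[OF q] subspace_neg[OF V x] by (simp add: face_functional_def dominated_on_def)
    ultimately show "- p (- x) \<le> q x" by simp
  qed
  have le: "m x \<le> q x" if "x \<in> V" "q \<in> C" for x q
    unfolding m_def using bdd that by (auto intro: cINF_lower)
  have greatest: "u \<le> m x" if "\<And>q. q \<in> C \<Longrightarrow> u \<le> q x" for u x
    unfolding m_def using C(1) that by (auto intro: cINF_greatest)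
  show "dominated_on V m q" if "q \<in> C" for q
    using le that by (simp add: dominated_on_def)
  have "sublinear_on V m"
  proof (rule sublinear_onI[OF V])
    have "q 0 = 0" if "q \<in> C" for q
      using C(2)[OF that] sublinear_on_zero[OF V] by (simp add: face_functional_def)
    then have "(\<lambda>q. q 0) ` C = {0}" using C(1) by (auto simp: image_iff)
    then show "m 0 = 0" by (simp add: m_def)
  next
    fix x y assume x: "x \<in> V" and y: "y \<in> V"
    have "m (x + y) - m x \<le> m y"
    proof (rule greatest)
      fix q assume q: "q \<in> C"
      have "m (x + y) - q y \<le> m x"
      proof (rule greatest)
        fix q' assume q': "q' \<in> C"
        obtain q'' where q'': "q'' \<in> C" "q'' x \<le> q' x" "q'' y \<le> q y"
          using chain[OF q q'] q q' x y by (force simp: dominated_on_def)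
        have "m (x + y) \<le> q'' (x + y)" using le q'' x y V by (simp add: subspace_add)
        also have "\<dots> \<le> q'' x + q'' y"
          using C(2)[OF q''(1)] x y by (simp add: face_functional_def sublinear_on_def)
        finally show "m (x + y) - q y \<le> q' x" using q'' by simp
      qed
      then show "m (x + y) - m x \<le> q y" by simp
    qed
    then show "m (x + y) \<le> m x + m y" by simp
  next
    fix x and r :: real assume x: "x \<in> V" and r: "0 < r"
    show "r * m x \<le> m (r *\<^sub>R x)"
    proof (rule greatest)
      fix q assume q: "q \<in> C"
      have "q (r *\<^sub>R x) = r * q x" using C(2)[OF q] x r by (simp add: face_functional_def sublinear_on_def)
      then show "r * m x \<le> q (r *\<^sub>R x)" using le[OF x q] r by simp
    qed
  qed
  moreover have "dominated_on V m p"
  proof -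
    obtain q where "q \<in> C" using C(1) by blast
    then show ?thesis using le C(2)[of q] by (force simp: dominated_on_def face_functional_def)
  qed
  moreover have "m x = 0" if "x \<notin> V" for x
  proof -
    have "q x = 0" if "q \<in> C" for q
      using C(2)[OF that] \<open>x \<notin> V\<close> by (simp add: face_functional_def)
    then have "(\<lambda>q. q x) ` C = {0}" using C(1) by (auto simp: image_iff)
    then show ?thesis by (simp add: m_def)
  qed
  moreover have "dominated_on V f m \<and> dominated_on V g m"
    if fg: "real_linear_on V f" "dominated_on V f p" "real_linear_on V g" "dominated_on V g p"
      and t: "0 < t" "t < 1"
      and dom: "dominated_on V (\<lambda>x. t * f x + (1 - t) * g x) m" for f g t
  proof -
    have "dominated_on V f q \<and> dominated_on V g q" if q: "q \<in> C" for q
    proof -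
      have "dominated_on V (\<lambda>x. t * f x + (1 - t) * g x) q"
        using dom le[OF _ q] by (force simp: dominated_on_def)
      then show ?thesis using C(2)[OF q] fg t unfolding face_functional_def by blast
    qed
    then show ?thesis by (auto simp: dominated_on_def intro: greatest)
  qed
  ultimately show "face_functional V p m" unfolding face_functional_def by blast
qed

text \<open>Hahn--Banach and Krein--Milman in one stroke: by Zorn's lemma there is a minimal sublinear
  functional among those that cut out faces and force the value \<open>p a\<close> at \<open>a\<close>.  It is additive, because
  forcing its value at any further point does not make it smaller.\<close>

theorem exists_extreme_dominated_functional:
  fixes V :: "'v::real_vector set" and p :: "'v \<Rightarrow> real"
  assumes V: "subspace V" and p: "sublinear_on V p" and a: "a \<in> V"
  obtains \<psi> where "real_linear_on V \<psi>" "dominated_on V \<psi> p" "\<psi> a = p a"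
    "\<And>f g t x. \<lbrakk>real_linear_on V f; dominated_on V f p; real_linear_on V g; dominated_on V g p;
        0 < t; t < 1; \<And>y. y \<in> V \<Longrightarrow> \<psi> y = t * f y + (1 - t) * g y; x \<in> V\<rbrakk> \<Longrightarrow> f x = \<psi> x"
proof -
  define p0 where "p0 x = (if x \<in> V then p x else 0)" for x
  have p0: "face_functional V p p0"
    using p V by (auto simp: face_functional_def sublinear_on_def dominated_on_def p0_def subspace_add subspace_scale)
  define q0 where "q0 = attain_at V p0 a"
  have q0: "face_functional V p q0" unfolding q0_def by (rule face_functional_attain_at[OF V p0 a])
  define A where "A = {q. face_functional V p q \<and> dominated_on V q q0}"
  define P where "P = (\<lambda>q q'. dominated_on V q' q)"
  have anti: "q = q'" if "q \<in> A" "q' \<in> A" "P q q'" "P q' q" for q q'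
  proof
    fix x show "q x = q' x"
      using that by (cases "x \<in> V") (auto simp: A_def P_def face_functional_def dominated_on_def intro: order_antisym)
  qed
  have "partial_order_on A (relation_of P A)"
    by (rule partial_order_on_relation_ofI)
      (auto simp: P_def dominated_on_def intro: order.trans anti[unfolded P_def dominated_on_def])
  moreover have "\<exists>u\<in>A. \<forall>q\<in>C. P q u" if C: "C \<in> Chains (relation_of P A)" for C
  proof (cases "C = {}")
    case True
    have "q0 \<in> A" using q0 by (simp add: A_def dominated_on_def)
    then show ?thesis using True by blast
  next
    case False
    have CA: "C \<subseteq> A" by (rule Chains_relation_of[OF C])
    have ch: "dominated_on V q q' \<or> dominated_on V q' q" if "q \<in> C" "q' \<in> C" for q q'
      using C that unfolding Chains_def relation_of_def P_def by blast
    have face: "face_functional V p q" if "q \<in> C" for q using CA that by (auto simp: A_def)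
    note m = face_functional_Inf_chain[OF V p False face ch, simplified]
    have "(\<lambda>x. INF q\<in>C. q x) \<in> A"
    proof -
      obtain q where q: "q \<in> C" using False by blast
      then have "dominated_on V q q0" using CA by (auto simp: A_def)
      then show ?thesis using m(1) m(2)[OF q] by (force simp: A_def dominated_on_def)
    qed
    then show ?thesis using m(2) by (auto simp: P_def)
  qed
  ultimately obtain q where q: "q \<in> A" and min: "\<And>q'. q' \<in> A \<Longrightarrow> P q q' \<Longrightarrow> q' = q"
    using predicate_Zorn[of A P] by blast
  have face: "face_functional V p q" and q_q0: "dominated_on V q q0" using q by (auto simp: A_def)
  have sub: "sublinear_on V q" and q_p: "dominated_on V q p" using face by (auto simp: face_functional_def)
  have neg: "q (- x) = - q x" if x: "x \<in> V" for x
  proof -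
    have "attain_at V q x \<in> A"
      using face_functional_attain_at[OF V face x] attain_at_dominated[OF V sub x] q_q0
      by (force simp: A_def dominated_on_def)
    then have "attain_at V q x = q"
      using min attain_at_dominated[OF V sub x] by (auto simp: P_def)
    then have "q (- x) \<le> - q x" using attain_at_minus[OF V sub x] by simp
    moreover have "- q x \<le> q (- x)" using sublinear_on_minus[OF V sub x] by simp
    ultimately show ?thesis by simp
  qed
  have lin: "real_linear_on V q"
    unfolding real_linear_on_def
  proof (intro conjI ballI allI)
    fix x y assume x: "x \<in> V" and y: "y \<in> V"
    have "q (- x + - y) \<le> q (- x) + q (- y)"
      using sub subspace_neg[OF V x] subspace_neg[OF V y] unfolding sublinear_on_def by blast
    moreover have "q (- x + - y) = - q (x + y)" using neg[of "x + y"] x y V by (simp add: subspace_add)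
    moreover have "q (x + y) \<le> q x + q y" using sub x y by (simp add: sublinear_on_def)
    ultimately show "q (x + y) = q x + q y" using neg x y by simp
  next
    fix x and r :: real assume x: "x \<in> V"
    show "q (r *\<^sub>R x) = r * q x"
    proof (cases "0 \<le> r")
      case False
      then have "q ((- r) *\<^sub>R x) = (- r) * q x"
        using sub x unfolding sublinear_on_def by (meson neg_0_le_iff_le le_cases)
      then have "q (- (r *\<^sub>R x)) = - (r * q x)" by simp
      then show ?thesis using neg[of "r *\<^sub>R x"] x V by (simp add: subspace_scale)
    qed (use sub x in \<open>auto simp: sublinear_on_def\<close>)
  qed
  have p0_sub: "sublinear_on V p0" using p0 by (simp add: face_functional_def)
  have "dominated_on V q p0 \<and> q a = p0 a"
    using q_q0 dominated_by_attain_at_iff[OF V p0_sub a lin] by (simp add: q0_def)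
  then have "q a = p a" using a by (simp add: p0_def)
  moreover have "f x = q x"
    if fg: "real_linear_on V f" "dominated_on V f p" "real_linear_on V g" "dominated_on V g p"
      "0 < t" "t < 1" and eq: "\<And>y. y \<in> V \<Longrightarrow> q y = t * f y + (1 - t) * g y" and x: "x \<in> V" for f g t x
  proof -
    have "dominated_on V (\<lambda>x. t * f x + (1 - t) * g x) q" using eq by (simp add: dominated_on_def)
    then have fq: "dominated_on V f q" using face fg unfolding face_functional_def by blast
    have "f (- x) = - f x" using fg(1) x unfolding real_linear_on_def by (metis mult_minus1 scaleR_minus1_left)
    then have "- f x \<le> - q x" "f x \<le> q x"
      using fq x subspace_neg[OF V x] neg[OF x] unfolding dominated_on_def by metis+
    then show ?thesis by simp
  qed
  ultimately show ?thesis using that[OF lin q_p] by blast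
qed

section \<open>Completion of a semi-inner product space\<close>

locale semi_inner_product =
  fixes V :: "'v::complex_vector set" and s :: "'v \<Rightarrow> 'v \<Rightarrow> complex"
  assumes V_zero: "0 \<in> V"
    and V_add: "\<lbrakk>x \<in> V; y \<in> V\<rbrakk> \<Longrightarrow> x + y \<in> V"
    and V_scaleC: "x \<in> V \<Longrightarrow> c *\<^sub>C x \<in> V"
    and s_add_left: "\<lbrakk>x \<in> V; y \<in> V; z \<in> V\<rbrakk> \<Longrightarrow> s (x + y) z = s x z + s y z"
    and s_scaleC_left: "\<lbrakk>x \<in> V; y \<in> V\<rbrakk> \<Longrightarrow> s (c *\<^sub>C x) y = c * s x y"
    and s_commute: "\<lbrakk>x \<in> V; y \<in> V\<rbrakk> \<Longrightarrow> s y x = cnj (s x y)"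
    and s_self_nonneg: "x \<in> V \<Longrightarrow> 0 \<le> Re (s x x)"
begin

abbreviation nrm :: "'v \<Rightarrow> real" where "nrm \<equiv> ip_norm s"

lemma V_diff: "\<lbrakk>x \<in> V; y \<in> V\<rbrakk> \<Longrightarrow> x - y \<in> V"
  using V_add[of x "(- 1) *\<^sub>C y"] V_scaleC[of y "- 1"] by (simp add: scaleC_minus_one)

lemma s_add_right: "\<lbrakk>x \<in> V; y \<in> V; z \<in> V\<rbrakk> \<Longrightarrow> s z (x + y) = s z x + s z y"
  by (metis V_add complex_cnj_add s_add_left s_commute)

lemma s_scaleC_right: "\<lbrakk>x \<in> V; y \<in> V\<rbrakk> \<Longrightarrow> s y (c *\<^sub>C x) = cnj c * s y x"
  by (metis V_scaleC complex_cnj_mult s_scaleC_left s_commute)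

lemma s_diff_left: "\<lbrakk>x \<in> V; y \<in> V; z \<in> V\<rbrakk> \<Longrightarrow> s (x - y) z = s x z - s y z"
  using s_add_left[of "x - y" y z] V_diff by simp

lemma s_diff_right: "\<lbrakk>x \<in> V; y \<in> V; z \<in> V\<rbrakk> \<Longrightarrow> s z (x - y) = s z x - s z y"
  using s_add_right[of "x - y" y z] V_diff by simp

lemma nrm_nonneg: "x \<in> V \<Longrightarrow> 0 \<le> nrm x"
  by (simp add: ip_norm_def s_self_nonneg)

lemma nrm_sq: "x \<in> V \<Longrightarrow> (nrm x)\<^sup>2 = Re (s x x)"
  by (simp add: ip_norm_def s_self_nonneg)

lemma s_self: "x \<in> V \<Longrightarrow> s x x = of_real ((nrm x)\<^sup>2)"
  using s_commute[of x x] by (simp add: nrm_sq complex_eq_iff)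

text \<open>Since \<open>s\<close> may be degenerate, the optimal multiple of \<open>y\<close> is not available when \<open>nrm y = 0\<close>; a
  large one serves instead.\<close>

lemma semi_Cauchy_Schwarz:
  assumes x: "x \<in> V" and y: "y \<in> V"
  shows "cmod (s x y) \<le> nrm x * nrm y"
proof -
  define a where "a = s x y"
  have *: "0 \<le> (nrm x)\<^sup>2 - 2 * t * (cmod a)\<^sup>2 + t\<^sup>2 * (cmod a)\<^sup>2 * (nrm y)\<^sup>2" for t :: real
  proof -
    define c where "c = of_real t * a"
    have cy: "c *\<^sub>C y \<in> V" using y by (rule V_scaleC)
    have yx: "s y x = cnj a" using s_commute[OF x y] by (simp add: a_def)
    have "s (x - c *\<^sub>C y) (x - c *\<^sub>C y)
        = of_real ((nrm x)\<^sup>2) - cnj c * a - c * cnj a + c * cnj c * of_real ((nrm y)\<^sup>2)"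
      using x y cy
      by (simp add: s_diff_left s_diff_right V_diff s_scaleC_left s_scaleC_right yx s_self[OF x] s_self[OF y]
          algebra_simps flip: a_def)
    also have "\<dots> = of_real ((nrm x)\<^sup>2 - 2 * t * (cmod a)\<^sup>2 + t\<^sup>2 * (cmod a)\<^sup>2 * (nrm y)\<^sup>2)"
    proof -
      have aa: "a * cnj a = of_real ((cmod a)\<^sup>2)" by (rule complex_norm_square[symmetric])
      have "cnj c * a = of_real t * (a * cnj a)" "c * cnj a = of_real t * (a * cnj a)"
        "c * cnj c = of_real (t\<^sup>2) * (a * cnj a)"
        by (simp_all add: c_def power2_eq_square ac_simps)
      then show ?thesis by (simp only: aa of_real_mult of_real_add of_real_diff) simp
    qed
    finally show ?thesis using s_self_nonneg[OF V_diff[OF x cy]] by simp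
  qed
  have "(cmod a)\<^sup>2 \<le> (nrm x)\<^sup>2 * (nrm y)\<^sup>2"
  proof (cases "nrm y = 0")
    case True
    show ?thesis
    proof (cases "a = 0")
      case False
      then have "((nrm x)\<^sup>2 + 1) / (cmod a)\<^sup>2 * (cmod a)\<^sup>2 = (nrm x)\<^sup>2 + 1" by simp
      then show ?thesis using *[of "((nrm x)\<^sup>2 + 1) / (cmod a)\<^sup>2"] True False
        by (simp add: add_nonneg_pos add_pos_nonneg) (smt (verit) zero_le_power2)
    qed (simp add: True)
  next
    case False
    then have "nrm y > 0" using nrm_nonneg[OF y] by simp
    then show ?thesis using *[of "1 / (nrm y)\<^sup>2"] by (simp add: power2_eq_square field_simps)
  qed
  then have "(cmod a)\<^sup>2 \<le> (nrm x * nrm y)\<^sup>2" by (simp add: power_mult_distrib)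
  then have "cmod a \<le> nrm x * nrm y"
    by (rule power2_le_imp_le) (intro mult_nonneg_nonneg nrm_nonneg x y)
  then show ?thesis by (simp only: a_def)
qed

text \<open>A vector \<open>v\<close> acts on \<open>V\<close> through \<open>w \<mapsto> s v w\<close>.  The completion is taken inside the conjugate
  linear functionals on \<open>V\<close>: its elements are the functions approximable by vectors in the dual
  norm, and separation is automatic.\<close>

definition approximates :: "'v \<Rightarrow> real \<Rightarrow> ('v \<Rightarrow> complex) \<Rightarrow> bool" where
  "approximates v e F \<longleftrightarrow> v \<in> V \<and> 0 \<le> e \<and> (\<forall>w\<in>V. cmod (F w - s v w) \<le> e * nrm w)"

definition hilbert_completion :: "('v \<Rightarrow> complex) set" where
  "hilbert_completion = {F. (\<forall>w. w \<notin> V \<longrightarrow> F w = 0) \<and> (\<forall>e>0. \<exists>v. approximates v e F)}"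

definition vector_functional :: "'v \<Rightarrow> 'v \<Rightarrow> complex" where
  "vector_functional v = (\<lambda>w. if w \<in> V then s v w else 0)"

definition approx_seq :: "('v \<Rightarrow> complex) \<Rightarrow> nat \<Rightarrow> 'v" where
  "approx_seq F n = (SOME v. approximates v (1 / Suc n) F)"

text \<open>If \<open>G\<close> is approximated by vectors \<open>w\<close>, its inner product with \<open>F\<close> is approximated by \<open>F w\<close>.  The chosen
  sequence of vectors is irrelevant; see \<open>completion_ip_approx\<close>.\<close>

definition completion_ip :: "('v \<Rightarrow> complex) \<Rightarrow> ('v \<Rightarrow> complex) \<Rightarrow> complex" where
  "completion_ip F G = lim (\<lambda>n. F (approx_seq G n))"

lemma vector_functional_approximates: "v \<in> V \<Longrightarrow> approximates v 0 (vector_functional v)"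
  by (simp add: approximates_def vector_functional_def)

lemma approximates_mono: "approximates v e F \<Longrightarrow> e \<le> e' \<Longrightarrow> approximates v e' F"
  unfolding approximates_def by (meson mult_right_mono nrm_nonneg order.trans)

lemma vector_functional_mem: "v \<in> V \<Longrightarrow> vector_functional v \<in> hilbert_completion"
  using approximates_mono[OF vector_functional_approximates less_imp_le] by (force simp: hilbert_completion_def vector_functional_def)

lemma approx_seq: "F \<in> hilbert_completion \<Longrightarrow> approximates (approx_seq F n) (1 / Suc n) F"
  unfolding approx_seq_def by (rule someI_ex) (auto simp: hilbert_completion_def)

lemma approx_seq_mem: "F \<in> hilbert_completion \<Longrightarrow> approx_seq F n \<in> V"
  using approx_seq by (simp add: approximates_def)

lemma approximates_add:
  assumes "approximates v e F" "approximates v' e' G"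
  shows "approximates (v + v') (e + e') (F + G)"
proof -
  have "cmod ((F + G) w - s (v + v') w) \<le> (e + e') * nrm w" if "w \<in> V" for w
  proof -
    have "cmod ((F + G) w - s (v + v') w) = cmod ((F w - s v w) + (G w - s v' w))"
      using assms that by (simp add: approximates_def s_add_left algebra_simps)
    also have "\<dots> \<le> e * nrm w + e' * nrm w"
      using assms that by (intro order.trans[OF norm_triangle_ineq] add_mono) (auto simp: approximates_def)
    finally show ?thesis by (simp add: distrib_right)
  qed
  then show ?thesis using assms by (simp add: approximates_def V_add)
qed

lemma approximates_scaleC:
  assumes "approximates v e F"
  shows "approximates (c *\<^sub>C v) (cmod c * e) (c *\<^sub>C F)"
proof -
  have "cmod ((c *\<^sub>C F) w - s (c *\<^sub>C v) w) = cmod c * cmod (F w - s v w)" if "w \<in> V" for w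
    using assms that
    by (simp add: approximates_def s_scaleC_left scaleC_fun_def scaleC_complex_def
        right_diff_distrib[symmetric] norm_mult)
  then show ?thesis using assms by (auto simp: approximates_def V_scaleC mult.assoc intro: mult_left_mono)
qed

lemma zero_mem_completion: "0 \<in> hilbert_completion"
proof -
  have "s 0 w = 0" if "w \<in> V" for w using s_scaleC_left[of 0 w 0] that V_zero by (simp add: scaleC_zero_left)
  then have "approximates 0 e 0" if "e > 0" for e
    using that V_zero nrm_nonneg by (simp add: approximates_def)
  then show ?thesis by (auto simp: hilbert_completion_def)
qed

lemma add_mem_completion:
  assumes "F \<in> hilbert_completion" "G \<in> hilbert_completion"
  shows "F + G \<in> hilbert_completion"
proof -
  have "\<exists>v. approximates v e (F + G)" if e: "e > 0" for e
  proof -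
    obtain v v' where "approximates v (e / 2) F" "approximates v' (e / 2) G"
      using assms half_gt_zero[OF e] unfolding hilbert_completion_def by blast
    from approximates_add[OF this] show ?thesis by auto
  qed
  then show ?thesis using assms by (simp add: hilbert_completion_def)
qed

lemma scaleC_mem_completion:
  assumes "F \<in> hilbert_completion"
  shows "c *\<^sub>C F \<in> hilbert_completion"
proof -
  have "\<exists>v. approximates v e (c *\<^sub>C F)" if "e > 0" for e
  proof -
    have "e / (cmod c + 1) > 0" using that by (simp add: add_nonneg_pos)
    then obtain v where "approximates v (e / (cmod c + 1)) F" using assms by (auto simp: hilbert_completion_def)
    from approximates_scaleC[OF this, of c] have "approximates (c *\<^sub>C v) (cmod c * (e / (cmod c + 1))) (c *\<^sub>C F)" .
    moreover have "0 < cmod c + 1" by (simp add: add_nonneg_pos)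
    then have "cmod c * (e / (cmod c + 1)) \<le> e" using that by (simp add: field_simps)
    ultimately show ?thesis using approximates_mono by blast
  qed
  then show ?thesis using assms by (simp add: hilbert_completion_def scaleC_fun_def)
qed

lemma diff_mem_completion: "F \<in> hilbert_completion \<Longrightarrow> G \<in> hilbert_completion \<Longrightarrow> F - G \<in> hilbert_completion"
  using add_mem_completion[of F "(- 1) *\<^sub>C G"] scaleC_mem_completion[of G "- 1"]
  by (simp add: scaleC_minus_one)

lemma approximates_bound:
  assumes "approximates v e F" "w \<in> V"
  shows "cmod (F w) \<le> (e + nrm v) * nrm w"
proof -
  have "cmod (F w) \<le> cmod (F w - s v w) + cmod (s v w)"
    using norm_triangle_ineq[of "F w - s v w" "s v w"] by simp
  also have "\<dots> \<le> e * nrm w + nrm v * nrm w"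
    using assms semi_Cauchy_Schwarz[of v w] by (intro add_mono) (auto simp: approximates_def)
  finally show ?thesis by (simp add: distrib_right)
qed

lemma approx_seq_lim:
  assumes F: "F \<in> hilbert_completion" and u: "u \<in> V"
  shows "(\<lambda>n. s (approx_seq F n) u) \<longlonglongrightarrow> F u"
proof -
  have "cmod (F u - s (approx_seq F n) u) \<le> inverse (Suc n) * nrm u" for n
    using approx_seq[OF F, of n] u by (simp add: approximates_def inverse_eq_divide)
  moreover have "(\<lambda>n. inverse (real (Suc n)) * nrm u) \<longlonglongrightarrow> 0"
    using LIMSEQ_inverse_real_of_nat tendsto_mult_left_zero by blast
  ultimately have "(\<lambda>n. F u - s (approx_seq F n) u) \<longlonglongrightarrow> 0"
    by (intro Lim_null_comparison[of "\<lambda>n. F u - s (approx_seq F n) u"]) auto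
  then have "(\<lambda>n. F u - (F u - s (approx_seq F n) u)) \<longlonglongrightarrow> F u - 0" by (intro tendsto_intros)
  then show ?thesis by simp
qed

lemma completion_conj_linear:
  assumes F: "F \<in> hilbert_completion" and w: "w \<in> V" "w' \<in> V"
  shows "F (w + w') = F w + F w'" "F (c *\<^sub>C w) = cnj c * F w" "F (w - w') = F w - F w'"
proof -
  note lim = approx_seq_lim[OF F]
  note v = approx_seq_mem[OF F]
  show "F (w + w') = F w + F w'"
    using LIMSEQ_unique[OF lim[OF V_add[OF w]]] tendsto_add[OF lim[OF w(1)] lim[OF w(2)]]
    by (simp add: s_add_right w v)
  show "F (w - w') = F w - F w'"
    using LIMSEQ_unique[OF lim[OF V_diff[OF w]]] tendsto_diff[OF lim[OF w(1)] lim[OF w(2)]]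
    by (simp add: s_diff_right w v)
  show "F (c *\<^sub>C w) = cnj c * F w"
    using LIMSEQ_unique[OF lim[OF V_scaleC[OF w(1)]]] tendsto_mult_left[OF lim[OF w(1)]]
    by (simp add: s_scaleC_right w v)
qed

text \<open>Testing the two approximations against \<open>v - v'\<close> itself bounds \<open>nrm (v - v')\<^sup>2\<close> by \<open>(e + e') nrm (v - v')\<close>.\<close>

lemma approximates_dist:
  assumes "approximates v e F" "approximates v' e' F"
  shows "nrm (v - v') \<le> e + e'"
proof -
  have v: "v \<in> V" "v' \<in> V" using assms by (auto simp: approximates_def)
  define w where "w = v - v'"
  have w: "w \<in> V" using v by (simp add: w_def V_diff)
  have "(nrm w)\<^sup>2 = cmod (s w w)" by (subst s_self[OF w]) (simp add: norm_power)
  also have "s w w = (F w - s v' w) - (F w - s v w)" using v w by (subst (1) w_def) (simp add: s_diff_left)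
  also have "cmod \<dots> \<le> cmod (F w - s v' w) + cmod (F w - s v w)" by (rule norm_triangle_ineq4)
  also have "\<dots> \<le> e' * nrm w + e * nrm w"
    using assms w by (intro add_mono) (auto simp: approximates_def)
  finally have "nrm w * nrm w \<le> (e + e') * nrm w" by (simp add: power2_eq_square algebra_simps)
  then show ?thesis
    using nrm_nonneg[OF w] assms by (cases "nrm w = 0") (auto simp: approximates_def w_def)
qed

lemma approximates_nrm_le:
  assumes "approximates v e F" "0 \<le> C" "\<And>x. x \<in> V \<Longrightarrow> cmod (F x) \<le> C * nrm x"
  shows "nrm v \<le> e + C"
proof -
  have v: "v \<in> V" using assms by (simp add: approximates_def)
  have "nrm v * nrm v = cmod (s v v)" by (simp add: s_self[OF v] power2_eq_square norm_mult)
  also have "\<dots> \<le> cmod (F v - s v v) + cmod (F v)"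
    using norm_triangle_ineq4[of "F v" "F v - s v v"] by simp
  also have "\<dots> \<le> e * nrm v + C * nrm v"
    using assms v by (intro add_mono) (auto simp: approximates_def)
  finally have "nrm v * nrm v \<le> (e + C) * nrm v" by (simp add: algebra_simps)
  then show ?thesis
    using nrm_nonneg[OF v] assms by (cases "nrm v = 0") (auto simp: approximates_def)
qed

lemma completion_bounded:
  assumes "F \<in> hilbert_completion"
  obtains C where "0 \<le> C" "\<And>w. w \<in> V \<Longrightarrow> cmod (F w) \<le> C * nrm w"
proof -
  have "approximates (approx_seq F 0) 1 F" using approx_seq[OF assms, of 0] by simp
  then show ?thesis
    using that[of "1 + nrm (approx_seq F 0)"] approximates_bound nrm_nonneg[of "approx_seq F 0"]
    by (auto simp: approximates_def)
qed

lemma completion_ip_approx: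
  assumes F: "F \<in> hilbert_completion" and G: "G \<in> hilbert_completion"
    and C: "0 \<le> C" "\<And>x. x \<in> V \<Longrightarrow> cmod (F x) \<le> C * nrm x"
  shows "(\<lambda>n. F (approx_seq G n)) \<longlonglongrightarrow> completion_ip F G"
    and "approximates w e G \<Longrightarrow> cmod (completion_ip F G - F w) \<le> C * e"
proof -
  have *: "cmod (F v - F v') \<le> C * (e + e')" if "approximates v e G" "approximates v' e' G" for v v' e e'
  proof -
    have v: "v \<in> V" "v' \<in> V" using that by (auto simp: approximates_def)
    have "cmod (F v - F v') \<le> C * nrm (v - v')"
      using C(2)[OF V_diff[OF v]] completion_conj_linear(3)[OF F v] by simp
    also have "\<dots> \<le> C * (e + e')" using approximates_dist[OF that] C(1) by (rule mult_left_mono)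
    finally show ?thesis .
  qed
  have inv: "(\<lambda>n. C * (k + 1 / real (Suc n))) \<longlonglongrightarrow> C * (k + 0)" for k
    using LIMSEQ_inverse_real_of_nat by (intro tendsto_intros) (simp add: inverse_eq_divide)
  have "Cauchy (\<lambda>n. F (approx_seq G n))"
  proof (rule CauchyI)
    fix r :: real assume r: "0 < r"
    have "\<forall>\<^sub>F n in sequentially. C * (0 + 1 / real (Suc n)) < r / 2"
      using order_tendstoD(2)[OF inv[of 0], of "r / 2"] r by simp
    then obtain M where M: "\<And>n. n \<ge> M \<Longrightarrow> C * (1 / real (Suc n)) < r / 2"
      by (auto simp: eventually_sequentially)
    have "cmod (F (approx_seq G m) - F (approx_seq G n)) < r" if "m \<ge> M" "n \<ge> M" for m n
    proof -
      have "cmod (F (approx_seq G m) - F (approx_seq G n)) \<le> C * (1 / real (Suc m)) + C * (1 / real (Suc n))"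
        using *[OF approx_seq[OF G, of m] approx_seq[OF G, of n]] by (simp only: distrib_left)
      then show ?thesis using M[OF that(1)] M[OF that(2)] by linarith
    qed
    then show "\<exists>M. \<forall>m\<ge>M. \<forall>n\<ge>M. cmod (F (approx_seq G m) - F (approx_seq G n)) < r" by blast
  qed
  then have "convergent (\<lambda>n. F (approx_seq G n))" by (rule Cauchy_convergent)
  then show lim: "(\<lambda>n. F (approx_seq G n)) \<longlonglongrightarrow> completion_ip F G"
    unfolding completion_ip_def by (rule convergent_LIMSEQ_iff[THEN iffD1])
  show "cmod (completion_ip F G - F w) \<le> C * e" if w: "approximates w e G"
  proof (rule LIMSEQ_le)
    show "(\<lambda>n. cmod (F (approx_seq G n) - F w)) \<longlonglongrightarrow> cmod (completion_ip F G - F w)"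
      by (intro tendsto_intros lim)
    show "(\<lambda>n. C * (e + 1 / real (Suc n))) \<longlonglongrightarrow> C * e" using inv[of e] by simp
    show "\<exists>N. \<forall>n\<ge>N. cmod (F (approx_seq G n) - F w) \<le> C * (e + 1 / real (Suc n))"
      using *[OF approx_seq[OF G] w] by (auto simp: add.commute)
  qed
qed

lemma completion_ip_vector_functional:
  assumes "F \<in> hilbert_completion" "w \<in> V"
  shows "completion_ip F (vector_functional w) = F w"
proof -
  obtain C where "0 \<le> C" "\<And>w. w \<in> V \<Longrightarrow> cmod (F w) \<le> C * nrm w"
    using completion_bounded[OF assms(1)] by blast
  from completion_ip_approx(2)[OF assms(1) vector_functional_mem[OF assms(2)] this vector_functional_approximates[OF assms(2)]]
  show ?thesis by simp
qed

lemma completion_ip_lim: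
  assumes F: "F \<in> hilbert_completion" and G: "G \<in> hilbert_completion"
  shows "(\<lambda>n. s (approx_seq F n) (approx_seq G n)) \<longlonglongrightarrow> completion_ip F G"
proof -
  obtain C where C: "0 \<le> C" "\<And>w. w \<in> V \<Longrightarrow> cmod (F w) \<le> C * nrm w"
    using completion_bounded[OF F] by blast
  obtain K where K: "0 \<le> K" "\<And>w. w \<in> V \<Longrightarrow> cmod (G w) \<le> K * nrm w"
    using completion_bounded[OF G] by blast
  have "norm (F (approx_seq G n) - s (approx_seq F n) (approx_seq G n)) \<le> inverse (real (Suc n)) * (1 + K)" for n
  proof -
    have "norm (F (approx_seq G n) - s (approx_seq F n) (approx_seq G n)) \<le> 1 / Suc n * nrm (approx_seq G n)"
      using approx_seq[OF F, of n] approx_seq_mem[OF G, of n] unfolding approximates_def by blast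
    also have "nrm (approx_seq G n) \<le> 1 / Suc n + K"
      by (rule approximates_nrm_le[OF approx_seq[OF G] K])
    also have "\<dots> \<le> 1 + K" by simp
    finally show ?thesis by (simp add: inverse_eq_divide divide_right_mono)
  qed
  moreover have "(\<lambda>n. inverse (real (Suc n)) * (1 + K)) \<longlonglongrightarrow> 0"
    using LIMSEQ_inverse_real_of_nat tendsto_mult_left_zero by blast
  ultimately have "(\<lambda>n. F (approx_seq G n) - s (approx_seq F n) (approx_seq G n)) \<longlonglongrightarrow> 0"
    by (intro Lim_null_comparison[of "\<lambda>n. F (approx_seq G n) - s (approx_seq F n) (approx_seq G n)"]) auto
  from tendsto_diff[OF completion_ip_approx(1)[OF F G C] this] show ?thesis by simp
qed

lemma completion_ip_commute:
  assumes "F \<in> hilbert_completion" "G \<in> hilbert_completion"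
  shows "completion_ip G F = cnj (completion_ip F G)"
proof -
  have "(\<lambda>n. s (approx_seq G n) (approx_seq F n)) \<longlonglongrightarrow> cnj (completion_ip F G)"
    using tendsto_cnj[OF completion_ip_lim[OF assms]]
    by (simp add: s_commute[OF approx_seq_mem[OF assms(1)] approx_seq_mem[OF assms(2)], symmetric])
  then show ?thesis using LIMSEQ_unique completion_ip_lim[OF assms(2,1)] by blast
qed

lemma completion_ip_left:
  assumes "F \<in> hilbert_completion" "G \<in> hilbert_completion" "H \<in> hilbert_completion"
  shows "completion_ip (F + G) H = completion_ip F H + completion_ip G H"
    "completion_ip (c *\<^sub>C F) H = c * completion_ip F H"
proof -
  have lim: "(\<lambda>n. F (approx_seq H n)) \<longlonglongrightarrow> completion_ip F H" if "F \<in> hilbert_completion" for F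
    using completion_bounded[OF that] completion_ip_approx(1)[OF that assms(3)] by metis
  show "completion_ip (F + G) H = completion_ip F H + completion_ip G H"
    using LIMSEQ_unique[OF lim[OF add_mem_completion[OF assms(1,2)]]]
      tendsto_add[OF lim[OF assms(1)] lim[OF assms(2)]] by simp
  show "completion_ip (c *\<^sub>C F) H = c * completion_ip F H"
    using LIMSEQ_unique[OF lim[OF scaleC_mem_completion[OF assms(1), of c]]]
      tendsto_mult_left[OF lim[OF assms(1)], of c] by (simp add: scaleC_fun_def scaleC_complex_def)
qed

lemma completion_ip_nonneg:
  assumes "F \<in> hilbert_completion"
  shows "0 \<le> Re (completion_ip F F)"
  using LIMSEQ_le_const[OF tendsto_Re[OF completion_ip_lim[OF assms assms]], of 0]
    s_self_nonneg[OF approx_seq_mem[OF assms]] by blast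

lemma nrm_approx_seq_lim:
  assumes "F \<in> hilbert_completion"
  shows "(\<lambda>n. nrm (approx_seq F n)) \<longlonglongrightarrow> ip_norm completion_ip F"
  unfolding ip_norm_def by (rule tendsto_real_sqrt[OF tendsto_Re[OF completion_ip_lim[OF assms assms]]])

lemma completion_norm_bound:
  assumes "F \<in> hilbert_completion" "w \<in> V"
  shows "cmod (F w) \<le> ip_norm completion_ip F * nrm w"
proof (rule LIMSEQ_le_const)
  show "(\<lambda>n. (inverse (real (Suc n)) + nrm (approx_seq F n)) * nrm w) \<longlonglongrightarrow> ip_norm completion_ip F * nrm w"
    using tendsto_mult_right[OF tendsto_add[OF LIMSEQ_inverse_real_of_nat nrm_approx_seq_lim[OF assms(1)]], of "nrm w"]
    by simp
  show "\<exists>N. \<forall>n\<ge>N. cmod (F w) \<le> (inverse (real (Suc n)) + nrm (approx_seq F n)) * nrm w"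
    using approximates_bound[OF approx_seq[OF assms(1)] assms(2)] by (simp add: inverse_eq_divide)
qed

lemma completion_norm_le:
  assumes "F \<in> hilbert_completion" "0 \<le> C" "\<And>w. w \<in> V \<Longrightarrow> cmod (F w) \<le> C * nrm w"
  shows "ip_norm completion_ip F \<le> C"
proof (rule LIMSEQ_le[OF nrm_approx_seq_lim[OF assms(1)]])
  show "(\<lambda>n. inverse (real (Suc n)) + C) \<longlonglongrightarrow> C"
    using tendsto_add[OF LIMSEQ_inverse_real_of_nat tendsto_const[of C]] by simp
  show "\<exists>N. \<forall>n\<ge>N. nrm (approx_seq F n) \<le> inverse (real (Suc n)) + C"
    using approximates_nrm_le[OF approx_seq[OF assms(1)] assms(2,3)] by (simp add: inverse_eq_divide)
qed

text \<open>A Cauchy sequence converges pointwise on \<open>V\<close>, uniformly relative to \<open>nrm\<close>.\<close>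

lemma complete_completion:
  assumes X: "\<And>n. X n \<in> hilbert_completion"
    and Cauchy: "\<And>e. e > 0 \<Longrightarrow> \<exists>N::nat. \<forall>m\<ge>N. \<forall>n\<ge>N. ip_norm completion_ip (X m - X n) < e"
  shows "\<exists>L\<in>hilbert_completion. (\<lambda>n. ip_norm completion_ip (X n - L)) \<longlonglongrightarrow> 0"
proof -
  have diff: "cmod (X m w - X n w) \<le> ip_norm completion_ip (X m - X n) * nrm w" if "w \<in> V" for m n w
    using completion_norm_bound[OF diff_mem_completion[OF X[of m] X[of n]] that] by simp
  have "Cauchy (\<lambda>n. X n w)" if w: "w \<in> V" for w
  proof (rule CauchyI)
    fix e :: real assume e: "0 < e"
    have pos: "0 < nrm w + 1" using nrm_nonneg[OF w] by simp
    obtain N where N: "\<And>m n. m \<ge> N \<Longrightarrow> n \<ge> N \<Longrightarrow> ip_norm completion_ip (X m - X n) < e / (nrm w + 1)"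
      using Cauchy[of "e / (nrm w + 1)"] e pos by auto
    have "cmod (X m w - X n w) < e" if "m \<ge> N" "n \<ge> N" for m n
    proof -
      have "cmod (X m w - X n w) \<le> e / (nrm w + 1) * nrm w"
        by (rule order.trans[OF diff[OF w] mult_right_mono[OF less_imp_le[OF N[OF that]] nrm_nonneg[OF w]]])
      also have "\<dots> < e" using e pos by (simp add: field_simps)
      finally show ?thesis .
    qed
    then show "\<exists>M. \<forall>m\<ge>M. \<forall>n\<ge>M. cmod (X m w - X n w) < e" by blast
  qed
  then have conv: "(\<lambda>n. X n w) \<longlonglongrightarrow> lim (\<lambda>n. X n w)" if "w \<in> V" for w
    using that by (simp add: Cauchy_convergent convergent_LIMSEQ_iff[symmetric])
  define L where "L w = (if w \<in> V then lim (\<lambda>n. X n w) else 0)" for w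
  have close: "\<exists>N. \<forall>n\<ge>N. \<forall>w\<in>V. cmod (X n w - L w) \<le> e * nrm w" if e: "0 < e" for e
  proof -
    obtain N where N: "\<And>m n. m \<ge> N \<Longrightarrow> n \<ge> N \<Longrightarrow> ip_norm completion_ip (X m - X n) < e"
      using Cauchy[OF e] by auto
    have "cmod (X n w - L w) \<le> e * nrm w" if n: "n \<ge> N" and w: "w \<in> V" for n w
    proof (rule LIMSEQ_le_const2)
      show "(\<lambda>m. cmod (X n w - X m w)) \<longlonglongrightarrow> cmod (X n w - L w)"
        using conv[OF w] w by (auto simp: L_def intro!: tendsto_intros)
      show "\<exists>M. \<forall>m\<ge>M. cmod (X n w - X m w) \<le> e * nrm w"
        using order.trans[OF diff[OF w] mult_right_mono[OF less_imp_le[OF N[OF n]] nrm_nonneg[OF w]]] by blast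
    qed
    then show ?thesis by blast
  qed
  have L: "L \<in> hilbert_completion"
  proof -
    have "\<exists>v. approximates v e L" if e: "0 < e" for e
    proof -
      obtain n where n: "\<And>w. w \<in> V \<Longrightarrow> cmod (X n w - L w) \<le> e / 2 * nrm w"
        using close[of "e / 2"] e by auto
      obtain v where v: "approximates v (e / 2) (X n)"
        using X[of n] half_gt_zero[OF e] unfolding hilbert_completion_def by blast
      have "cmod (L w - s v w) \<le> e * nrm w" if w: "w \<in> V" for w
      proof -
        have "cmod (L w - s v w) \<le> cmod (X n w - s v w) + cmod (X n w - L w)"
          using norm_triangle_ineq4[of "X n w - s v w" "X n w - L w"] by simp
        also have "\<dots> \<le> e / 2 * nrm w + e / 2 * nrm w"
          using v n[OF w] w by (intro add_mono) (auto simp: approximates_def)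
        finally show ?thesis by (simp add: field_simps)
      qed
      then show ?thesis using v e by (auto simp: approximates_def)
    qed
    then show ?thesis by (simp add: hilbert_completion_def L_def)
  qed
  moreover have "(\<lambda>n. ip_norm completion_ip (X n - L)) \<longlonglongrightarrow> 0"
  proof (rule LIMSEQ_I)
    fix r :: real assume r: "0 < r"
    obtain N where N: "\<And>n w. n \<ge> N \<Longrightarrow> w \<in> V \<Longrightarrow> cmod (X n w - L w) \<le> r / 2 * nrm w"
      using close[of "r / 2"] r by auto
    have "norm (ip_norm completion_ip (X n - L) - 0) < r" if "n \<ge> N" for n
    proof -
      have D: "X n - L \<in> hilbert_completion" by (rule diff_mem_completion[OF X L])
      have "ip_norm completion_ip (X n - L) \<le> r / 2"
        by (rule completion_norm_le[OF D]) (use r N[OF that] in auto)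
      moreover have "0 \<le> ip_norm completion_ip (X n - L)"
        using completion_ip_nonneg[OF D] by (simp add: ip_norm_def)
      ultimately show ?thesis using r by simp
    qed
    then show "\<exists>N. \<forall>n\<ge>N. norm (ip_norm completion_ip (X n - L) - 0) < r" by blast
  qed
  ultimately show ?thesis by blast
qed

lemma complex_hilbert_space_completion: "complex_hilbert_space hilbert_completion completion_ip"
proof
  fix F assume F: "F \<in> hilbert_completion" "completion_ip F F = 0"
  have "F w = 0" for w
    using completion_norm_bound[OF F(1), of w] F by (cases "w \<in> V") (auto simp: ip_norm_def hilbert_completion_def)
  then show "F = 0" by (simp add: fun_eq_iff)
qed (auto simp: zero_mem_completion add_mem_completion scaleC_mem_completion completion_ip_left
    completion_ip_nonneg complete_completion intro: completion_ip_commute)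

end

section \<open>Orthogonal projections in a Hilbert space\<close>

context complex_hilbert_space
begin

lemma ip_add_right: "\<lbrakk>x \<in> S; y \<in> S; z \<in> S\<rbrakk> \<Longrightarrow> ip z (x + y) = ip z x + ip z y"
  using ip_diff_right[of "x + y" y z] add_mem by simp

lemma ip_zero_right: "x \<in> S \<Longrightarrow> ip x 0 = 0"
  using ip_commute[of 0 x] ip_zero_left zero_mem by simp

lemma ip_norm_sq: "x \<in> S \<Longrightarrow> (ip_norm ip x)\<^sup>2 = Re (ip x x)"
  by (simp add: ip_norm_def ip_self_nonneg)

lemma ip_norm_scaleC: "x \<in> S \<Longrightarrow> ip_norm ip (c *\<^sub>C x) = cmod c * ip_norm ip x"
proof -
  assume x: "x \<in> S"
  have "ip (c *\<^sub>C x) (c *\<^sub>C x) = (c * cnj c) * ip x x"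
    using x scaleC_mem[OF x, of c] by (simp add: ip_scaleC_left ip_scaleC_right)
  then have "Re (ip (c *\<^sub>C x) (c *\<^sub>C x)) = (cmod c)\<^sup>2 * Re (ip x x)"
    by (simp add: complex_norm_square[symmetric] flip: of_real_power)
  then show ?thesis by (simp add: ip_norm_def real_sqrt_mult)
qed

lemma ip_norm_triangle:
  assumes x: "x \<in> S" and y: "y \<in> S"
  shows "ip_norm ip (x + y) \<le> ip_norm ip x + ip_norm ip y"
proof (rule power2_le_imp_le)
  have "(ip_norm ip (x + y))\<^sup>2 = Re (ip x x) + Re (ip y y) + (Re (ip x y) + Re (ip y x))"
    using x y by (simp add: ip_norm_sq add_mem ip_add_left ip_add_right)
  also have "Re (ip x y) + Re (ip y x) = 2 * Re (ip x y)" using ip_commute[OF x y] by simp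
  also have "Re (ip x y) \<le> ip_norm ip x * ip_norm ip y"
    using Cauchy_Schwarz[OF x y] complex_Re_le_cmod order.trans by blast
  finally show "(ip_norm ip (x + y))\<^sup>2 \<le> (ip_norm ip x + ip_norm ip y)\<^sup>2"
    using x y by (simp add: power2_sum ip_norm_sq)
  show "0 \<le> ip_norm ip x + ip_norm ip y" using ip_norm_nonneg x y by simp
qed

lemma parallelogram:
  assumes "x \<in> S" "y \<in> S"
  shows "(ip_norm ip (x + y))\<^sup>2 + (ip_norm ip (x - y))\<^sup>2 = 2 * (ip_norm ip x)\<^sup>2 + 2 * (ip_norm ip y)\<^sup>2"
  using assms by (simp add: ip_norm_sq add_mem diff_mem ip_add_left ip_add_right ip_diff_left ip_diff_right)

text \<open>A minimising sequence for the distance of \<open>x\<close> to \<open>T\<close> is Cauchy by the parallelogram law; at the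
  minimiser \<open>t\<close> the first variation in the direction \<open>y\<close> vanishes.\<close>

theorem orthogonal_projection:
  assumes T: "closed_linear_subspace T" and x: "x \<in> S"
  obtains t where "t \<in> T" "\<And>y. y \<in> T \<Longrightarrow> ip (x - t) y = 0"
proof -
  have TS: "T \<subseteq> S" and T0: "0 \<in> T" and Tadd: "\<And>u v. u \<in> T \<Longrightarrow> v \<in> T \<Longrightarrow> u + v \<in> T"
    and Tsc: "\<And>c u. u \<in> T \<Longrightarrow> c *\<^sub>C u \<in> T"
    using T unfolding closed_linear_subspace_def by simp_all
  have Tlim: "l \<in> T" if "l \<in> S" "\<And>n::nat. X n \<in> T" "(\<lambda>n. ip_norm ip (X n - l)) \<longlonglongrightarrow> 0" for X l
  proof -
    have "\<forall>X. \<forall>l\<in>S. (\<forall>n::nat. X n \<in> T) \<and> (\<lambda>n. ip_norm ip (X n - l)) \<longlonglongrightarrow> 0 \<longrightarrow> l \<in> T"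
      using T unfolding closed_linear_subspace_def by (elim conjE)
    from this[rule_format, OF that(1), of X] that show ?thesis by simp
  qed
  define d where "d = (INF y\<in>T. (ip_norm ip (x - y))\<^sup>2)"
  have bdd: "bdd_below ((\<lambda>y. (ip_norm ip (x - y))\<^sup>2) ` T)" by (rule bdd_belowI2[of _ 0]) simp
  have d_le: "d \<le> (ip_norm ip (x - y))\<^sup>2" if "y \<in> T" for y
    unfolding d_def using bdd that by (rule cINF_lower)
  have "\<exists>y\<in>T. (ip_norm ip (x - y))\<^sup>2 < d + inverse (real (Suc n))" for n
  proof -
    have "d < d + inverse (real (Suc n))" by simp
    then show ?thesis unfolding d_def using cINF_less_iff[OF _ bdd] T0 by blast
  qed
  then obtain X where X: "\<And>n. X n \<in> T" "\<And>n. (ip_norm ip (x - X n))\<^sup>2 < d + inverse (real (Suc n))"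
    by metis
  have XS: "X n \<in> S" for n using X TS by blast
  have close: "(ip_norm ip (X m - X n))\<^sup>2 \<le> 2 * inverse (real (Suc m)) + 2 * inverse (real (Suc n))" for m n
  proof -
    let ?c = "complex_of_real (1/2)"
    have mid: "?c *\<^sub>C (X m + X n) \<in> T" using X Tadd Tsc by blast
    have half: "2 *\<^sub>C (?c *\<^sub>C u) = u" for u :: 'h by (simp add: scaleC_scaleC scaleC_one)
    have "(x - X n) + (x - X m) = 2 *\<^sub>C (x - ?c *\<^sub>C (X m + X n))"
    proof -
      have "2 *\<^sub>C x = x + x" using scaleC_add_left[of 1 1 x] by (simp add: scaleC_one)
      then show ?thesis unfolding scaleC_diff_right half by (simp add: algebra_simps)
    qed
    then have "(ip_norm ip ((x - X n) + (x - X m)))\<^sup>2 = 4 * (ip_norm ip (x - ?c *\<^sub>C (X m + X n)))\<^sup>2"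
      using diff_mem[OF x, of "?c *\<^sub>C (X m + X n)"] mid TS by (auto simp: ip_norm_scaleC power_mult_distrib)
    then have "4 * d \<le> (ip_norm ip ((x - X n) + (x - X m)))\<^sup>2" using d_le[OF mid] by simp
    moreover have "(x - X n) - (x - X m) = X m - X n" by simp
    ultimately show ?thesis
      using parallelogram[OF diff_mem[OF x XS[of n]] diff_mem[OF x XS[of m]]] X(2)[of m] X(2)[of n]
      by simp
  qed
  have "\<exists>N. \<forall>m\<ge>N. \<forall>n\<ge>N. ip_norm ip (X m - X n) < e" if e: "0 < e" for e
  proof -
    obtain N where N: "\<And>n. n \<ge> N \<Longrightarrow> inverse (real (Suc n)) < e\<^sup>2 / 4"
      using order_tendstoD(2)[OF LIMSEQ_inverse_real_of_nat, of "e\<^sup>2 / 4"] e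
      by (auto simp: eventually_sequentially)
    have "ip_norm ip (X m - X n) < e" if "m \<ge> N" "n \<ge> N" for m n
    proof (rule power2_less_imp_less)
      show "(ip_norm ip (X m - X n))\<^sup>2 < e\<^sup>2"
        using close[of m n] N[OF that(1)] N[OF that(2)] by linarith
    qed (use e in simp)
    then show ?thesis by blast
  qed
  then obtain t where t: "t \<in> S" "(\<lambda>n. ip_norm ip (X n - t)) \<longlonglongrightarrow> 0"
    using complete[of X] XS by blast
  have tT: "t \<in> T" by (rule Tlim[OF t(1) X(1) t(2)])
  have xt: "x - t \<in> S" by (rule diff_mem[OF x t(1)])
  have min: "(ip_norm ip (x - t))\<^sup>2 \<le> d"
  proof (rule LIMSEQ_le_const)
    have "(\<lambda>n. (sqrt (d + inverse (real (Suc n))) + ip_norm ip (X n - t))\<^sup>2) \<longlonglongrightarrow> (sqrt (d + 0) + 0)\<^sup>2"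
      by (intro tendsto_intros LIMSEQ_inverse_real_of_nat t)
    moreover have "0 \<le> d" unfolding d_def using T0 by (intro cINF_greatest) auto
    ultimately show "(\<lambda>n. (sqrt (d + inverse (real (Suc n))) + ip_norm ip (X n - t))\<^sup>2) \<longlonglongrightarrow> d" by simp
    have "(ip_norm ip (x - t))\<^sup>2 \<le> (sqrt (d + inverse (real (Suc n))) + ip_norm ip (X n - t))\<^sup>2" for n
    proof (rule power_mono)
      have "ip_norm ip (x - t) \<le> ip_norm ip (x - X n) + ip_norm ip (X n - t)"
        using ip_norm_triangle[OF diff_mem[OF x XS[of n]] diff_mem[OF XS[of n] t(1)]] by simp
      moreover have "ip_norm ip (x - X n) \<le> sqrt (d + inverse (real (Suc n)))"
        by (rule real_le_rsqrt) (use X(2)[of n] in simp)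
      ultimately show "ip_norm ip (x - t) \<le> sqrt (d + inverse (real (Suc n))) + ip_norm ip (X n - t)" by simp
    qed (rule ip_norm_nonneg[OF xt])
    then show "\<exists>N. \<forall>n\<ge>N. (ip_norm ip (x - t))\<^sup>2 \<le> (sqrt (d + inverse (real (Suc n))) + ip_norm ip (X n - t))\<^sup>2"
      by blast
  qed
  have "ip (x - t) y = 0" if y: "y \<in> T" for y
  proof (rule ccontr)
    assume ne: "ip (x - t) y \<noteq> 0"
    define a where "a = ip (x - t) y"
    have yS: "y \<in> S" using y TS by blast
    define r where "r = 1 / ((ip_norm ip y)\<^sup>2 + 1)"
    define c where "c = of_real r * a"
    have cy: "c *\<^sub>C y \<in> S" by (rule scaleC_mem[OF yS])
    have ya: "ip y (x - t) = cnj a" using ip_commute[OF xt yS] by (simp add: a_def)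
    have aa: "a * cnj a = of_real ((cmod a)\<^sup>2)" by (rule complex_norm_square[symmetric])
    have c: "cnj c * a = of_real (r * (cmod a)\<^sup>2)" "c * cnj a = of_real (r * (cmod a)\<^sup>2)"
      "c * cnj c = of_real (r\<^sup>2 * (cmod a)\<^sup>2)"
      using aa by (simp_all add: c_def power2_eq_square ac_simps)
    have "ip (x - t - c *\<^sub>C y) (x - t - c *\<^sub>C y)
        = ip (x - t) (x - t) - cnj c * a - (c * cnj a - (c * cnj c) * ip y y)"
      unfolding ip_diff_left[OF xt cy diff_mem[OF xt cy]] ip_diff_right[OF xt cy xt] ip_diff_right[OF xt cy cy]
      by (simp add: ip_scaleC_left[OF yS] ip_scaleC_right[OF _ yS] xt cy yS ya flip: a_def)
    then have "Re (ip (x - t - c *\<^sub>C y) (x - t - c *\<^sub>C y))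
        = Re (ip (x - t) (x - t)) - 2 * r * (cmod a)\<^sup>2 + r\<^sup>2 * (cmod a)\<^sup>2 * Re (ip y y)"
      unfolding c by simp
    moreover have "d \<le> (ip_norm ip (x - (t + c *\<^sub>C y)))\<^sup>2" by (rule d_le) (use tT y Tadd Tsc in blast)
    ultimately have "2 * r * (cmod a)\<^sup>2 \<le> r\<^sup>2 * (cmod a)\<^sup>2 * (ip_norm ip y)\<^sup>2"
      using min ip_norm_sq[OF xt] ip_norm_sq[OF diff_mem[OF xt cy]] ip_norm_sq[OF yS]
      by (simp add: diff_diff_eq)
    moreover have "r\<^sup>2 * (cmod a)\<^sup>2 * (ip_norm ip y)\<^sup>2 = (r * (cmod a)\<^sup>2) * (r * (ip_norm ip y)\<^sup>2)"
      by (simp add: power2_eq_square)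
    moreover have "0 < (ip_norm ip y)\<^sup>2 + 1" by (simp add: add_nonneg_pos)
    then have r: "0 < r" "r * (ip_norm ip y)\<^sup>2 \<le> 1" by (simp_all add: r_def)
    moreover have pos: "0 < r * (cmod a)\<^sup>2" using r ne by (simp add: a_def)
    moreover have "(r * (cmod a)\<^sup>2) * (r * (ip_norm ip y)\<^sup>2) \<le> (r * (cmod a)\<^sup>2) * 1"
      using r pos by (intro mult_left_mono) auto
    ultimately show False by linarith
  qed
  then show ?thesis using that tT by blast
qed

end

lemma (in star_representation) rep_contractive:
  assumes B: "cstar_subalgebra B" and b: "b \<in> B" and h: "h \<in> S"
  shows "ip_norm ip (\<pi> b h) \<le> norm b * ip_norm ip h"
proof (rule field_le_epsilon)
  fix e :: real assume e: "0 < e"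
  have nh: "0 \<le> ip_norm ip h" by (rule ip_norm_nonneg[OF h])
  define r where "r = norm b + e / (ip_norm ip h + 1)"
  have pos: "0 < e / (ip_norm ip h + 1)" using e nh by simp
  then have r: "norm b < r" "0 < r" by (auto simp: r_def add_nonneg_pos)
  let ?c = "complex_of_real (1 / r)"
  have cb: "?c *\<^sub>C b \<in> B" using B b by (simp add: cstar_subalgebra_def)
  have "norm (?c *\<^sub>C b) < 1" using r by (simp add: norm_scaleC norm_divide)
  then have "ip_norm ip (\<pi> (?c *\<^sub>C b) h) \<le> ip_norm ip h"
    by (rule rep_norm_le[OF B cb _ h])
  moreover have "ip_norm ip (\<pi> (?c *\<^sub>C b) h) = (1 / r) * ip_norm ip (\<pi> b h)"
    using r b h by (simp add: rep_scaleC ip_norm_scaleC op_mem norm_divide)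
  ultimately have "(1 / r) * ip_norm ip (\<pi> b h) \<le> ip_norm ip h" by metis
  then have "ip_norm ip (\<pi> b h) \<le> r * ip_norm ip h" using r by (simp add: field_simps)
  also have "\<dots> = norm b * ip_norm ip h + e * (ip_norm ip h / (ip_norm ip h + 1))"
    by (simp add: r_def distrib_right)
  also have "\<dots> \<le> norm b * ip_norm ip h + e * 1"
    using e nh by (intro add_left_mono mult_left_mono) (auto simp: field_simps)
  finally show "ip_norm ip (\<pi> b h) \<le> norm b * ip_norm ip h + e" by simp
qed

section \<open>The GNS representation of an extreme state\<close>

locale cstar_state =
  fixes B :: "'b::{cstar_algebra,real_normed_algebra_1} set" and \<phi> :: "'b \<Rightarrow> complex"
  assumes B: "cstar_subalgebra B" and one_mem: "1 \<in> B"
    and \<phi>_add: "\<lbrakk>x \<in> B; y \<in> B\<rbrakk> \<Longrightarrow> \<phi> (x + y) = \<phi> x + \<phi> y"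
    and \<phi>_scaleC: "x \<in> B \<Longrightarrow> \<phi> (c *\<^sub>C x) = c * \<phi> x"
    and \<phi>_star: "x \<in> B \<Longrightarrow> \<phi> (star x) = cnj (\<phi> x)"
    and \<phi>_pos: "x \<in> B \<Longrightarrow> 0 \<le> Re (\<phi> (star x * x))"
    and \<phi>_one: "\<phi> 1 = 1"
begin

lemma B_closed:
  "0 \<in> B" "\<lbrakk>x \<in> B; y \<in> B\<rbrakk> \<Longrightarrow> x + y \<in> B" "x \<in> B \<Longrightarrow> c *\<^sub>C x \<in> B"
  "\<lbrakk>x \<in> B; y \<in> B\<rbrakk> \<Longrightarrow> x * y \<in> B" "x \<in> B \<Longrightarrow> star x \<in> B"
  using B by (simp_all add: cstar_subalgebra_def)

sublocale semi_inner_product B "\<lambda>x y. \<phi> (star y * x)"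
proof
  fix x y assume "x \<in> B" "y \<in> B"
  then show "\<phi> (star x * y) = cnj (\<phi> (star y * x))"
    using \<phi>_star[of "star y * x"] by (simp add: star_mult star_star B_closed)
qed (simp_all add: B_closed distrib_left \<phi>_add mult_scaleC_right \<phi>_scaleC \<phi>_pos)

abbreviation "gns_space \<equiv> hilbert_completion"
abbreviation "gns_ip \<equiv> completion_ip"

text \<open>On the functional of a vector \<open>v\<close> this is left multiplication of \<open>v\<close> by \<open>b\<close>; see \<open>gns_rep_vector\<close>.\<close>

definition gns_rep :: "'b \<Rightarrow> ('b \<Rightarrow> complex) \<Rightarrow> ('b \<Rightarrow> complex)" where
  "gns_rep b F = (\<lambda>w. if w \<in> B then F (star b * w) else 0)"

abbreviation "cyclic_vector \<equiv> vector_functional 1"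

sublocale H: complex_hilbert_space gns_space gns_ip
  by (rule complex_hilbert_space_completion)

text \<open>Writing \<open>norm b ^ 2 - b\<^sup>* b\<close> as a square \<open>k\<^sup>2\<close>, the difference of the two sides (squared) is the
  value of \<open>\<phi>\<close> at \<open>(k w)\<^sup>* (k w)\<close>.\<close>

lemma nrm_mult_le:
  assumes b: "b \<in> B" and w: "w \<in> B"
  shows "nrm (b * w) \<le> norm b * nrm w"
proof (rule power2_le_imp_le)
  define a where "a = star b * b"
  have aB: "a \<in> B" using b by (simp add: a_def B_closed)
  have a: "star a = a" "norm a = (norm b)\<^sup>2"
    by (simp_all add: a_def star_mult star_star norm_star_mult_self)
  obtain k where k: "k \<in> sa_bicommutant B a" "k * k = (norm b)\<^sup>2 *\<^sub>R 1 - a"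
    using sqrt_of_scalar_minus[OF closed_real_subalgebra_sa_bicommutant[OF B] one_mem_sa_bicommutant[OF one_mem]
        sa_bicommutant_self[OF aB a(1)], of "(norm b)\<^sup>2"] a(2) by auto
  have kB: "k \<in> B" and sk: "star k = k" using sa_bicommutantD k(1) by auto
  have "star (k * w) * (k * w) = star w * (k * k) * w" by (simp add: star_mult sk mult.assoc)
  also have "\<dots> = of_real ((norm b)\<^sup>2) *\<^sub>C (star w * w) - star (b * w) * (b * w)"
    by (simp add: k(2) a_def left_diff_distrib right_diff_distrib star_mult mult.assoc scaleR_scaleC
        mult_scaleC_left mult_scaleC_right)
  finally have eq: "star (k * w) * (k * w) + star (b * w) * (b * w)
      = of_real ((norm b)\<^sup>2) *\<^sub>C (star w * w)" by simp
  have "\<phi> (star (k * w) * (k * w)) + \<phi> (star (b * w) * (b * w)) = of_real ((norm b)\<^sup>2) * \<phi> (star w * w)"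
    using \<phi>_add[of "star (k * w) * (k * w)" "star (b * w) * (b * w)"] \<phi>_scaleC[of "star w * w"] kB b w
    by (simp add: eq B_closed)
  from arg_cong[OF this, of Re]
  have "Re (\<phi> (star (k * w) * (k * w))) + Re (\<phi> (star (b * w) * (b * w)))
      = (norm b)\<^sup>2 * Re (\<phi> (star w * w))" by simp
  then show "(nrm (b * w))\<^sup>2 \<le> (norm b * nrm w)\<^sup>2"
    using \<phi>_pos[of "k * w"] kB b w by (simp add: nrm_sq B_closed power_mult_distrib)
  show "0 \<le> norm b * nrm w" using w nrm_nonneg by simp
qed

lemma gns_rep_approximates:
  assumes b: "b \<in> B" and v: "approximates v e F"
  shows "approximates (b * v) (norm b * e) (gns_rep b F)"
proof -
  have vB: "v \<in> B" and e: "0 \<le> e" using v by (auto simp: approximates_def)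
  have "cmod (gns_rep b F w - \<phi> (star w * (b * v))) \<le> norm b * e * nrm w" if w: "w \<in> B" for w
  proof -
    have bw: "star b * w \<in> B" using b w by (simp add: B_closed)
    have "star (star b * w) * v = star w * (b * v)" by (simp add: star_mult star_star mult.assoc)
    then have "cmod (gns_rep b F w - \<phi> (star w * (b * v))) \<le> e * nrm (star b * w)"
      using v bw w by (auto simp: approximates_def gns_rep_def)
    also have "\<dots> \<le> e * (norm (star b) * nrm w)"
      using nrm_mult_le[of "star b" w] b w e by (intro mult_left_mono) (auto simp: B_closed)
    finally show ?thesis by (simp add: norm_star ac_simps)
  qed
  then show ?thesis using vB b e by (simp add: approximates_def B_closed)
qed

lemma gns_rep_mem:
  assumes b: "b \<in> B" and F: "F \<in> gns_space"
  shows "gns_rep b F \<in> gns_space"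
proof -
  have "\<exists>v. approximates v e (gns_rep b F)" if e: "0 < e" for e
  proof -
    have pos: "0 < norm b + 1" by (simp add: add_nonneg_pos)
    then obtain v where "approximates v (e / (norm b + 1)) F"
      using F e unfolding hilbert_completion_def by fastforce
    from gns_rep_approximates[OF b this]
    have "approximates (b * v) (norm b * (e / (norm b + 1))) (gns_rep b F)" .
    moreover have "norm b * (e / (norm b + 1)) \<le> e" using e pos by (simp add: field_simps)
    ultimately show ?thesis using approximates_mono by blast
  qed
  then show ?thesis by (simp add: hilbert_completion_def gns_rep_def)
qed

lemma gns_rep_vector: "b \<in> B \<Longrightarrow> v \<in> B \<Longrightarrow> gns_rep b (vector_functional v) = vector_functional (b * v)"
  by (auto simp: gns_rep_def vector_functional_def fun_eq_iff B_closed star_mult star_star mult.assoc)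

lemma gns_rep_adjoint:
  assumes b: "b \<in> B" and F: "F \<in> gns_space" and G: "G \<in> gns_space"
  shows "gns_ip (gns_rep (star b) F) G = gns_ip F (gns_rep b G)"
proof -
  have bF: "gns_rep (star b) F \<in> gns_space" and bG: "gns_rep b G \<in> gns_space"
    using gns_rep_mem b F G B_closed(5) by auto
  obtain C where C: "0 \<le> C" "\<And>w. w \<in> B \<Longrightarrow> cmod (F w) \<le> C * nrm w" using completion_bounded[OF F] by blast
  obtain K where K: "0 \<le> K" "\<And>w. w \<in> B \<Longrightarrow> cmod (gns_rep (star b) F w) \<le> K * nrm w"
    using completion_bounded[OF bF] by blast
  have val: "gns_rep (star b) F (approx_seq G n) = F (b * approx_seq G n)" for n
    using approx_seq_mem[OF G] by (simp add: gns_rep_def star_star)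
  have lim1: "(\<lambda>n. F (b * approx_seq G n)) \<longlonglongrightarrow> gns_ip (gns_rep (star b) F) G"
    using completion_ip_approx(1)[OF bF G K] by (simp add: val)
  have "cmod (gns_ip F (gns_rep b G) - F (b * approx_seq G n)) \<le> C * (norm b * inverse (real (Suc n)))" for n
    using completion_ip_approx(2)[OF F bG C gns_rep_approximates[OF b approx_seq[OF G]]]
    by (simp add: inverse_eq_divide)
  moreover have "(\<lambda>n. C * (norm b * inverse (real (Suc n)))) \<longlonglongrightarrow> 0"
    using LIMSEQ_inverse_real_of_nat by (intro tendsto_mult_right_zero)
  ultimately have "(\<lambda>n. gns_ip F (gns_rep b G) - F (b * approx_seq G n)) \<longlonglongrightarrow> 0"
    by (intro Lim_null_comparison[of "\<lambda>n. gns_ip F (gns_rep b G) - F (b * approx_seq G n)"]) auto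
  from tendsto_diff[OF tendsto_const this, of "gns_ip F (gns_rep b G)"]
  have "(\<lambda>n. F (b * approx_seq G n)) \<longlonglongrightarrow> gns_ip F (gns_rep b G)" by simp
  with lim1 show ?thesis by (rule LIMSEQ_unique)
qed

lemma star_representation_gns: "star_representation gns_space gns_ip B gns_rep"
proof
  fix b assume b: "b \<in> B"
  show "\<exists>C. \<forall>F\<in>gns_space. ip_norm gns_ip (gns_rep b F) \<le> C * ip_norm gns_ip F"
  proof (intro exI ballI)
    fix F assume F: "F \<in> gns_space"
    have nF: "0 \<le> ip_norm gns_ip F" by (rule H.ip_norm_nonneg[OF F])
    show "ip_norm gns_ip (gns_rep b F) \<le> norm b * ip_norm gns_ip F"
    proof (rule completion_norm_le[OF gns_rep_mem[OF b F]])
      fix w assume w: "w \<in> B"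
      have bw: "star b * w \<in> B" using b w by (simp add: B_closed)
      have "cmod (gns_rep b F w) \<le> ip_norm gns_ip F * nrm (star b * w)"
        using completion_norm_bound[OF F bw] w by (simp add: gns_rep_def)
      also have "\<dots> \<le> ip_norm gns_ip F * (norm (star b) * nrm w)"
        using nrm_mult_le[OF _ w, of "star b"] b nF by (intro mult_left_mono) (auto simp: B_closed)
      finally show "cmod (gns_rep b F w) \<le> norm b * ip_norm gns_ip F * nrm w"
        by (simp add: norm_star ac_simps)
    qed (simp add: nF)
  qed
  fix F assume F: "F \<in> gns_space"
  show "gns_rep (c *\<^sub>C b) F = c *\<^sub>C gns_rep b F" for c
  proof
    fix w show "gns_rep (c *\<^sub>C b) F w = (c *\<^sub>C gns_rep b F) w"
      using completion_conj_linear(2)[OF F, of "star b * w" 1 "cnj c"] b one_mem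
      by (cases "w \<in> B")
        (simp_all add: gns_rep_def scaleC_fun_def scaleC_complex_def star_scaleC mult_scaleC_left B_closed)
  qed
  fix d assume d: "d \<in> B"
  show "gns_rep (b + d) F = gns_rep b F + gns_rep d F"
  proof
    fix w show "gns_rep (b + d) F w = (gns_rep b F + gns_rep d F) w"
      using completion_conj_linear(1)[OF F, of "star b * w" "star d * w"] b d
      by (cases "w \<in> B") (simp_all add: gns_rep_def star_add distrib_right B_closed)
  qed
  show "gns_rep (b * d) F = gns_rep b (gns_rep d F)"
    using b by (auto simp: gns_rep_def star_mult mult.assoc B_closed)
next
  fix b F G show "gns_rep b (F + G) = gns_rep b F + gns_rep b G"
    by (auto simp: gns_rep_def fun_eq_iff)
next
  fix b F c show "gns_rep b (c *\<^sub>C F) = c *\<^sub>C gns_rep b F"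
    by (auto simp: gns_rep_def scaleC_fun_def scaleC_complex_def fun_eq_iff)
qed (auto simp: gns_rep_mem gns_rep_adjoint)

sublocale R: star_representation gns_space gns_ip B gns_rep
  by (rule star_representation_gns)

lemma cyclic_vector_mem: "cyclic_vector \<in> gns_space"
  by (rule vector_functional_mem[OF one_mem])

lemma gns_rep_cyclic_vector: "b \<in> B \<Longrightarrow> gns_rep b cyclic_vector = vector_functional b"
  using gns_rep_vector[OF _ one_mem] by simp

lemma gns_ip_cyclic_vector: "F \<in> gns_space \<Longrightarrow> gns_ip F cyclic_vector = F 1"
  by (rule completion_ip_vector_functional[OF _ one_mem])

lemma gns_ip_vector_state: "b \<in> B \<Longrightarrow> gns_ip (gns_rep b cyclic_vector) cyclic_vector = \<phi> b"
  using gns_ip_cyclic_vector[OF vector_functional_mem, of b] vector_functional_def[of b] one_mem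
  by (simp add: gns_rep_cyclic_vector)

lemma gns_rep_one: "F \<in> gns_space \<Longrightarrow> gns_rep 1 F = F"
  by (auto simp: gns_rep_def hilbert_completion_def fun_eq_iff)

lemma gns_rep_vanishes:
  assumes I: "I \<in> Ideal B" and \<phi>I: "\<And>x. x \<in> I \<Longrightarrow> \<phi> x = 0"
    and i: "i \<in> I" and F: "F \<in> gns_space"
  shows "gns_rep i F = 0"
proof
  fix w
  have iB: "i \<in> B" using I i by (auto simp: Ideal_def)
  show "gns_rep i F w = 0 w"
  proof (cases "w \<in> B")
    case w: True
    have "\<phi> (star (star i * w) * v) = 0" if v: "v \<in> B" for v
    proof -
      have "star w * i * v \<in> I" using I i v B_closed(5)[OF w] unfolding Ideal_def by blast
      then show ?thesis using \<phi>I by (simp add: star_mult star_star)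
    qed
    then have "(\<lambda>n. 0 :: complex) \<longlonglongrightarrow> F (star i * w)"
      using approx_seq_lim[OF F, of "star i * w"] approx_seq_mem[OF F] w iB by (simp add: B_closed)
    then have "F (star i * w) = 0" by (rule LIMSEQ_unique[OF _ tendsto_const])
    then show ?thesis by (simp add: gns_rep_def)
  qed (simp add: gns_rep_def)
qed

text \<open>The representation kills \<open>I\<close> and is contractive, so for a unit vector \<open>\<tau>\<close> the vector
  functional is dominated by the distance to \<open>I\<close>, like \<open>\<phi>\<close> itself.\<close>

lemma vector_state_dominated:
  assumes I: "I \<in> Ideal B" and \<phi>I: "\<And>x. x \<in> I \<Longrightarrow> \<phi> x = 0"
    and \<tau>: "\<tau> \<in> gns_space" and x: "x \<in> B"
  shows "Re (gns_ip (gns_rep x \<tau>) \<tau>) \<le> Re (gns_ip \<tau> \<tau>) * infdist x I"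
proof -
  have I0: "I \<noteq> {}" using I by (auto simp: Ideal_def)
  have le: "Re (gns_ip (gns_rep x \<tau>) \<tau>) \<le> Re (gns_ip \<tau> \<tau>) * norm (x - i)" if i: "i \<in> I" for i
  proof -
    have iB: "i \<in> B" using I i by (auto simp: Ideal_def)
    have xi: "x - i \<in> B" using V_diff[OF x iB] .
    have "gns_rep (x - i + i) \<tau> = gns_rep (x - i) \<tau> + gns_rep i \<tau>" by (rule R.rep_add[OF xi iB \<tau>])
    then have eq: "gns_rep x \<tau> = gns_rep (x - i) \<tau>" using gns_rep_vanishes[OF I \<phi>I i \<tau>] by simp
    have "Re (gns_ip (gns_rep (x - i) \<tau>) \<tau>) \<le> cmod (gns_ip (gns_rep (x - i) \<tau>) \<tau>)" by (rule complex_Re_le_cmod)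
    also have "\<dots> \<le> ip_norm gns_ip (gns_rep (x - i) \<tau>) * ip_norm gns_ip \<tau>"
      by (rule H.Cauchy_Schwarz[OF gns_rep_mem[OF xi \<tau>] \<tau>])
    also have "\<dots> \<le> (norm (x - i) * ip_norm gns_ip \<tau>) * ip_norm gns_ip \<tau>"
      by (intro mult_right_mono R.rep_contractive[OF B xi \<tau>] H.ip_norm_nonneg[OF \<tau>])
    also have "\<dots> = (ip_norm gns_ip \<tau>)\<^sup>2 * norm (x - i)" by (simp add: power2_eq_square)
    finally show ?thesis by (simp add: eq H.ip_norm_sq[OF \<tau>])
  qed
  show ?thesis
  proof (cases "Re (gns_ip \<tau> \<tau>) = 0")
    case True
    then show ?thesis using le I0 by fastforce
  next
    case False
    then have t: "0 < Re (gns_ip \<tau> \<tau>)" using completion_ip_nonneg[OF \<tau>] by simp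
    have "Re (gns_ip (gns_rep x \<tau>) \<tau>) / Re (gns_ip \<tau> \<tau>) \<le> infdist x I"
      unfolding infdist_notempty[OF I0]
      by (rule cINF_greatest[OF I0]) (use le t in \<open>simp add: dist_norm field_simps\<close>)
    then show ?thesis using t by (simp add: field_simps)
  qed
qed

text \<open>The projection \<open>\<tau>\<close> of the cyclic vector to an invariant subspace splits \<open>\<phi>\<close> into the vector
  functionals of \<open>\<tau>\<close> and of its orthogonal complement.  Extremality of \<open>\<phi>\<close> makes the first proportional
  to \<open>\<phi>\<close>, and so \<open>\<tau>\<close> to the cyclic vector.\<close>

theorem gns_irreducible:
  assumes I: "I \<in> Ideal B" and \<phi>I: "\<And>x. x \<in> I \<Longrightarrow> \<phi> x = 0"
    and extreme: "\<And>f g t x. \<lbrakk>real_linear_on B f; dominated_on B f (\<lambda>x. infdist x I); real_linear_on B g;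
        dominated_on B g (\<lambda>x. infdist x I); 0 < t; t < 1;
        \<And>y. y \<in> B \<Longrightarrow> Re (\<phi> y) = t * f y + (1 - t) * g y; x \<in> B\<rbrakk> \<Longrightarrow> f x = Re (\<phi> x)"
  shows "irreducible_representation gns_space gns_ip B gns_rep"
proof
  have "gns_ip cyclic_vector cyclic_vector = 1"
    using gns_ip_vector_state[OF one_mem] gns_rep_one[OF cyclic_vector_mem] \<phi>_one by simp
  note unit = this
  then have "gns_rep 1 cyclic_vector \<noteq> 0"
    using gns_rep_one[OF cyclic_vector_mem] H.ip_zero_left[OF cyclic_vector_mem] by auto
  then show "\<exists>b\<in>B. \<exists>F\<in>gns_space. gns_rep b F \<noteq> 0" using one_mem cyclic_vector_mem by blast
  fix T assume T: "H.closed_linear_subspace T"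
    and inv: "\<And>b F. \<lbrakk>b \<in> B; F \<in> T\<rbrakk> \<Longrightarrow> gns_rep b F \<in> T"
  have TS: "T \<subseteq> gns_space" and T0: "0 \<in> T" and Tsc: "\<And>c u. u \<in> T \<Longrightarrow> c *\<^sub>C u \<in> T"
    using T unfolding H.closed_linear_subspace_def by simp_all
  have coord: "F w = gns_ip (gns_rep (star w) F) cyclic_vector" if "F \<in> gns_space" "w \<in> B" for F w
    using gns_ip_cyclic_vector[OF gns_rep_mem[OF B_closed(5)[OF that(2)] that(1)]] that one_mem
    by (simp add: gns_rep_def star_star)
  have zero: "F = 0" if "F \<in> gns_space" "\<And>w. w \<in> B \<Longrightarrow> F w = 0" for F
    using that by (auto simp: hilbert_completion_def fun_eq_iff)
  have full: "T = gns_space" if c: "cyclic_vector \<in> T"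
  proof -
    have vT: "vector_functional v \<in> T" if "v \<in> B" for v
      using inv[OF that c] gns_rep_cyclic_vector[OF that] by simp
    have "F \<in> T" if F: "F \<in> gns_space" for F
    proof -
      define X where "X n = vector_functional (approx_seq F n)" for n
      have XT: "X n \<in> T" for n unfolding X_def by (rule vT[OF approx_seq_mem[OF F]])
      have "ip_norm gns_ip (X n - F) \<le> inverse (real (Suc n))" for n
      proof (rule completion_norm_le)
        show "X n - F \<in> gns_space" using XT TS F by (intro diff_mem_completion) auto
        fix w assume w: "w \<in> B"
        then show "cmod ((X n - F) w) \<le> inverse (real (Suc n)) * nrm w"
          using approx_seq[OF F, of n]
          by (simp add: approximates_def X_def vector_functional_def norm_minus_commute inverse_eq_divide)
      qed simp
      moreover have "0 \<le> ip_norm gns_ip (X n - F)" for n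
        using XT TS F by (intro H.ip_norm_nonneg diff_mem_completion) auto
      ultimately have "(\<lambda>n. ip_norm gns_ip (X n - F)) \<longlonglongrightarrow> 0"
        by (intro tendsto_sandwich[OF _ _ tendsto_const LIMSEQ_inverse_real_of_nat] always_eventually) auto
      moreover have "\<forall>X. \<forall>l\<in>gns_space. (\<forall>n::nat. X n \<in> T) \<and> (\<lambda>n. ip_norm gns_ip (X n - l)) \<longlonglongrightarrow> 0 \<longrightarrow> l \<in> T"
        using T unfolding H.closed_linear_subspace_def by (elim conjE)
      ultimately show ?thesis using XT F by blast
    qed
    then show ?thesis using TS by blast
  qed
  obtain \<tau> where \<tau>T: "\<tau> \<in> T" and orth: "\<And>y. y \<in> T \<Longrightarrow> gns_ip (cyclic_vector - \<tau>) y = 0"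
    using H.orthogonal_projection[OF T cyclic_vector_mem] by blast
  have \<tau>: "\<tau> \<in> gns_space" using \<tau>T TS by blast
  define \<sigma> where "\<sigma> = cyclic_vector - \<tau>"
  have \<sigma>: "\<sigma> \<in> gns_space" unfolding \<sigma>_def by (rule diff_mem_completion[OF cyclic_vector_mem \<tau>])
  have split: "cyclic_vector = \<tau> + \<sigma>" by (simp add: \<sigma>_def)
  have \<sigma>y: "gns_ip \<sigma> y = 0" if "y \<in> T" for y using orth[OF that] by (simp add: \<sigma>_def)
  have y\<sigma>: "gns_ip y \<sigma> = 0" if y: "y \<in> T" for y
    using completion_ip_commute[OF \<sigma>, of y] \<sigma>y[OF y] y TS by auto
  define t where "t = Re (gns_ip \<tau> \<tau>)"
  have "gns_ip cyclic_vector cyclic_vector = gns_ip \<tau> \<tau> + gns_ip \<sigma> \<sigma>"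
    unfolding split using \<sigma>y[OF \<tau>T] y\<sigma>[OF \<tau>T]
    by (simp add: H.ip_add_left H.ip_add_right \<tau> \<sigma> add_mem_completion)
  then have "gns_ip \<tau> \<tau> + gns_ip \<sigma> \<sigma> = 1" using unit by simp
  from arg_cong[OF this, of Re] have s: "Re (gns_ip \<sigma> \<sigma>) = 1 - t" by (simp add: t_def)
  have y_cyclic: "gns_ip y cyclic_vector = gns_ip y \<tau>" if "y \<in> T" for y
    unfolding split using that TS y\<sigma>[OF that] \<tau> \<sigma> by (auto simp: H.ip_add_right)
  consider "t = 0" | "t = 1" | "0 < t" "t < 1"
    using completion_ip_nonneg[OF \<tau>] completion_ip_nonneg[OF \<sigma>] s by (force simp: t_def)
  then show "T = {0} \<or> T = gns_space"
  proof cases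
    case 1
    have \<tau>0: "\<tau> = 0" using 1 H.ip_self_real[OF \<tau>] H.ip_self_eq_0[OF \<tau>] by (simp add: t_def)
    have "F = 0" if F: "F \<in> T" for F
    proof (rule zero)
      show FS: "F \<in> gns_space" using F TS by blast
      fix w assume w: "w \<in> B"
      have "gns_rep (star w) F \<in> T" using inv[OF B_closed(5)[OF w] F] .
      then show "F w = 0"
        using coord[OF FS w] y_cyclic H.ip_zero_right TS by (auto simp: \<tau>0)
    qed
    then show ?thesis using T0 by blast
  next
    case 2
    then have "\<sigma> = 0" using s H.ip_self_real[OF \<sigma>] H.ip_self_eq_0[OF \<sigma>] by simp
    then show ?thesis using full \<tau>T by (simp add: split)
  next
    case 3
    define f where "f x = Re (gns_ip (gns_rep x \<tau>) \<tau>) / t" for x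
    define g where "g x = Re (gns_ip (gns_rep x \<sigma>) \<sigma>) / (1 - t)" for x
    have lin: "real_linear_on B (\<lambda>x. Re (gns_ip (gns_rep x \<rho>) \<rho>) / r)" if \<rho>: "\<rho> \<in> gns_space" for \<rho> r
      using \<rho> by (simp add: real_linear_on_def R.rep_add R.rep_scaleC scaleR_scaleC completion_ip_left
          gns_rep_mem add_divide_distrib)
    have dom: "dominated_on B f (\<lambda>x. infdist x I)" "dominated_on B g (\<lambda>x. infdist x I)"
      using vector_state_dominated[OF I \<phi>I \<tau>] vector_state_dominated[OF I \<phi>I \<sigma>] 3 s
      by (auto simp: dominated_on_def f_def g_def t_def field_simps)
    have decomp: "\<phi> x = gns_ip (gns_rep x \<tau>) \<tau> + gns_ip (gns_rep x \<sigma>) \<sigma>" if x: "x \<in> B" for x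
    proof -
      have x\<tau>: "gns_rep x \<tau> \<in> T" by (rule inv[OF x \<tau>T])
      have "gns_ip (gns_rep (star (star x)) \<sigma>) \<tau> = gns_ip \<sigma> (gns_rep (star x) \<tau>)"
        by (rule gns_rep_adjoint[OF B_closed(5)[OF x] \<sigma> \<tau>])
      then have "gns_ip (gns_rep x \<sigma>) \<tau> = 0" using \<sigma>y[OF inv[OF B_closed(5)[OF x] \<tau>T]] by (simp add: star_star)
      moreover have "gns_rep x cyclic_vector = gns_rep x \<tau> + gns_rep x \<sigma>"
        unfolding split by (rule R.op_add[OF x \<tau> \<sigma>])
      ultimately show ?thesis
        using gns_ip_vector_state[OF x] y\<sigma>[OF x\<tau>] gns_rep_mem[OF x \<tau>] gns_rep_mem[OF x \<sigma>] \<tau> \<sigma>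
        by (simp add: completion_ip_left H.ip_add_right cyclic_vector_mem)
          (simp add: split H.ip_add_right)
    qed
    have fRe: "f x = Re (\<phi> x)" if x: "x \<in> B" for x
    proof (rule extreme[of f g t, OF _ dom(1) _ dom(2) 3 _ x])
      show "real_linear_on B f" "real_linear_on B g" unfolding f_def g_def using lin \<tau> \<sigma> by blast+
      fix y assume "y \<in> B"
      then show "Re (\<phi> y) = t * f y + (1 - t) * g y"
        using decomp 3 by (simp add: f_def g_def)
    qed
    have proportional: "gns_ip (gns_rep x \<tau>) cyclic_vector = t * gns_ip (gns_rep x cyclic_vector) cyclic_vector"
      if x: "x \<in> B" for x
    proof -
      have "Re (gns_ip (gns_rep x \<tau>) \<tau>) = t * Re (\<phi> x)" if "x \<in> B" for x
        using fRe[OF that] 3 by (simp add: f_def field_simps)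
      note re = this
      have "gns_ip (gns_rep (- \<i> *\<^sub>C x) \<tau>) \<tau> = - \<i> * gns_ip (gns_rep x \<tau>) \<tau>"
        using x \<tau> by (simp add: R.rep_scaleC completion_ip_left gns_rep_mem)
      then have "Im (gns_ip (gns_rep x \<tau>) \<tau>) = t * Im (\<phi> x)"
        using re[OF B_closed(3)[OF x, of "- \<i>"]] \<phi>_scaleC[OF x, of "- \<i>"] by simp
      then have "gns_ip (gns_rep x \<tau>) \<tau> = t * \<phi> x" using re[OF x] by (simp add: complex_eq_iff)
      then show ?thesis using y_cyclic[OF inv[OF x \<tau>T]] gns_ip_vector_state[OF x] by simp
    qed
    have tc: "of_real t *\<^sub>C cyclic_vector \<in> gns_space" by (rule scaleC_mem_completion[OF cyclic_vector_mem])
    have "\<tau> - of_real t *\<^sub>C cyclic_vector = 0"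
    proof (rule zero)
      show "\<tau> - of_real t *\<^sub>C cyclic_vector \<in> gns_space" by (rule diff_mem_completion[OF \<tau> tc])
      fix w assume w: "w \<in> B"
      have "\<tau> w = t * cyclic_vector w"
        unfolding coord[OF \<tau> w] coord[OF cyclic_vector_mem w] by (rule proportional[OF B_closed(5)[OF w]])
      then show "(\<tau> - of_real t *\<^sub>C cyclic_vector) w = 0"
        by (simp add: scaleC_fun_def scaleC_complex_def)
    qed
    then have "cyclic_vector = of_real (1 / t) *\<^sub>C \<tau>" using 3 by (simp add: scaleC_scaleC scaleC_one)
    then have "cyclic_vector \<in> T" using Tsc[OF \<tau>T] by metis
    then show ?thesis using full by blast
  qed
qed

end

section \<open>Distances to ideals and irreducible representations attaining them\<close>

lemma IdealD:
  assumes "I \<in> Ideal B"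
  shows "I \<subseteq> B" "0 \<in> I" "\<lbrakk>x \<in> I; y \<in> I\<rbrakk> \<Longrightarrow> x + y \<in> I" "x \<in> I \<Longrightarrow> c *\<^sub>C x \<in> I"
    "\<lbrakk>b \<in> B; x \<in> I\<rbrakk> \<Longrightarrow> b * x \<in> I" "\<lbrakk>b \<in> B; x \<in> I\<rbrakk> \<Longrightarrow> x * b \<in> I" "closed I"
  using assms by (auto simp: Ideal_def)

lemma Ideal_scaleR: "I \<in> Ideal B \<Longrightarrow> x \<in> I \<Longrightarrow> r *\<^sub>R x \<in> I"
  by (simp add: scaleR_scaleC IdealD(4))

lemma Ideal_minus: "I \<in> Ideal B \<Longrightarrow> x \<in> I \<Longrightarrow> - x \<in> I"
  using IdealD(4)[of I B x "- 1"] by (simp add: scaleC_minus_one)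

lemma Ideal_diff: "I \<in> Ideal B \<Longrightarrow> x \<in> I \<Longrightarrow> y \<in> I \<Longrightarrow> x - y \<in> I"
  using IdealD(3)[of I B x "- y"] Ideal_minus[of I B y] by simp

lemma scaleC_scaleR: "c *\<^sub>C (r *\<^sub>R x) = r *\<^sub>R (c *\<^sub>C (x::'a::cstar_algebra))"
  by (simp add: scaleR_scaleC scaleC_scaleC mult.commute)

lemma infdist_lessD: "A \<noteq> {} \<Longrightarrow> infdist x A < e \<Longrightarrow> \<exists>a\<in>A. dist x a < e"
  using cINF_less_iff[of A "dist x" e] bdd_below_image_dist[of x A]
  by (simp add: infdist_notempty)

lemma le_infdist: "A \<noteq> {} \<Longrightarrow> (\<And>a. a \<in> A \<Longrightarrow> m \<le> dist x a) \<Longrightarrow> m \<le> infdist x A"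
  by (simp add: infdist_notempty cINF_greatest)

text \<open>The distance to an ideal is the norm of the quotient algebra.  It is used directly, as a
  submultiplicative seminorm.\<close>

context
  fixes I B :: "'a::cstar_algebra set"
  assumes I: "I \<in> Ideal B"
begin

lemma infdist_ideal_le_norm: "infdist x I \<le> norm x"
  using infdist_le[OF IdealD(2)[OF I], of x] by simp

lemma infdist_ideal_eq_0: "infdist x I = 0 \<longleftrightarrow> x \<in> I"
  using in_closed_iff_infdist_zero[OF IdealD(7)[OF I]] IdealD(2)[OF I] by auto

lemma infdist_ideal_pos: "0 < infdist x I \<longleftrightarrow> x \<notin> I"
  using infdist_ideal_eq_0[of x] infdist_nonneg[of x I] by linarith

lemma infdist_ideal_triangle: "infdist (x + y) I \<le> infdist x I + infdist y I"
proof (rule field_le_epsilon)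
  fix e :: real assume e: "0 < e"
  have ne: "I \<noteq> {}" using IdealD(2)[OF I] by blast
  obtain i j where ij: "i \<in> I" "dist x i < infdist x I + e / 2" "j \<in> I" "dist y j < infdist y I + e / 2"
    using infdist_lessD[OF ne, of x "infdist x I + e / 2"] infdist_lessD[OF ne, of y "infdist y I + e / 2"] e by auto
  have "infdist (x + y) I \<le> dist (x + y) (i + j)" using ij IdealD(3)[OF I] by (intro infdist_le) auto
  also have "\<dots> \<le> dist x i + dist y j" by (rule dist_triangle_add)
  finally show "infdist (x + y) I \<le> infdist x I + infdist y I + e" using ij by simp
qed

lemma infdist_ideal_scaleR:
  assumes r: "0 \<le> r"
  shows "infdist (r *\<^sub>R x) I = r * infdist x I"
proof (cases "r = 0")
  case True
  then show ?thesis using IdealD(2)[OF I] by simp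
next
  case False
  have ne: "I \<noteq> {}" using IdealD(2)[OF I] by blast
  have le: "infdist (r *\<^sub>R x) I \<le> r * infdist x I" if r: "0 < r" for r x
  proof -
    have "infdist (r *\<^sub>R x) I / r \<le> infdist x I"
    proof (rule le_infdist[OF ne])
      fix a assume "a \<in> I"
      then have "infdist (r *\<^sub>R x) I \<le> dist (r *\<^sub>R x) (r *\<^sub>R a)" by (intro infdist_le Ideal_scaleR[OF I])
      also have "\<dots> = r * dist x a" using r by (simp add: dist_norm flip: scaleR_diff_right)
      finally show "infdist (r *\<^sub>R x) I / r \<le> dist x a"
        using r by (simp add: pos_divide_le_eq mult.commute)
    qed
    then show ?thesis using r by (simp add: field_simps)
  qed
  have "infdist ((1 / r) *\<^sub>R (r *\<^sub>R x)) I \<le> (1 / r) * infdist (r *\<^sub>R x) I"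
    using False r by (intro le) simp
  then have "r * infdist x I \<le> infdist (r *\<^sub>R x) I" using False r by (simp add: field_simps)
  then show ?thesis using le[of r x] False r by simp
qed

lemma infdist_ideal_mult:
  assumes x: "x \<in> B" and y: "y \<in> B"
  shows "infdist (x * y) I \<le> infdist x I * infdist y I"
proof -
  have ne: "I \<noteq> {}" using IdealD(2)[OF I] by blast
  have le: "infdist (x * y) I \<le> dist x i * dist y j" if ij: "i \<in> I" "j \<in> I" for i j
  proof -
    have iB: "i \<in> B" using ij IdealD(1)[OF I] by blast
    have "i * (y - j) + x * j \<in> I"
      using IdealD(5)[OF I iB ij(2)] IdealD(6)[OF I y ij(1)] IdealD(5)[OF I x ij(2)]
      by (simp add: right_diff_distrib Ideal_diff[OF I] IdealD(3)[OF I])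
    then have "infdist (x * y) I \<le> dist (x * y) (i * (y - j) + x * j)" by (rule infdist_le)
    also have "\<dots> = norm ((x - i) * (y - j))" by (simp add: dist_norm algebra_simps)
    also have "\<dots> \<le> dist x i * dist y j" unfolding dist_norm by (rule norm_mult_ineq)
    finally show ?thesis .
  qed
  have le': "infdist (x * y) I \<le> infdist x I * dist y j" if j: "j \<in> I" for j
  proof (cases "dist y j = 0")
    case True
    then show ?thesis using le[OF IdealD(2)[OF I] j] by simp
  next
    case False
    then have pos: "0 < dist y j" by simp
    have "infdist (x * y) I / dist y j \<le> infdist x I"
      by (rule le_infdist[OF ne]) (use le j pos in \<open>simp add: pos_divide_le_eq\<close>)
    then show ?thesis using pos by (simp add: pos_divide_le_eq)
  qed
  show ?thesis
  proof (cases "infdist x I = 0")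
    case True
    then show ?thesis using le'[OF IdealD(2)[OF I]] by simp
  next
    case False
    then have pos: "0 < infdist x I" using infdist_nonneg[of x I] by simp
    have "infdist (x * y) I / infdist x I \<le> infdist y I"
      by (rule le_infdist[OF ne]) (use le' pos in \<open>simp add: pos_divide_le_eq mult.commute\<close>)
    then show ?thesis using pos by (simp add: pos_divide_le_eq mult.commute)
  qed
qed

lemma threshold_element_mem_ideal:
  assumes mem: "f \<in> B" "y \<in> B" "v * v \<in> B" "v * v * y \<in> B" and y: "norm y \<le> 1"
    and eq: "f + f = f * y + f * (v * v * y)" and lt: "infdist (v * v) I < 1"
  shows "f \<in> I"
proof -
  have y1: "infdist y I \<le> 1" using infdist_ideal_le_norm[of y] y by linarith
  have "2 * infdist f I = infdist (f + f) I" using infdist_ideal_scaleR[of 2 f] by (simp add: scaleR_2)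
  also have "\<dots> \<le> infdist (f * y) I + infdist (f * (v * v * y)) I" unfolding eq by (rule infdist_ideal_triangle)
  also have "\<dots> \<le> infdist f I * infdist y I + infdist f I * (infdist (v * v) I * infdist y I)"
    using mem by (intro add_mono order.trans[OF infdist_ideal_mult] mult_left_mono infdist_ideal_mult)
      (auto simp: infdist_nonneg)
  also have "\<dots> \<le> infdist f I * 1 + infdist f I * (infdist (v * v) I * 1)"
    using y1 by (intro add_mono mult_left_mono) (auto simp: infdist_nonneg)
  finally have "infdist f I * (1 - infdist (v * v) I) \<le> 0" by (simp add: algebra_simps)
  then have "infdist f I = 0" using lt infdist_nonneg[of f I] by (simp add: mult_le_0_iff)
  then show ?thesis by (simp add: infdist_ideal_eq_0)
qed

lemma infdist_le_one_of_threshold_element: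
  assumes mem: "y \<in> B" "v * v \<in> B" and y: "norm y \<le> 1"
    and eq: "v * v * y + y + f + v * v * f = v * v + v * v" and f: "f \<in> I"
  shows "infdist (v * v) I \<le> 1"
proof -
  have y1: "infdist y I \<le> 1" using infdist_ideal_le_norm[of y] y by linarith
  have f0: "infdist f I = 0" "infdist (v * v * f) I = 0"
    using f IdealD(5)[OF I mem(2) f] by (simp_all add: infdist_ideal_eq_0)
  have "2 * infdist (v * v) I = infdist (v * v + v * v) I"
    using infdist_ideal_scaleR[of 2 "v * v"] by (simp add: scaleR_2)
  also have "\<dots> \<le> infdist (v * v * y) I + infdist y I + infdist f I + infdist (v * v * f) I"
    using infdist_ideal_triangle[of "v * v * y + y + f" "v * v * f"]
      infdist_ideal_triangle[of "v * v * y + y" f] infdist_ideal_triangle[of "v * v * y" y]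
    unfolding eq by linarith
  also have "\<dots> \<le> infdist (v * v) I * infdist y I + 1"
    using y1 f0 infdist_ideal_mult[OF mem(2,1)] by simp
  also have "\<dots> \<le> infdist (v * v) I * 1 + 1"
    using y1 by (intro add_right_mono mult_left_mono) (auto simp: infdist_nonneg)
  finally show ?thesis by simp
qed

end

text \<open>In the quotient by \<open>I\<close> this says that \<open>norm (d + h\<^sup>2) \<ge> 2 d\<close> for \<open>d = norm (h\<^sup>2)\<close>.  For \<open>\<delta> < d\<close> the
  threshold element \<open>f\<close> of \<open>h / sqrt \<delta>\<close> is outside \<open>I\<close>, and \<open>2 f = f (1 + h\<^sup>2 / \<delta>) y\<close> shows that
  \<open>1 + h\<^sup>2 / \<delta>\<close> has distance at least \<open>2\<close>.\<close>

lemma infdist_scalar_plus_square_ge: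
  fixes h :: "'a::{cstar_algebra,real_normed_algebra_1}"
  assumes B: "cstar_subalgebra B" "1 \<in> B" and I: "I \<in> Ideal B" and h: "h \<in> B" "star h = h"
  defines "d \<equiv> infdist (h * h) I"
  shows "2 * d \<le> infdist (d *\<^sub>R 1 + h * h) I"
proof -
  have sub: "subspace B" by (rule cstar_subalgebra_subspace[OF B(1)])
  have mult: "x * y \<in> B" if "x \<in> B" "y \<in> B" for x y using B(1) that by (simp add: cstar_subalgebra_def)
  have I1: "infdist (r *\<^sub>R 1) I \<le> r" if "0 \<le> r" for r :: real
    using infdist_ideal_le_norm[OF I, of "r *\<^sub>R 1"] that by simp
  have below: "2 * \<delta> \<le> infdist (\<delta> *\<^sub>R 1 + h * h) I" if \<delta>: "0 < \<delta>" "\<delta> < d" for \<delta>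
  proof -
    define v where "v = (1 / sqrt \<delta>) *\<^sub>R h"
    have v: "v \<in> B" "star v = v" using h sub by (simp_all add: v_def subspace_scale star_scaleR)
    have vv: "v * v = (1 / \<delta>) *\<^sub>R (h * h)" using \<delta> by (simp add: v_def)
    obtain f y where fy: "f \<in> B" "y \<in> B" "norm y \<le> 1" "f + f = f * y + f * (v * v * y)"
      "v * v * y + y + f + v * v * f = v * v + v * v"
      by (rule threshold_element_unital[OF B(1) v])
    have "1 < infdist (v * v) I" using \<delta> by (simp add: vv infdist_ideal_scaleR[OF I] d_def[symmetric])
    then have "f \<notin> I"
      using infdist_le_one_of_threshold_element[OF I fy(2) mult[OF v(1) v(1)] fy(3,5)] by linarith
    then have pos: "0 < infdist f I" by (simp add: infdist_ideal_pos[OF I])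
    have wB: "1 + v * v \<in> B" using B(2) mult[OF v(1) v(1)] sub by (simp add: subspace_add)
    have "f + f = f * ((1 + v * v) * y)" by (subst fy(4)) (simp add: algebra_simps)
    then have "2 * infdist f I = infdist (f * ((1 + v * v) * y)) I"
      using infdist_ideal_scaleR[OF I, of 2 f] by (simp add: scaleR_2)
    also have "\<dots> \<le> infdist f I * (infdist (1 + v * v) I * infdist y I)"
      using fy wB mult by (intro order.trans[OF infdist_ideal_mult[OF I]] mult_left_mono infdist_ideal_mult[OF I])
        (auto simp: infdist_nonneg)
    also have "\<dots> \<le> infdist f I * (infdist (1 + v * v) I * 1)"
      using infdist_ideal_le_norm[OF I, of y] fy(3) by (intro mult_left_mono) (auto simp: infdist_nonneg)
    finally have "2 \<le> infdist (1 + v * v) I" using pos by (simp add: mult.commute)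
    moreover have "\<delta> *\<^sub>R 1 + h * h = \<delta> *\<^sub>R (1 + v * v)" using \<delta> by (simp add: vv scaleR_right_distrib)
    ultimately show ?thesis using \<delta> infdist_ideal_scaleR[OF I, of \<delta> "1 + v * v"] by (simp add: mult_left_mono mult.commute[of 2])
  qed
  show ?thesis
  proof (cases "0 < d")
    case True
    show ?thesis
    proof (rule field_le_epsilon)
      fix e :: real assume e: "0 < e"
      define \<delta> where "\<delta> = max (d / 2) (d - e / 3)"
      have \<delta>: "0 < \<delta>" "\<delta> < d" "d - e / 3 \<le> \<delta>" using True e by (auto simp: \<delta>_def)
      have "infdist (\<delta> *\<^sub>R 1 + h * h) I \<le> infdist (d *\<^sub>R 1 + h * h) I + (d - \<delta>)"
      proof -
        have "\<delta> *\<^sub>R 1 + h * h = (d *\<^sub>R 1 + h * h) + (- ((d - \<delta>) *\<^sub>R 1))" by (simp add: algebra_simps)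
        moreover have "infdist (- ((d - \<delta>) *\<^sub>R 1)) I \<le> d - \<delta>"
          using infdist_ideal_le_norm[OF I, of "- ((d - \<delta>) *\<^sub>R 1)"] \<delta> by simp
        ultimately show ?thesis using infdist_ideal_triangle[OF I] by (metis add_left_mono order.trans)
      qed
      then show "2 * d \<le> infdist (d *\<^sub>R 1 + h * h) I + e" using below[OF \<delta>(1,2)] \<delta>(3) by simp
    qed
  next
    case False
    then have "d = 0" using infdist_nonneg[of "h * h" I] by (simp add: d_def)
    then show ?thesis by (simp add: infdist_nonneg)
  qed
qed

text \<open>For real \<open>s\<close> the element \<open>s + \<i> h\<close> has norm at most \<open>sqrt (s\<^sup>2 + (norm h)\<^sup>2)\<close>, which exceeds \<open>s\<close> by
  arbitrarily little when \<open>s\<close> is large, while \<open>\<psi> (s + \<i> h) = s + \<psi> (\<i> h)\<close>.\<close>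

lemma norm_one_functional_on_imaginary:
  fixes \<psi> :: "'a::{cstar_algebra,real_normed_algebra_1} \<Rightarrow> real"
  assumes B: "cstar_subalgebra B" "1 \<in> B" and lin: "real_linear_on B \<psi>"
    and le: "\<And>x. x \<in> B \<Longrightarrow> \<psi> x \<le> norm x" and one: "\<psi> 1 = 1"
    and h: "h \<in> B" "star h = h"
  shows "\<psi> (\<i> *\<^sub>C h) = 0"
proof -
  have le0: "\<psi> (\<i> *\<^sub>C h) \<le> 0" if h: "h \<in> B" "star h = h" for h
  proof (rule ccontr)
    assume "\<not> \<psi> (\<i> *\<^sub>C h) \<le> 0"
    then have pos: "0 < \<psi> (\<i> *\<^sub>C h)" by simp
    define s where "s = (norm h)\<^sup>2 / \<psi> (\<i> *\<^sub>C h)"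
    have s: "0 \<le> s" using pos by (simp add: s_def)
    have ih: "\<i> *\<^sub>C h \<in> B" and sB: "s *\<^sub>R 1 \<in> B"
      using B h by (auto simp: cstar_subalgebra_def scaleR_scaleC)
    define u where "u = s *\<^sub>R 1 + \<i> *\<^sub>C h"
    have uB: "u \<in> B" using ih sB B(1) by (simp add: u_def cstar_subalgebra_def)
    have "star u * u = s\<^sup>2 *\<^sub>R 1 + h * h"
      by (simp add: u_def star_add star_scaleR star_scaleC h distrib_left distrib_right power2_eq_square
          mult_scaleC_left mult_scaleC_right scaleC_scaleC scaleC_minus_left scaleC_minus_one scaleC_one
          scaleC_diff_right scaleC_add_right scaleC_scaleR algebra_simps)
    then have "(norm u)\<^sup>2 = norm (s\<^sup>2 *\<^sub>R 1 + h * h)" using norm_star_mult_self[of u] by simp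
    also have "\<dots> \<le> s\<^sup>2 + (norm h)\<^sup>2"
      using norm_triangle_ineq[of "s\<^sup>2 *\<^sub>R 1" "h * h"] norm_self_adjoint_square[OF h(2)] by simp
    finally have nu: "(norm u)\<^sup>2 \<le> s\<^sup>2 + (norm h)\<^sup>2" .
    have "\<psi> u = s + \<psi> (\<i> *\<^sub>C h)" using lin ih sB B(2) one by (simp add: u_def real_linear_on_def)
    then have "(s + \<psi> (\<i> *\<^sub>C h))\<^sup>2 \<le> (norm u)\<^sup>2" using le[OF uB] s pos by (intro power_mono) auto
    then have "2 * s * \<psi> (\<i> *\<^sub>C h) + (\<psi> (\<i> *\<^sub>C h))\<^sup>2 \<le> (norm h)\<^sup>2" using nu by (simp add: power2_sum)
    moreover have "s * \<psi> (\<i> *\<^sub>C h) = (norm h)\<^sup>2" using pos by (simp add: s_def)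
    moreover have "0 < (\<psi> (\<i> *\<^sub>C h))\<^sup>2" using pos by simp
    moreover have "0 \<le> (norm h)\<^sup>2" by simp
    ultimately show False by linarith
  qed
  have mh: "- h \<in> B" using B(1) h by (metis cstar_subalgebra_def scaleC_minus_one)
  have ih: "\<i> *\<^sub>C h \<in> B" using B(1) h by (simp add: cstar_subalgebra_def)
  have "\<psi> (\<i> *\<^sub>C (- h)) = - \<psi> (\<i> *\<^sub>C h)"
    using lin ih unfolding real_linear_on_def scaleC_minus_right
    by (metis mult_minus1 scaleR_minus1_left)
  then show ?thesis using le0[OF h] le0[OF mh] h by (simp add: star_minus)
qed

text \<open>The complex linear functional with real part \<open>\<psi>\<close> is real on self-adjoint elements and, as
  \<open>norm (r - y\<^sup>* y) \<le> r\<close> for \<open>r = (norm y)\<^sup>2\<close>, nonnegative at \<open>y\<^sup>* y\<close>.\<close>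

lemma cstar_state_of_real_functional:
  fixes \<psi> :: "'a::{cstar_algebra,real_normed_algebra_1} \<Rightarrow> real"
  assumes B: "cstar_subalgebra B" "1 \<in> B" and lin: "real_linear_on B \<psi>"
    and le: "\<And>x. x \<in> B \<Longrightarrow> \<psi> x \<le> norm x" and one: "\<psi> 1 = 1"
  shows "cstar_state B (\<lambda>x. Complex (\<psi> x) (- \<psi> (\<i> *\<^sub>C x)))"
proof
  have closed: "x + y \<in> B" "c *\<^sub>C x \<in> B" "r *\<^sub>R x \<in> B" "star x \<in> B" "x * y \<in> B" "- x \<in> B" "x - y \<in> B"
    if "x \<in> B" "y \<in> B" for x y c r
  proof -
    show 1: "x + y \<in> B" "c *\<^sub>C x \<in> B" "r *\<^sub>R x \<in> B" "star x \<in> B" "x * y \<in> B"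
      using B(1) that by (simp_all add: cstar_subalgebra_def scaleR_scaleC)
    show "- x \<in> B" "x - y \<in> B"
      using cstar_subalgebra_subspace[OF B(1)] that by (simp_all add: subspace_neg subspace_diff)
  qed
  have add: "\<psi> (x + y) = \<psi> x + \<psi> y" if "x \<in> B" "y \<in> B" for x y
    using lin that by (simp add: real_linear_on_def)
  have scale: "\<psi> (r *\<^sub>R x) = r * \<psi> x" if "x \<in> B" for x r
    using lin that by (simp add: real_linear_on_def)
  have neg: "\<psi> (- x) = - \<psi> x" if "x \<in> B" for x using scale[OF that, of "- 1"] by simp
  have diff: "\<psi> (x - y) = \<psi> x - \<psi> y" if "x \<in> B" "y \<in> B" for x y
    using add[of "x - y" y] that closed by simp
  have imag: "\<psi> (\<i> *\<^sub>C h) = 0" if "h \<in> B" "star h = h" for h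
    by (rule norm_one_functional_on_imaginary[OF B lin le one that])
  show "cstar_subalgebra B" "1 \<in> B" by (fact B)+
  show "Complex (\<psi> (x + y)) (- \<psi> (\<i> *\<^sub>C (x + y))) = Complex (\<psi> x) (- \<psi> (\<i> *\<^sub>C x)) + Complex (\<psi> y) (- \<psi> (\<i> *\<^sub>C y))"
    if "x \<in> B" "y \<in> B" for x y
    using that by (simp add: add closed scaleC_add_right complex_eq_iff)
  show "Complex (\<psi> (c *\<^sub>C x)) (- \<psi> (\<i> *\<^sub>C c *\<^sub>C x)) = c * Complex (\<psi> x) (- \<psi> (\<i> *\<^sub>C x))"
    if x: "x \<in> B" for x c
  proof -
    have split: "c *\<^sub>C z = Re c *\<^sub>R z + Im c *\<^sub>R (\<i> *\<^sub>C z)" for z :: 'a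
    proof -
      have "c = of_real (Re c) + of_real (Im c) * \<i>" by (simp add: complex_eq_iff)
      then have "c *\<^sub>C z = (of_real (Re c) + of_real (Im c) * \<i>) *\<^sub>C z" by simp
      then show ?thesis by (simp only: scaleC_add_left scaleR_scaleC scaleC_scaleC)
    qed
    have "\<i> *\<^sub>C c *\<^sub>C x = c *\<^sub>C (\<i> *\<^sub>C x)" by (simp add: scaleC_scaleC mult.commute)
    also have "\<dots> = Re c *\<^sub>R (\<i> *\<^sub>C x) + Im c *\<^sub>R (- x)"
      unfolding split[of "\<i> *\<^sub>C x"] by (simp add: scaleC_scaleC scaleC_minus_one)
    finally have "\<psi> (\<i> *\<^sub>C c *\<^sub>C x) = \<psi> (Re c *\<^sub>R (\<i> *\<^sub>C x) + Im c *\<^sub>R (- x))" by simp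
    also have "\<dots> = Re c * \<psi> (\<i> *\<^sub>C x) + Im c * \<psi> (- x)"
      using x closed(2,3,6) by (simp only: add scale)
    finally have "\<psi> (\<i> *\<^sub>C c *\<^sub>C x) = Re c * \<psi> (\<i> *\<^sub>C x) + Im c * \<psi> (- x)" .
    moreover have "\<psi> (c *\<^sub>C x) = Re c * \<psi> x + Im c * \<psi> (\<i> *\<^sub>C x)"
      using x by (simp add: split[of x] add scale closed)
    ultimately show ?thesis using neg[OF x] by (simp add: complex_eq_iff algebra_simps)
  qed
  have star_eq: "\<psi> (star x) = \<psi> x" if x: "x \<in> B" for x
  proof -
    define k where "k = - \<i> *\<^sub>C (x - star x)"
    have "star k = k"
      by (simp add: k_def star_scaleC star_diff star_star scaleC_minus_left scaleC_diff_right)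
    moreover have "k \<in> B" unfolding k_def by (rule closed(2)[OF closed(7)[OF x closed(4)[OF x x]] x])
    moreover have "\<i> *\<^sub>C k = x - star x" by (simp add: k_def scaleC_scaleC scaleC_one)
    ultimately have "\<psi> (x - star x) = 0" using imag[of k] by simp
    then show ?thesis using diff[OF x closed(4)[OF x x]] by simp
  qed
  show "Complex (\<psi> (star x)) (- \<psi> (\<i> *\<^sub>C star x)) = cnj (Complex (\<psi> x) (- \<psi> (\<i> *\<^sub>C x)))"
    if x: "x \<in> B" for x
  proof -
    have "\<i> *\<^sub>C star x = star (- (\<i> *\<^sub>C x))" by (simp add: star_minus star_scaleC scaleC_minus_left)
    then have "\<psi> (\<i> *\<^sub>C star x) = - \<psi> (\<i> *\<^sub>C x)"
      using star_eq[of "- (\<i> *\<^sub>C x)"] neg closed x by simp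
    then show ?thesis using star_eq[OF x] by (simp add: complex_eq_iff)
  qed
  show "0 \<le> Re (Complex (\<psi> (star x * x)) (- \<psi> (\<i> *\<^sub>C (star x * x))))" if x: "x \<in> B" for x
  proof -
    have xx: "star x * x \<in> B" by (rule closed(5)[OF closed(4)[OF x x] x])
    have rB: "(norm x)\<^sup>2 *\<^sub>R 1 \<in> B" by (rule closed(3)[OF B(2) B(2)])
    have "(norm x)\<^sup>2 - \<psi> (star x * x) = \<psi> ((norm x)\<^sup>2 *\<^sub>R 1 - star x * x)"
      using diff[OF rB xx] scale[OF B(2)] one by simp
    also have "\<dots> \<le> norm ((norm x)\<^sup>2 *\<^sub>R 1 - star x * x)" using closed(7)[OF rB xx] by (rule le)
    also have "\<dots> \<le> (norm x)\<^sup>2" by (rule norm_scalar_minus_star_mult_self_le)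
    finally show ?thesis by simp
  qed
  show "Complex (\<psi> 1) (- \<psi> (\<i> *\<^sub>C 1)) = 1"
    using imag[OF B(2)] one by (simp add: complex_eq_iff)
qed

text \<open>Let \<open>d\<close> be the distance of \<open>h\<^sup>2\<close> to \<open>I\<close>.  Take \<open>\<psi>\<close> extreme among the functionals dominated by the
  distance to \<open>I\<close> and with the largest possible value at \<open>d + h\<^sup>2\<close>, which is at least \<open>2 d\<close>.  As \<open>\<psi> 1 \<le> 1\<close> and
  \<open>\<psi> (h\<^sup>2) \<le> d\<close>, equality holds in both.  So \<open>\<psi>\<close> is the real part of an extreme state that vanishes on \<open>I\<close>, and
  the representation is its GNS representation.\<close>

theorem irreducible_representation_attaining_distance_unital:
  fixes B :: "'a::{cstar_algebra,real_normed_algebra_1} set"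
  assumes alg: "cstar_subalgebra B" "1 \<in> B" and I: "I \<in> Ideal B" and h: "h \<in> B" "star h = h"
    and pos: "0 < infdist (h * h) I"
  obtains S :: "('a \<Rightarrow> complex) set" and ip \<pi> \<xi>
  where "irreducible_representation S ip B \<pi>" "\<And>x. x \<in> S \<Longrightarrow> \<pi> 1 x = x"
    "\<And>i x. i \<in> I \<Longrightarrow> x \<in> S \<Longrightarrow> \<pi> i x = 0" "\<xi> \<in> S" "ip \<xi> \<xi> = 1"
    "ip (\<pi> (h * h) \<xi>) \<xi> = of_real (infdist (h * h) I)"
proof -
  define d where "d = infdist (h * h) I"
  define p where "p x = infdist x I" for x
  have sub: "subspace B" by (rule cstar_subalgebra_subspace[OF alg(1)])
  have hh: "h * h \<in> B" using alg(1) h by (simp add: cstar_subalgebra_def)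
  have p_sub: "sublinear_on B p"
    by (simp add: sublinear_on_def p_def infdist_ideal_triangle[OF I] infdist_ideal_scaleR[OF I])
  have aB: "d *\<^sub>R 1 + h * h \<in> B" using sub alg(2) hh by (simp add: subspace_add subspace_scale)
  obtain \<psi> where lin: "real_linear_on B \<psi>" and dom: "dominated_on B \<psi> p"
    and attain: "\<psi> (d *\<^sub>R 1 + h * h) = p (d *\<^sub>R 1 + h * h)"
    and extreme: "\<And>f g t x. \<lbrakk>real_linear_on B f; dominated_on B f p; real_linear_on B g; dominated_on B g p;
        0 < t; t < 1; \<And>y. y \<in> B \<Longrightarrow> \<psi> y = t * f y + (1 - t) * g y; x \<in> B\<rbrakk> \<Longrightarrow> f x = \<psi> x"
    using exists_extreme_dominated_functional[OF sub p_sub aB] by blast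
  have le: "\<psi> x \<le> norm x" if "x \<in> B" for x
    using order.trans[OF _ infdist_ideal_le_norm[OF I, of x]] dom that by (simp add: dominated_on_def p_def)
  have "2 * d \<le> d * \<psi> 1 + \<psi> (h * h)"
    using infdist_scalar_plus_square_ge[OF alg I h] attain lin hh alg(2) sub
    by (simp add: p_def d_def real_linear_on_def subspace_scale)
  moreover have "\<psi> (h * h) \<le> d" using dom hh by (simp add: dominated_on_def p_def d_def)
  moreover have "\<psi> 1 \<le> 1" using le[OF alg(2)] by simp
  moreover have "d * \<psi> 1 \<le> d * 1" using \<open>\<psi> 1 \<le> 1\<close> pos by (intro mult_left_mono) (simp_all add: d_def)
  ultimately have hd: "\<psi> (h * h) = d" and "d * \<psi> 1 = d * 1" by linarith+
  then have one: "\<psi> 1 = 1" using pos by (simp add: d_def)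
  define \<phi> where "\<phi> x = Complex (\<psi> x) (- \<psi> (\<i> *\<^sub>C x))" for x
  interpret cstar_state B \<phi>
    unfolding \<phi>_def by (rule cstar_state_of_real_functional[OF alg lin le one])
  have \<psi>I: "\<psi> x = 0" if x: "x \<in> I" for x
  proof -
    have xB: "x \<in> B" "- x \<in> B" using x IdealD(1)[OF I] Ideal_minus[OF I x] by auto
    have "\<psi> (- x) = - \<psi> x" using lin xB unfolding real_linear_on_def by (metis mult_minus1 scaleR_minus1_left)
    moreover have "p x = 0" "p (- x) = 0"
      using x Ideal_minus[OF I x] by (simp_all add: p_def infdist_ideal_eq_0[OF I])
    moreover have "\<psi> x \<le> p x" "\<psi> (- x) \<le> p (- x)" using dom xB by (simp_all add: dominated_on_def)
    ultimately show ?thesis by linarith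
  qed
  then have \<phi>I: "\<phi> x = 0" if "x \<in> I" for x
    using that IdealD(4)[OF I that] by (simp add: \<phi>_def complex_eq_iff)
  have "irreducible_representation gns_space gns_ip B gns_rep"
  proof (rule gns_irreducible[OF I \<phi>I])
    fix f g t x
    assume "real_linear_on B f" "dominated_on B f (\<lambda>x. infdist x I)" "real_linear_on B g"
      "dominated_on B g (\<lambda>x. infdist x I)" "0 < t" "t < 1"
      "\<And>y. y \<in> B \<Longrightarrow> Re (\<phi> y) = t * f y + (1 - t) * g y" "x \<in> B"
    then show "f x = Re (\<phi> x)" using extreme[of f g t x] by (simp add: \<phi>_def p_def[abs_def])
  qed
  moreover have "star (h * h) = h * h" by (simp add: star_mult h)
  then have "\<phi> (h * h) = of_real d"
    using \<phi>_star[OF hh] hd by (simp add: \<phi>_def complex_eq_iff)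
  ultimately show ?thesis
    using that[of gns_space gns_ip gns_rep cyclic_vector] gns_rep_one gns_rep_vanishes[OF I \<phi>I]
      cyclic_vector_mem gns_ip_vector_state[OF hh] gns_ip_vector_state[OF alg(2)] \<phi>_one
    by (simp add: d_def)
qed

section \<open>Adjoining a unit\<close>

datatype 'a unitization = Unitization (scalar_part: complex) (algebra_part: 'a)

definition left_mult :: "'a::cstar_algebra unitization \<Rightarrow> 'a \<Rightarrow> 'a" where
  "left_mult u y = scalar_part u *\<^sub>C y + algebra_part u * y"

lemma bounded_linear_left_mult: "bounded_linear (left_mult u)"
proof -
  have "norm (left_mult u x) \<le> norm x * (cmod (scalar_part u) + norm (algebra_part u))" for x
    using norm_triangle_ineq[of "scalar_part u *\<^sub>C x" "algebra_part u * x"]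
      norm_mult_ineq[of "algebra_part u" x]
    by (simp add: left_mult_def norm_scaleC algebra_simps)
  then show ?thesis
    by (intro bounded_linear_intro[where K = "cmod (scalar_part u) + norm (algebra_part u)"])
      (simp_all add: left_mult_def scaleC_add_right scaleC_scaleR scaleR_right_distrib distrib_left algebra_simps)
qed

instantiation unitization :: (cstar_algebra) "{real_vector, complex_vector, ring, one}"
begin

definition zero_unitization where "0 = Unitization 0 0"
definition one_unitization where "1 = Unitization 1 0"
definition plus_unitization where
  "u + v = Unitization (scalar_part u + scalar_part v) (algebra_part u + algebra_part v)"
definition minus_unitization where
  "u - v = Unitization (scalar_part u - scalar_part v) (algebra_part u - algebra_part v)"
definition uminus_unitization where
  "- u = Unitization (- scalar_part u) (- algebra_part u)"
definition times_unitization where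
  "u * v = Unitization (scalar_part u * scalar_part v)
     (scalar_part u *\<^sub>C algebra_part v + scalar_part v *\<^sub>C algebra_part u + algebra_part u * algebra_part v)"
definition scaleR_unitization where
  "r *\<^sub>R u = Unitization (r *\<^sub>R scalar_part u) (r *\<^sub>R algebra_part u)"
definition scaleC_unitization where
  "c *\<^sub>C u = Unitization (c * scalar_part u) (c *\<^sub>C algebra_part u)"

lemmas unitization_ops = zero_unitization_def one_unitization_def plus_unitization_def
  minus_unitization_def uminus_unitization_def times_unitization_def scaleR_unitization_def
  scaleC_unitization_def

instance
  by standard
    (simp_all add: unitization_ops unitization.expand scaleR_right_distrib scaleR_left_distrib
      scaleC_add_right scaleC_add_left scaleC_scaleC scaleC_one distrib_left distrib_right
      mult_scaleC_left mult_scaleC_right mult.assoc mult.commute[of "_ :: complex"] add_ac)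

end

lemma left_mult_simps:
  "left_mult (u + v) y = left_mult u y + left_mult v y"
  "left_mult (r *\<^sub>R u) y = r *\<^sub>R left_mult u y"
  "left_mult (u * v) y = left_mult u (left_mult v y)"
  by (simp_all add: left_mult_def unitization_ops scaleC_add_left scaleC_add_right scaleR_right_distrib
      distrib_left distrib_right scaleR_scaleC scaleC_scaleC mult_scaleC_left mult_scaleC_right
      mult.assoc mult.left_commute add_ac scaleC_scaleR scaleR_conv_of_real)

lemma left_mult_one: "left_mult 1 y = y"
  by (simp add: left_mult_def unitization_ops scaleC_one)

lemma norm_left_mult_le: "norm (left_mult u y) \<le> onorm (left_mult u) * norm y"
  by (rule onorm[OF bounded_linear_left_mult])

lemma onorm_left_mult_nonneg: "0 \<le> onorm (left_mult u)"
  by (rule onorm_pos_le[OF bounded_linear_left_mult])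

lemma norm_le_onorm_left_mult: "norm x \<le> onorm (left_mult (Unitization 0 x))"
proof (cases "x = 0")
  case False
  have "norm x * norm x = norm (left_mult (Unitization 0 x) (star x))"
    using norm_star_mult_self[of "star x"] by (simp add: left_mult_def scaleC_zero_left norm_star star_star power2_eq_square)
  also have "\<dots> \<le> onorm (left_mult (Unitization 0 x)) * norm x"
    using norm_left_mult_le[of "Unitization 0 x" "star x"] by (simp add: norm_star)
  finally show ?thesis using False by simp
qed (simp add: onorm_left_mult_nonneg)

lemma onorm_left_mult_algebra: "onorm (left_mult (Unitization 0 x)) = norm x"
proof (rule order.antisym)
  show "onorm (left_mult (Unitization 0 x)) \<le> norm x"
    by (rule onorm_bound) (simp_all add: left_mult_def scaleC_zero_left norm_mult_ineq)
qed (rule norm_le_onorm_left_mult)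

instantiation unitization :: (cstar_algebra) real_normed_algebra_1
begin

text \<open>The operator norm of left multiplication is a C*-seminorm; it is degenerate when the algebra
  already has a unit, and the maximum with the modulus of the scalar part repairs this.\<close>

definition norm_unitization where
  "norm u = max (cmod (scalar_part u)) (onorm (left_mult u))"
definition dist_unitization where "dist u v = norm (u - (v::'a unitization))"
definition sgn_unitization where "sgn u = inverse (norm u) *\<^sub>R (u::'a unitization)"
definition uniformity_unitization where
  "(uniformity :: ('a unitization \<times> 'a unitization) filter) = (INF e\<in>{0<..}. principal {(x, y). dist x y < e})"
definition open_unitization where
  "open (U :: 'a unitization set) \<longleftrightarrow> (\<forall>x\<in>U. \<forall>\<^sub>F (x', y) in uniformity. x' = x \<longrightarrow> y \<in> U)"

instance
proof
  fix u v :: "'a unitization" and r :: real and U :: "'a unitization set"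
  show "dist u v = norm (u - v)" by (rule dist_unitization_def)
  show "sgn u = u /\<^sub>R norm u" by (rule sgn_unitization_def)
  show "(uniformity :: ('a unitization \<times> 'a unitization) filter) = (INF e\<in>{0<..}. principal {(x, y). dist x y < e})"
    by (rule uniformity_unitization_def)
  show "open U = (\<forall>x\<in>U. \<forall>\<^sub>F (x', y) in uniformity. x' = x \<longrightarrow> y \<in> U)" by (rule open_unitization_def)
  show "(0::'a unitization) \<noteq> 1" by (simp add: unitization_ops)
  show "1 * u = u" "u * 1 = u" by (simp_all add: unitization_ops scaleC_one scaleC_zero_left unitization.expand)
  show "r *\<^sub>R u * v = r *\<^sub>R (u * v)" "u * r *\<^sub>R v = r *\<^sub>R (u * v)"
    by (simp_all add: unitization_ops scaleR_scaleC scaleR_conv_of_real scaleC_add_right scaleC_scaleC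
        mult_scaleC_left mult_scaleC_right mult.commute)
  have onorm_add: "onorm (left_mult (u + v)) \<le> onorm (left_mult u) + onorm (left_mult v)"
    using onorm_triangle[OF bounded_linear_left_mult bounded_linear_left_mult, of u v]
    by (simp add: left_mult_simps(1)[abs_def])
  show "norm (u + v) \<le> norm u + norm v"
    using onorm_add norm_triangle_ineq[of "scalar_part u" "scalar_part v"]
    unfolding norm_unitization_def by (auto simp: plus_unitization_def max_def)
  have "onorm (left_mult (r *\<^sub>R u)) = \<bar>r\<bar> * onorm (left_mult u)"
    using onorm_scaleR[OF bounded_linear_left_mult, of r u] by (simp add: left_mult_simps(2)[abs_def])
  then show "norm (r *\<^sub>R u) = \<bar>r\<bar> * norm u"
    by (simp add: norm_unitization_def scaleR_unitization_def max_mult_distrib_left)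
  have "onorm (left_mult (u * v)) \<le> onorm (left_mult u) * onorm (left_mult v)"
    using onorm_compose[OF bounded_linear_left_mult bounded_linear_left_mult, of u v]
    by (simp add: comp_def left_mult_simps(3)[abs_def])
  moreover have "onorm (left_mult u) * onorm (left_mult v) \<le> norm u * norm v"
    "cmod (scalar_part u) * cmod (scalar_part v) \<le> norm u * norm v"
    unfolding norm_unitization_def by (intro mult_mono; simp add: onorm_left_mult_nonneg le_max_iff_disj)+
  ultimately show "norm (u * v) \<le> norm u * norm v"
    unfolding norm_unitization_def[of "u * v"] by (simp add: times_unitization_def norm_mult)
  show "(norm u = 0) = (u = 0)"
  proof
    assume "norm u = 0"
    then have s: "scalar_part u = 0" and o: "onorm (left_mult u) \<le> 0"
      by (auto simp: norm_unitization_def max_def split: if_splits)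
    have "u = Unitization 0 (algebra_part u)" using s by (metis unitization.collapse)
    then have "norm (algebra_part u) \<le> 0" using o norm_le_onorm_left_mult by (metis order.trans)
    then show "u = 0" using s by (simp add: zero_unitization_def unitization.expand)
  next
    assume "u = 0"
    then show "norm u = 0" by (simp add: zero_unitization_def norm_unitization_def onorm_left_mult_algebra)
  qed
  have "onorm (left_mult (1::'a unitization)) \<le> 1"
    by (rule onorm_bound) (simp_all add: left_mult_one)
  then show "norm (1::'a unitization) = 1" by (simp add: norm_unitization_def one_unitization_def)
qed

end

lemma norm_Unitization_zero: "norm (Unitization 0 x) = norm x"
  by (simp add: norm_unitization_def onorm_left_mult_algebra)

lemma norm_scalar_part_le: "cmod (scalar_part u) \<le> norm u"
  by (simp add: norm_unitization_def)

lemma norm_algebra_part_le: "norm (algebra_part u) \<le> 2 * norm u"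
proof -
  have "Unitization 0 (algebra_part u) = u - Unitization (scalar_part u) 0"
    by (simp add: minus_unitization_def)
  moreover have "norm (Unitization (scalar_part u) 0 :: 'a unitization) \<le> cmod (scalar_part u)"
  proof -
    have "onorm (left_mult (Unitization (scalar_part u) 0 :: 'a unitization)) \<le> cmod (scalar_part u)"
      by (rule onorm_bound) (simp_all add: left_mult_def norm_scaleC)
    then show ?thesis by (simp add: norm_unitization_def)
  qed
  ultimately show ?thesis
    using norm_triangle_ineq4[of u "Unitization (scalar_part u) 0"] norm_scalar_part_le[of u]
      norm_Unitization_zero[of "algebra_part u"] by simp
qed

instantiation unitization :: (cstar_algebra) cstar_algebra
begin

definition star_unitization where
  "star u = Unitization (cnj (scalar_part u)) (star (algebra_part u))"

instance
proof
  fix X :: "nat \<Rightarrow> 'a unitization"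
  assume X: "Cauchy X"
  have "Cauchy (\<lambda>n. scalar_part (X n))"
  proof (rule CauchyI)
    fix e :: real assume "0 < e"
    then obtain M where M: "\<And>m n. m \<ge> M \<Longrightarrow> n \<ge> M \<Longrightarrow> norm (X m - X n) < e" using CauchyD[OF X] by blast
    have "norm (scalar_part (X m) - scalar_part (X n)) < e" if "m \<ge> M" "n \<ge> M" for m n
      using norm_scalar_part_le[of "X m - X n"] M[OF that] by (simp add: minus_unitization_def)
    then show "\<exists>M. \<forall>m\<ge>M. \<forall>n\<ge>M. norm (scalar_part (X m) - scalar_part (X n)) < e" by blast
  qed
  then obtain c where c: "(\<lambda>n. scalar_part (X n)) \<longlonglongrightarrow> c" by (auto simp: Cauchy_convergent_iff convergent_def)
  have "Cauchy (\<lambda>n. algebra_part (X n))"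
  proof (rule CauchyI)
    fix e :: real assume "0 < e"
    then have "0 < e / 2" by simp
    then obtain M where M: "\<And>m n. m \<ge> M \<Longrightarrow> n \<ge> M \<Longrightarrow> norm (X m - X n) < e / 2" using CauchyD[OF X] by blast
    have "norm (algebra_part (X m) - algebra_part (X n)) < e" if "m \<ge> M" "n \<ge> M" for m n
      using norm_algebra_part_le[of "X m - X n"] M[OF that] by (simp add: minus_unitization_def)
    then show "\<exists>M. \<forall>m\<ge>M. \<forall>n\<ge>M. norm (algebra_part (X m) - algebra_part (X n)) < e" by blast
  qed
  then obtain x where x: "(\<lambda>n. algebra_part (X n)) \<longlonglongrightarrow> x" by (auto simp: Cauchy_convergent_iff convergent_def)
  have le: "norm (Unitization d y) \<le> cmod d + norm y" for d and y :: 'a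
  proof -
    have "onorm (left_mult (Unitization d y)) \<le> cmod d + norm y"
    proof (rule onorm_bound)
      fix z show "norm (left_mult (Unitization d y) z) \<le> (cmod d + norm y) * norm z"
        using norm_triangle_ineq[of "d *\<^sub>C z" "y * z"] norm_mult_ineq[of y z]
        by (simp add: left_mult_def norm_scaleC distrib_right)
    qed simp
    then show ?thesis by (simp add: norm_unitization_def)
  qed
  have "(\<lambda>n. cmod (scalar_part (X n) - c) + norm (algebra_part (X n) - x)) \<longlonglongrightarrow> 0 + 0"
    by (intro tendsto_add tendsto_norm_zero LIM_zero c x)
  moreover have "norm (X n - Unitization c x) \<le> cmod (scalar_part (X n) - c) + norm (algebra_part (X n) - x)" for n
    using le[of "scalar_part (X n) - c" "algebra_part (X n) - x"] by (simp add: minus_unitization_def)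
  ultimately have "(\<lambda>n. X n - Unitization c x) \<longlonglongrightarrow> 0"
    by (intro Lim_null_comparison[of "\<lambda>n. X n - Unitization c x"]) auto
  then show "convergent X" by (auto simp: convergent_def intro: LIM_zero_cancel)
next
  fix u v :: "'a unitization" and r :: real and c :: complex
  show "r *\<^sub>R u = complex_of_real r *\<^sub>C u"
    by (simp add: unitization_ops scaleR_scaleC scaleR_conv_of_real)
  show "c *\<^sub>C u * v = c *\<^sub>C (u * v)" "u * c *\<^sub>C v = c *\<^sub>C (u * v)"
    by (simp_all add: unitization_ops scaleC_add_right scaleC_scaleC mult_scaleC_left mult_scaleC_right ac_simps)
  show "star (star u) = u" by (simp add: star_unitization_def star_star)
  show "star (u + v) = star u + star v" by (simp add: star_unitization_def unitization_ops star_add)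
  show "star (c *\<^sub>C u) = cnj c *\<^sub>C star u" by (simp add: star_unitization_def unitization_ops star_scaleC)
  show "star (u * v) = star v * star u"
    by (simp add: star_unitization_def unitization_ops star_add star_scaleC star_mult ac_simps)
  have le: "onorm (left_mult (c *\<^sub>C u)) \<le> cmod c * onorm (left_mult u)" for c and u :: "'a unitization"
  proof (rule onorm_bound)
    fix y
    have "left_mult (c *\<^sub>C u) y = c *\<^sub>C left_mult u y"
      by (simp add: left_mult_def unitization_ops scaleC_add_right scaleC_scaleC mult_scaleC_left)
    then have "norm (left_mult (c *\<^sub>C u) y) = cmod c * norm (left_mult u y)" by (simp add: norm_scaleC)
    also have "\<dots> \<le> cmod c * (onorm (left_mult u) * norm y)"
      by (intro mult_left_mono norm_left_mult_le) simp
    finally show "norm (left_mult (c *\<^sub>C u) y) \<le> cmod c * onorm (left_mult u) * norm y" by (simp add: mult.assoc)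
  qed (simp add: onorm_left_mult_nonneg)
  show "norm (c *\<^sub>C u) = cmod c * norm u"
  proof (cases "c = 0")
    case True
    then show ?thesis using norm_Unitization_zero[of 0] by (simp add: scaleC_unitization_def scaleC_zero_left)
  next
    case False
    have "u = inverse c *\<^sub>C (c *\<^sub>C u)" using False by (simp add: scaleC_scaleC scaleC_one)
    then have "onorm (left_mult u) \<le> cmod (inverse c) * onorm (left_mult (c *\<^sub>C u))" using le by metis
    then have "cmod c * onorm (left_mult u) \<le> cmod c * (cmod (inverse c) * onorm (left_mult (c *\<^sub>C u)))"
      by (rule mult_left_mono) simp
    also have "\<dots> = cmod (c * inverse c) * onorm (left_mult (c *\<^sub>C u))" by (simp only: norm_mult mult.assoc)
    finally have "cmod c * onorm (left_mult u) \<le> onorm (left_mult (c *\<^sub>C u))" using False by simp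
    then have "onorm (left_mult (c *\<^sub>C u)) = cmod c * onorm (left_mult u)" using le[of c u] by simp
    then show ?thesis by (simp add: norm_unitization_def scaleC_unitization_def norm_mult max_mult_distrib_left)
  qed
  have mult_le: "onorm (left_mult (u * v)) \<le> onorm (left_mult u) * onorm (left_mult v)" for u v :: "'a unitization"
    using onorm_compose[OF bounded_linear_left_mult bounded_linear_left_mult, of u v]
    by (simp add: comp_def left_mult_simps(3)[abs_def])
  have sq_le: "(onorm (left_mult u))\<^sup>2 \<le> onorm (left_mult (star u * u))" for u :: "'a unitization"
  proof -
    have "onorm (left_mult u) \<le> sqrt (onorm (left_mult (star u * u)))"
    proof (rule onorm_bound)
      fix y
      have "(norm (left_mult u y))\<^sup>2 = norm (star (left_mult u y) * left_mult u y)" by (rule norm_star_mult_self[symmetric])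
      also have "star (left_mult u y) * left_mult u y = star y * left_mult (star u * u) y"
        by (simp add: left_mult_simps) (simp add: left_mult_def star_unitization_def star_add star_scaleC
            star_mult distrib_left distrib_right mult_scaleC_left mult_scaleC_right scaleC_add_right scaleC_scaleC mult.assoc
            mult.commute[of "cnj (scalar_part u)"])
      also have "norm \<dots> \<le> norm y * norm (left_mult (star u * u) y)"
        using norm_mult_ineq[of "star y"] by (simp add: norm_star)
      also have "\<dots> \<le> norm y * (onorm (left_mult (star u * u)) * norm y)"
        by (intro mult_left_mono norm_left_mult_le) simp
      finally have "(norm (left_mult u y))\<^sup>2 \<le> onorm (left_mult (star u * u)) * (norm y)\<^sup>2"
        by (simp add: power2_eq_square ac_simps)
      then have "sqrt ((norm (left_mult u y))\<^sup>2) \<le> sqrt (onorm (left_mult (star u * u)) * (norm y)\<^sup>2)"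
        by (rule real_sqrt_le_mono)
      then show "norm (left_mult u y) \<le> sqrt (onorm (left_mult (star u * u))) * norm y"
        by (simp add: real_sqrt_mult)
    qed (simp add: onorm_left_mult_nonneg)
    then have "(onorm (left_mult u))\<^sup>2 \<le> (sqrt (onorm (left_mult (star u * u))))\<^sup>2"
      by (intro power_mono onorm_left_mult_nonneg)
    then show ?thesis by (simp add: onorm_left_mult_nonneg)
  qed
  have star_ge: "onorm (left_mult u) \<le> onorm (left_mult (star u))" for u :: "'a unitization"
  proof (cases "onorm (left_mult u) = 0")
    case False
    have "onorm (left_mult u) * onorm (left_mult u) \<le> onorm (left_mult (star u)) * onorm (left_mult u)"
      using sq_le[of u] mult_le[of "star u" u] by (simp add: power2_eq_square)
    then show ?thesis using False onorm_left_mult_nonneg[of u] by (simp add: mult_le_cancel_right)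
  qed (simp add: onorm_left_mult_nonneg)
  have "onorm (left_mult (star u)) = onorm (left_mult u)"
    using star_ge[of u] star_ge[of "star u"] by (simp add: star_unitization_def star_star)
  then have "onorm (left_mult (star u * u)) = (onorm (left_mult u))\<^sup>2"
    using sq_le[of u] mult_le[of "star u" u] by (simp add: power2_eq_square)
  moreover have "cmod (scalar_part (star u * u)) = (cmod (scalar_part u))\<^sup>2"
    by (simp add: star_unitization_def times_unitization_def norm_mult power2_eq_square)
  moreover have "max (a\<^sup>2) (b\<^sup>2) = (max a b)\<^sup>2" if "0 \<le> a" "0 \<le> b" for a b :: real
    using that by (auto simp: max_def power_mono)
  ultimately show "norm (star u * u) = (norm u)\<^sup>2"
    by (simp add: norm_unitization_def onorm_left_mult_nonneg)
qed

end

section \<open>Primitive ideals attaining distances\<close>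

lemma Unitization_zero_simps:
  "Unitization 0 (0::'a::cstar_algebra) = 0"
  "Unitization 0 (x + y) = Unitization 0 x + Unitization 0 (y::'a)"
  "Unitization 0 (x - y) = Unitization 0 x - Unitization 0 y"
  "Unitization 0 (c *\<^sub>C x) = c *\<^sub>C Unitization 0 x"
  "Unitization 0 (x * y::'a) = Unitization 0 x * Unitization 0 y"
  "Unitization 0 (star x::'a) = star (Unitization 0 (x::'a::cstar_algebra))"
  by (simp_all add: unitization_ops star_unitization_def scaleC_zero_left)

lemma Unitization_split: "u = scalar_part u *\<^sub>C 1 + Unitization 0 (algebra_part (u::'a::cstar_algebra unitization))"
  by (simp add: unitization_ops)

lemma unitization_part_simps:
  "scalar_part (0::'a::cstar_algebra unitization) = 0" "algebra_part (0::'a unitization) = 0"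
  "scalar_part (1::'a unitization) = 1" "algebra_part (1::'a unitization) = 0"
  "scalar_part (u + v) = scalar_part u + scalar_part v" "algebra_part (u + v) = algebra_part u + algebra_part v"
  "scalar_part (u * v) = scalar_part u * scalar_part v"
  "algebra_part (u * v) = scalar_part u *\<^sub>C algebra_part v + scalar_part v *\<^sub>C algebra_part u + algebra_part u * algebra_part v"
  "scalar_part (c *\<^sub>C u) = c * scalar_part u" "algebra_part (c *\<^sub>C u) = c *\<^sub>C algebra_part u"
  "scalar_part (star u) = cnj (scalar_part u)" "algebra_part (star u) = star (algebra_part u)"
  by (simp_all add: unitization_ops star_unitization_def)

lemma bounded_linear_scalar_part: "bounded_linear (scalar_part :: 'a::cstar_algebra unitization \<Rightarrow> complex)"
  by (rule bounded_linear_intro[where K = 1]) (simp_all add: norm_scalar_part_le plus_unitization_def scaleR_unitization_def)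

lemma bounded_linear_algebra_part: "bounded_linear (algebra_part :: 'a::cstar_algebra unitization \<Rightarrow> 'a)"
  by (rule bounded_linear_intro[where K = 2])
    (use norm_algebra_part_le in \<open>simp_all add: plus_unitization_def scaleR_unitization_def mult.commute\<close>)

lemma closed_algebra_part_vimage: "closed B \<Longrightarrow> closed (algebra_part -` B :: 'a::cstar_algebra unitization set)"
  by (intro closed_vimage linear_continuous_on bounded_linear_algebra_part) 

lemma Unitization_zero_image: "Unitization 0 ` B = scalar_part -` {0} \<inter> algebra_part -` B"
  by (auto simp: image_iff) (metis unitization.collapse)

lemma closed_Unitization_zero_image: "closed B \<Longrightarrow> closed (Unitization 0 ` B :: 'a::cstar_algebra unitization set)"
  unfolding Unitization_zero_image
  by (intro closed_Int closed_algebra_part_vimage closed_vimage linear_continuous_on bounded_linear_scalar_part closed_singleton)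

lemma cstar_subalgebra_Unitization_zero_image:
  assumes "cstar_subalgebra B"
  shows "cstar_subalgebra (Unitization 0 ` B)"
  using assms closed_Unitization_zero_image[of B]
  unfolding cstar_subalgebra_def Unitization_zero_image
  by (auto simp: unitization_part_simps scaleC_zero_left)

lemma cstar_subalgebra_algebra_part_vimage:
  assumes "cstar_subalgebra B"
  shows "cstar_subalgebra (algebra_part -` B)"
  using assms closed_algebra_part_vimage[of B]
  unfolding cstar_subalgebra_def by (simp add: unitization_part_simps)

lemma infdist_Unitization_zero:
  fixes x :: "'a::cstar_algebra"
  shows "infdist (Unitization 0 x) (Unitization 0 ` A) = infdist x A"
proof -
  have "dist (Unitization 0 x) (Unitization 0 a) = dist x a" for a
    by (simp add: dist_norm Unitization_zero_simps(3)[symmetric] norm_Unitization_zero)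
  then show ?thesis by (simp add: infdist_def image_image)
qed

lemma threshold_element:
  fixes v :: "'a::cstar_algebra"
  assumes B: "cstar_subalgebra B" and v: "v \<in> B" "star v = v"
  obtains f y where "f \<in> B" "y \<in> B" "norm y \<le> 1"
    "f + f = f * y + f * (v * v * y)" "v * v * y + y + f + v * v * f = v * v + v * v"
proof -
  obtain f' y' where fy: "f' \<in> Unitization 0 ` B" "y' \<in> Unitization 0 ` B" "norm y' \<le> 1"
    "f' + f' = f' * y' + f' * (Unitization 0 v * Unitization 0 v * y')"
    "Unitization 0 v * Unitization 0 v * y' + y' + f' + Unitization 0 v * Unitization 0 v * f'
      = Unitization 0 v * Unitization 0 v + Unitization 0 v * Unitization 0 v"
    by (rule threshold_element_unital[OF cstar_subalgebra_Unitization_zero_image[OF B], of "Unitization 0 v"])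
      (use v in \<open>simp_all add: Unitization_zero_simps(6)[symmetric]\<close>)
  then obtain f y where f: "f \<in> B" "f' = Unitization 0 f" and y: "y \<in> B" "y' = Unitization 0 y" by blast
  have "norm y \<le> 1" using fy(3) y by (simp add: norm_Unitization_zero)
  moreover have "f + f = f * y + f * (v * v * y)" "v * v * y + y + f + v * v * f = v * v + v * v"
    using fy(4,5) unfolding f(2) y(2) Unitization_zero_simps[symmetric] by simp_all
  ultimately show ?thesis using that f y by blast
qed

text \<open>This is \<open>threshold_element\<close> for \<open>v\<^sup>2 = h\<^sup>2 / \<delta>\<close>.  The element \<open>f\<close> serves for the ideals of all algebras
  \<open>C\<close> above \<open>B\<close> at once.\<close>

lemma ideal_threshold_element:
  fixes h :: "'a::cstar_algebra"
  assumes B: "cstar_subalgebra B" and h: "h \<in> B" "star h = h" and \<delta>: "0 < \<delta>"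
  obtains f where "f \<in> B"
    "\<And>C I. \<lbrakk>B \<subseteq> C; I \<in> Ideal C; infdist (h * h) I < \<delta>\<rbrakk> \<Longrightarrow> f \<in> I"
    "\<And>C I. \<lbrakk>B \<subseteq> C; I \<in> Ideal C; f \<in> I\<rbrakk> \<Longrightarrow> infdist (h * h) I \<le> \<delta>"
proof -
  define v where "v = (1 / sqrt \<delta>) *\<^sub>R h"
  have v: "v \<in> B" "star v = v"
    using cstar_subalgebra_subspace[OF B] h by (simp_all add: v_def subspace_scale star_scaleR)
  have vv: "v * v = (1 / \<delta>) *\<^sub>R (h * h)" using \<delta> by (simp add: v_def)
  obtain f y where f: "f \<in> B" and y: "y \<in> B" "norm y \<le> 1"
    and eq: "f + f = f * y + f * (v * v * y)" "v * v * y + y + f + v * v * f = v * v + v * v"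
    by (rule threshold_element[OF B v])
  have mult: "v * v \<in> B" "v * v * y \<in> B" using B v y by (simp_all add: cstar_subalgebra_def)
  show ?thesis
  proof (rule that[OF f])
    fix C I assume C: "B \<subseteq> C" and I: "I \<in> Ideal C"
    have scale: "infdist (v * v) I = infdist (h * h) I / \<delta>"
      using \<delta> by (simp add: vv infdist_ideal_scaleR[OF I])
    show "f \<in> I" if "infdist (h * h) I < \<delta>"
      using threshold_element_mem_ideal[OF I _ _ _ _ y(2) eq(1)] that f y mult C \<delta> by (auto simp: scale)
    show "infdist (h * h) I \<le> \<delta>" if "f \<in> I"
      using infdist_le_one_of_threshold_element[OF I _ _ y(2) eq(2) that] y mult C \<delta> by (auto simp: scale)
  qed
qed

text \<open>The irreducible representation of the unitization restricts to one of \<open>B\<close>, because subspaces are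
  invariant under scalars.  Elements \<open>k\<close> of its kernel have distance at least \<open>\<langle>\<pi> (h\<^sup>2) \<xi>, \<xi>\<rangle>\<close> to \<open>h\<^sup>2\<close>, since
  \<open>\<pi>\<close> is contractive.\<close>

theorem primitive_ideal_attaining_distance:
  fixes B :: "'a::cstar_algebra set"
  assumes B: "cstar_subalgebra B" and I: "I \<in> Ideal B" and h: "h \<in> B" "star h = h"
    and pos: "0 < infdist (h * h) I"
  obtains J where "J \<in> Prim B" "I \<subseteq> J" "infdist (h * h) I \<le> infdist (h * h) J"
proof -
  define B' where "B' = (algebra_part -` B :: 'a unitization set)"
  define \<iota> where "\<iota> = (Unitization 0 :: 'a \<Rightarrow> 'a unitization)"
  have B': "cstar_subalgebra B'" unfolding B'_def by (rule cstar_subalgebra_algebra_part_vimage[OF B])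
  have B0: "0 \<in> B" and BC: "\<And>c x. x \<in> B \<Longrightarrow> c *\<^sub>C x \<in> B" using B by (auto simp: cstar_subalgebra_def)
  have one: "1 \<in> B'" using B0 by (simp add: B'_def unitization_part_simps)
  have \<iota>B: "\<iota> b \<in> B'" if "b \<in> B" for b using that by (simp add: B'_def \<iota>_def)
  note \<iota>_simps = Unitization_zero_simps[where 'a = 'a, folded \<iota>_def]
  have I': "\<iota> ` I \<in> Ideal B'"
    using closed_Unitization_zero_image[OF IdealD(7)[OF I]] IdealD(1-6)[OF I]
    unfolding Ideal_def \<iota>_def Unitization_zero_image
    by (auto simp: B'_def unitization_part_simps scaleC_zero_left)
  have dist: "infdist (\<iota> h * \<iota> h) (\<iota> ` I) = infdist (h * h) I"
    using infdist_Unitization_zero[of "h * h" I] by (simp add: \<iota>_def[symmetric] \<iota>_simps)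
  have \<iota>h: "star (\<iota> h) = \<iota> h" using h(2) by (simp add: \<iota>_simps(6)[symmetric])
  have pos': "0 < infdist (\<iota> h * \<iota> h) (\<iota> ` I)" using pos by (simp add: dist)
  obtain S :: "('a unitization \<Rightarrow> complex) set" and ip \<pi> \<xi>
    where irr: "irreducible_representation S ip B' \<pi>" and \<pi>1: "\<And>x. x \<in> S \<Longrightarrow> \<pi> 1 x = x"
      and \<pi>I: "\<And>i x. i \<in> \<iota> ` I \<Longrightarrow> x \<in> S \<Longrightarrow> \<pi> i x = 0" and \<xi>: "\<xi> \<in> S" "ip \<xi> \<xi> = 1"
      and attain: "ip (\<pi> (\<iota> h * \<iota> h) \<xi>) \<xi> = of_real (infdist (h * h) I)"
    by (rule irreducible_representation_attaining_distance_unital[OF B' one I' \<iota>B[OF h(1)] \<iota>h pos', unfolded dist])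
      (rule that)
  interpret irreducible_representation S ip B' \<pi> by (rule irr)
  define \<rho> where "\<rho> b = \<pi> (\<iota> b)" for b
  have hh: "h * h \<in> B" using B h by (simp add: cstar_subalgebra_def)
  have attain': "ip (\<rho> (h * h) \<xi>) \<xi> = of_real (infdist (h * h) I)"
    using attain by (simp add: \<rho>_def \<iota>_simps)
  have rep: "star_representation S ip B \<rho>"
  proof
    fix b assume "b \<in> B"
    then show "\<exists>C. \<forall>x\<in>S. ip_norm ip (\<rho> b x) \<le> C * ip_norm ip x" unfolding \<rho>_def by (intro op_bounded \<iota>B)
  qed (simp_all add: \<rho>_def \<iota>B op_mem op_add op_scaleC \<iota>_simps rep_add rep_scaleC rep_mult rep_star)
  interpret R: star_representation S ip B \<rho> by (rule rep)
  have "irreducible_representation S ip B \<rho>"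
  proof
    have "\<rho> (h * h) \<xi> \<noteq> 0" using attain' pos ip_zero_left[OF \<xi>(1)] by auto
    then show "\<exists>b\<in>B. \<exists>x\<in>S. \<rho> b x \<noteq> 0" using hh \<xi>(1) by blast
  next
    fix T assume T: "closed_linear_subspace T" and inv: "\<And>b x. \<lbrakk>b \<in> B; x \<in> T\<rbrakk> \<Longrightarrow> \<rho> b x \<in> T"
    have TS: "T \<subseteq> S" and Tadd: "\<And>u v. u \<in> T \<Longrightarrow> v \<in> T \<Longrightarrow> u + v \<in> T"
      and Tsc: "\<And>c u. u \<in> T \<Longrightarrow> c *\<^sub>C u \<in> T"
      using T unfolding closed_linear_subspace_def by simp_all
    show "T = {0} \<or> T = S"
    proof (rule irreducible[OF T])
      fix u x assume u: "u \<in> B'" and x: "x \<in> T"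
      have xS: "x \<in> S" using x TS by blast
      have ub: "algebra_part u \<in> B" using u by (simp add: B'_def)
      have c1: "scalar_part u *\<^sub>C 1 \<in> B'" using BC B0 by (simp add: B'_def unitization_part_simps)
      have "\<pi> u x = \<pi> (scalar_part u *\<^sub>C 1 + \<iota> (algebra_part u)) x"
        using Unitization_split[of u] by (simp add: \<iota>_def)
      also have "\<dots> = scalar_part u *\<^sub>C x + \<rho> (algebra_part u) x"
        using rep_add[OF c1 \<iota>B[OF ub] xS] rep_scaleC[OF one xS] \<pi>1[OF xS] by (simp add: \<rho>_def)
      finally show "\<pi> u x \<in> T" using Tadd Tsc inv[OF ub x] x by simp
    qed
  qed
  then have prim: "rep_kernel S B \<rho> \<in> Prim B" by (rule rep_kernel_in_Prim[OF B])
  moreover have "I \<subseteq> rep_kernel S B \<rho>"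
    using IdealD(1)[OF I] \<pi>I by (auto simp: rep_kernel_def \<rho>_def)
  moreover have "infdist (h * h) I \<le> infdist (h * h) (rep_kernel S B \<rho>)"
  proof (rule le_infdist)
    show "rep_kernel S B \<rho> \<noteq> {}" using \<open>I \<subseteq> rep_kernel S B \<rho>\<close> IdealD(2)[OF I] by blast
    fix k assume k: "k \<in> rep_kernel S B \<rho>"
    then have kB: "k \<in> B" and k0: "\<rho> k \<xi> = 0" using \<xi> by (auto simp: rep_kernel_def)
    have d: "h * h - k \<in> B" by (rule subspace_diff[OF cstar_subalgebra_subspace[OF B] hh kB])
    have "\<rho> (h * h) \<xi> = \<rho> (h * h - k + k) \<xi>" by simp
    also have "\<dots> = \<rho> (h * h - k) \<xi>" by (simp only: R.rep_add[OF d kB \<xi>(1)] k0) simp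
    finally have "infdist (h * h) I = cmod (ip (\<rho> (h * h - k) \<xi>) \<xi>)"
      using attain' pos by (metis abs_of_pos norm_of_real)
    also have "\<dots> \<le> ip_norm ip (\<rho> (h * h - k) \<xi>) * ip_norm ip \<xi>"
      by (rule Cauchy_Schwarz[OF R.op_mem[OF d \<xi>(1)] \<xi>(1)])
    also have "\<dots> \<le> (norm (h * h - k) * ip_norm ip \<xi>) * ip_norm ip \<xi>"
      by (intro mult_right_mono R.rep_contractive[OF B d \<xi>(1)] ip_norm_nonneg \<xi>(1))
    finally show "infdist (h * h) I \<le> dist (h * h) k" using \<xi>(2) by (simp add: ip_norm_def dist_norm)
  qed
  ultimately show ?thesis by (rule that)
qed

corollary primitive_ideal_excluding_square:
  assumes B: "cstar_subalgebra B" and I: "I \<in> Ideal B" and h: "h \<in> B" "star h = h" "h * h \<notin> I"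
  obtains J where "J \<in> Prim B" "I \<subseteq> J" "h * h \<notin> J"
proof -
  have pos: "0 < infdist (h * h) I" using h(3) by (simp add: infdist_ideal_pos[OF I])
  obtain J where J: "J \<in> Prim B" "I \<subseteq> J" "infdist (h * h) I \<le> infdist (h * h) J"
    by (rule primitive_ideal_attaining_distance[OF B I h(1,2) pos])
  then have "J \<in> Ideal B" using Prim_subset_Ideal[OF B] by blast
  then show ?thesis using that J pos infdist_ideal_pos by (metis less_le_trans)
qed

section \<open>Compact sets of primitive ideals and the two topologies\<close>

text \<open>In a representation \<open>\<pi> (x\<^sup>* x) v = 0\<close> implies that the norm of \<open>\<pi> x v\<close> is \<open>0\<close>; apply this to \<open>y\<close> and to
  \<open>y\<^sup>* y\<close>.\<close>

lemma square_not_mem_primitive_ideal: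
  assumes B: "cstar_subalgebra B" and J: "J \<in> Prim B" and y: "y \<in> B" "y \<notin> J"
  shows "(star y * y) * (star y * y) \<notin> J"
proof -
  obtain S :: "('a \<Rightarrow> complex) set" and ip \<pi> where irr: "irreducible_representation S ip B \<pi>"
    and J_eq: "J = rep_kernel S B \<pi>" using J by (auto simp: Prim_def)
  interpret irreducible_representation S ip B \<pi> by (rule irr)
  have mem: "x \<in> J" if x: "x \<in> B" "star x * x \<in> J" for x
  proof -
    have "\<pi> x v = 0" if v: "v \<in> S" for v
    proof (rule ip_self_eq_0[OF op_mem[OF x(1) v]])
      have sx: "star x \<in> B" using B x by (simp add: cstar_subalgebra_def)
      have "ip (\<pi> x v) (\<pi> x v) = ip (\<pi> (star x) (\<pi> x v)) v"
        using rep_star[of "star x" "v" "\<pi> x v"] rep_star[OF x(1) op_mem[OF x(1) v] v] by simp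
      also have "\<pi> (star x) (\<pi> x v) = 0"
        using x v rep_mult[OF sx x(1) v] by (simp add: J_eq rep_kernel_def)
      finally show "ip (\<pi> x v) (\<pi> x v) = 0" by (simp only: ip_zero_left[OF v])
    qed
    then show ?thesis using x by (simp add: J_eq rep_kernel_def)
  qed
  have "star y * y \<in> B" using B y by (simp add: cstar_subalgebra_def)
  moreover have "star (star y * y) = star y * y" by (simp add: star_mult star_star)
  ultimately show ?thesis using mem[of "star y * y"] mem[of y] y by metis
qed

lemma self_adjoint_square_not_mem:
  assumes B: "cstar_subalgebra B" and J: "J \<in> Prim B" and A: "cstar_subalgebra A" "A \<subseteq> B"
    and L: "L \<in> Ideal B" and y: "y \<in> A" "y \<in> L" "y \<notin> J"
  obtains h where "h \<in> A" "star h = h" "h * h \<in> L" "h * h \<notin> J"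
proof (rule that)
  let ?h = "star y * y"
  show "?h \<in> A" using A(1) y(1) by (simp add: cstar_subalgebra_def)
  then have hB: "?h \<in> B" using A(2) by blast
  have "star y \<in> B" using B y(1) A(2) by (auto simp: cstar_subalgebra_def)
  then show "?h * ?h \<in> L" using IdealD(5)[OF L] y(2) hB by blast
  show "star ?h = ?h" by (simp add: star_mult star_star)
  show "?h * ?h \<notin> J" using square_not_mem_primitive_ideal[OF B J _ y(3)] y(1) A(2) by blast
qed

lemma Ideal_Int:
  assumes "cstar_subalgebra A" "I \<in> Ideal UNIV"
  shows "I \<inter> A \<in> Ideal A"
  using assms by (auto simp: Ideal_def cstar_subalgebra_def)

lemma Prim_IdealD: "cstar_subalgebra B \<Longrightarrow> J \<in> Prim B \<Longrightarrow> J \<in> Ideal B"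
  using Prim_subset_Ideal by blast

lemma openin_jacobson_not_mem:
  assumes B: "cstar_subalgebra B" and f: "f \<in> B"
  shows "openin (jacobson_topology B) {J \<in> Prim B. f \<notin> J}"
proof -
  define K where "K = \<Inter>{I \<in> Ideal B. f \<in> I}"
  have BI: "B \<in> Ideal B" using B by (auto simp: cstar_subalgebra_def Ideal_def)
  have "K \<in> Ideal B"
  proof -
    have "K \<subseteq> B" using BI f by (auto simp: K_def)
    moreover have "closed K" unfolding K_def by (rule closed_Inter) (auto simp: Ideal_def)
    ultimately show ?thesis by (auto simp: Ideal_def K_def)
  qed
  moreover have "{J \<in> Prim B. f \<notin> J} = Prim B - prim_hull B K"
    using Prim_IdealD[OF B] by (auto simp: prim_hull_def K_def)
  ultimately show ?thesis unfolding openin_jacobson_topology[OF B] by blast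
qed

text \<open>If finite unions of a cover \<open>{J. \<not> I\<^sub>U \<subseteq> J}\<close> all failed, the distance of \<open>h\<^sup>2\<close> to every finite sum of the
  \<open>I\<^sub>U\<close> would be at least \<open>e\<close>, hence also the distance to their closed sum \<open>L\<close>; but then some primitive
  ideal above \<open>L\<close> has distance at least \<open>e\<close> and is not covered.\<close>

lemma compactin_infdist_ge:
  fixes B :: "'a::cstar_algebra set"
  assumes B: "cstar_subalgebra B" and h: "h \<in> B" "star h = h" and e: "0 < e"
  shows "compactin (jacobson_topology B) {J \<in> Prim B. e \<le> infdist (h * h) J}"
  unfolding compactin_def
proof (intro conjI allI impI)
  let ?K = "{J \<in> Prim B. e \<le> infdist (h * h) J}"
  show "?K \<subseteq> topspace (jacobson_topology B)" by (auto simp: topspace_jacobson_topology[OF B])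
  fix \<U> assume \<U>: "(\<forall>U\<in>\<U>. openin (jacobson_topology B) U) \<and> ?K \<subseteq> \<Union>\<U>"
  then have "\<forall>U\<in>\<U>. \<exists>I. I \<in> Ideal B \<and> U = Prim B - prim_hull B I"
    by (simp add: openin_jacobson_topology[OF B] Bex_def)
  then obtain I where I: "\<And>U. U \<in> \<U> \<Longrightarrow> I U \<in> Ideal B" "\<And>U. U \<in> \<U> \<Longrightarrow> U = Prim B - prim_hull B (I U)"
    by metis
  define P where "P = {sum g F | g F. finite F \<and> F \<subseteq> \<U> \<and> (\<forall>U\<in>F. g U \<in> I U)}"
  have P_I: "I U \<subseteq> P" if "U \<in> \<U>" for U
  proof
    fix x assume "x \<in> I U"
    then have "x = sum (\<lambda>_. x) {U} \<and> finite {U} \<and> {U} \<subseteq> \<U> \<and> (\<forall>V\<in>{U}. x \<in> I V)" using that by simp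
    then show "x \<in> P" unfolding P_def by blast
  qed
  have sum_mem: "sum g F \<in> J" if "J \<in> Ideal B" "\<And>U. U \<in> F \<Longrightarrow> g U \<in> J" for g :: "'b \<Rightarrow> 'a" and F J
    using that by (induction F rule: infinite_finite_induct) (auto simp: IdealD(2,3)[OF that(1)])
  have BI: "B \<in> Ideal B" using B by (auto simp: cstar_subalgebra_def Ideal_def)
  have P_B: "P \<subseteq> B"
  proof
    fix x assume "x \<in> P"
    then obtain g F where "x = sum g F" "F \<subseteq> \<U>" "\<forall>U\<in>F. g U \<in> I U" unfolding P_def by blast
    then show "x \<in> B" using IdealD(1)[OF I(1)] sum_mem[OF BI, of F g] by blast
  qed
  have P_0: "0 \<in> P" unfolding P_def by (rule CollectI, rule exI[of _ "\<lambda>_. 0"], rule exI[of _ "{}"]) simp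
  have P_add: "x + y \<in> P" if xy: "x \<in> P" "y \<in> P" for x y
  proof -
    obtain g F where g: "x = sum g F" "finite F" "F \<subseteq> \<U>" "\<forall>U\<in>F. g U \<in> I U" using xy unfolding P_def by blast
    obtain g' F' where g': "y = sum g' F'" "finite F'" "F' \<subseteq> \<U>" "\<forall>U\<in>F'. g' U \<in> I U" using xy unfolding P_def by blast
    define k where "k U = (if U \<in> F then g U else 0) + (if U \<in> F' then g' U else 0)" for U
    have "sum k (F \<union> F') = x + y"
      using g(2) g'(2) unfolding k_def sum.distrib g(1) g'(1)
      by (simp add: sum.inter_restrict[symmetric] Int_absorb1 Int_absorb2 sum.If_cases)
    moreover have "k U \<in> I U" if "U \<in> F \<union> F'" for U
      using that g g' IdealD(2,3)[OF I(1), of U] by (auto simp: k_def)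
    ultimately show ?thesis using g g' unfolding P_def
      by (intro CollectI exI[of _ k] exI[of _ "F \<union> F'"]) auto
  qed
  have P_map: "T x \<in> P" if x: "x \<in> P" and T: "\<And>U y. U \<in> \<U> \<Longrightarrow> y \<in> I U \<Longrightarrow> T y \<in> I U"
    and T_add: "\<And>x y. T (x + y) = T x + T y" for T :: "'a \<Rightarrow> 'a" and x
  proof -
    obtain g F where g: "x = sum g F" "finite F" "F \<subseteq> \<U>" "\<forall>U\<in>F. g U \<in> I U" using x unfolding P_def by blast
    have T0: "T 0 = 0" using T_add[of 0 0] by simp
    have "T (sum g F) = sum (\<lambda>U. T (g U)) F"
      by (induction F rule: infinite_finite_induct) (simp_all add: T0 T_add)
    then show ?thesis using g T unfolding P_def
      by (intro CollectI exI[of _ "\<lambda>U. T (g U)"] exI[of _ F]) auto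
  qed
  define L where "L = closure P"
  have map_L: "T x \<in> L" if x: "x \<in> L" and T: "\<And>U y. U \<in> \<U> \<Longrightarrow> y \<in> I U \<Longrightarrow> T y \<in> I U"
    and c: "bounded_linear T" for T x
  proof -
    have "T x \<in> P" if "x \<in> P" for x
      by (rule P_map[OF that T]) (simp_all add: linear_add[OF bounded_linear.linear[OF c]])
    note T = this
    have "T ` closure P \<subseteq> closure (T ` P)"
      by (rule closure_bounded_linear_image_subset[OF c])
    also have "\<dots> \<subseteq> closure P" using T by (intro closure_mono) auto
    finally show ?thesis using x by (auto simp: L_def)
  qed
  have bl_scaleC: "bounded_linear (\<lambda>x::'a. c *\<^sub>C x)" for c
    by (rule bounded_linear_intro[where K = "cmod c"])
      (simp_all add: scaleC_add_right scaleC_scaleR norm_scaleC mult.commute)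
  have L: "L \<in> Ideal B"
    unfolding Ideal_def
  proof (intro CollectI conjI ballI allI)
    show "L \<subseteq> B" unfolding L_def using P_B B by (intro closure_minimal) (auto simp: cstar_subalgebra_def)
    show "0 \<in> L" using P_0 closure_subset by (auto simp: L_def)
    show "closed L" by (simp add: L_def)
    fix x assume x: "x \<in> L"
    show "x + y \<in> L" if y: "y \<in> L" for y
    proof -
      obtain X where X: "\<forall>n. X n \<in> P" "X \<longlonglongrightarrow> x" using x unfolding L_def closure_sequential by blast
      obtain Y where Y: "\<forall>n. Y n \<in> P" "Y \<longlonglongrightarrow> y" using y unfolding L_def closure_sequential by blast
      have "(\<lambda>n. X n + Y n) \<longlonglongrightarrow> x + y" by (intro tendsto_add X Y)
      then show ?thesis
        unfolding L_def closure_sequential using X(1) Y(1) P_add by (intro exI[of _ "\<lambda>n. X n + Y n"]) simp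
    qed
    show "c *\<^sub>C x \<in> L" for c
      using map_L[OF x _ bl_scaleC] IdealD(4)[OF I(1)] by simp
    fix b assume b: "b \<in> B"
    show "b * x \<in> L"
      using map_L[OF x _ bounded_linear_mult_right] IdealD(5)[OF I(1) b] by simp
    show "x * b \<in> L"
      using map_L[OF x _ bounded_linear_mult_left] IdealD(6)[OF I(1) b] by simp
  qed
  have IL: "I U \<subseteq> L" if "U \<in> \<U>" for U using P_I[OF that] closure_subset[of P] by (auto simp: L_def)
  have "infdist (h * h) L < e"
  proof (rule ccontr)
    assume "\<not> infdist (h * h) L < e"
    then have ge: "e \<le> infdist (h * h) L" by simp
    then have "0 < infdist (h * h) L" using e by simp
    then obtain J where J: "J \<in> Prim B" "L \<subseteq> J" "infdist (h * h) L \<le> infdist (h * h) J"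
      by (rule primitive_ideal_attaining_distance[OF B L h])
    then have "J \<in> ?K" using ge by simp
    then obtain U where U: "U \<in> \<U>" "J \<in> U" using \<U> by blast
    then have "\<not> I U \<subseteq> J" using I(2)[OF U(1)] J(1) by (auto simp: prim_hull_def)
    then show False using IL[OF U(1)] J(2) by blast
  qed
  then obtain l where l: "l \<in> L" "dist (h * h) l < e" using infdist_lessD IdealD(2)[OF L] by blast
  then obtain p where p: "p \<in> P" "dist p l < e - dist (h * h) l"
    unfolding L_def closure_approachable by (metis diff_gt_0_iff_gt)
  then have p_e: "dist (h * h) p < e" using dist_triangle2[of "h * h" p l] by linarith
  obtain g F where g: "p = sum g F" "finite F" "F \<subseteq> \<U>" "\<forall>U\<in>F. g U \<in> I U" using p(1) unfolding P_def by blast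
  have "?K \<subseteq> \<Union>F"
  proof
    fix J assume J: "J \<in> ?K"
    show "J \<in> \<Union>F"
    proof (rule ccontr)
      assume "J \<notin> \<Union>F"
      then have "I U \<subseteq> J" if "U \<in> F" for U using that I(2)[of U] g(3) J by (auto simp: prim_hull_def)
      then have "p \<in> J" using sum_mem[OF Prim_IdealD[OF B], of J F g] J g by blast
      then have "infdist (h * h) J \<le> dist (h * h) p" by (rule infdist_le)
      then show False using p_e J by simp
    qed
  qed
  then show "\<exists>\<F>. finite \<F> \<and> \<F> \<subseteq> \<U> \<and> ?K \<subseteq> \<Union>\<F>" using g(2,3) by blast
qed

lemma openin_fell_ideal_hit:
  assumes B: "cstar_subalgebra B" and A: "openin (jacobson_topology B) A"
  shows "openin (fell_ideal B) {I \<in> Ideal B. prim_hull B I \<inter> A \<noteq> {}}"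
proof (cases "A = {}")
  case False
  let ?X = "jacobson_topology B"
  have "openin (fell_topology ?X) (fell_basic ?X {} {A})"
    unfolding openin_fell_topology
    by (rule arbitrary_union_of_inc, rule exI[of _ "{}"], rule exI[of _ "{A}"]) (use A False in simp)
  moreover have "{I \<in> Ideal B. prim_hull B I \<inter> A \<noteq> {}} = prim_hull B -` fell_basic ?X {} {A} \<inter> Ideal B"
    by (auto simp: fell_basic_def closedin_jacobson_topology[OF B])
  ultimately show ?thesis unfolding fell_ideal_def openin_pullback_topology by blast
qed simp

lemma openin_fell_ideal_miss:
  assumes B: "cstar_subalgebra B" and K: "compactin (jacobson_topology B) K"
  shows "openin (fell_ideal B) {I \<in> Ideal B. prim_hull B I \<inter> K = {}}"
proof -
  let ?X = "jacobson_topology B"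
  have "openin (fell_topology ?X) (fell_basic ?X K {})"
    unfolding openin_fell_topology
    by (rule arbitrary_union_of_inc, rule exI[of _ K], rule exI[of _ "{}"]) (use K in simp)
  moreover have "{I \<in> Ideal B. prim_hull B I \<inter> K = {}} = prim_hull B -` fell_basic ?X K {} \<inter> Ideal B"
    by (auto simp: fell_basic_def closedin_jacobson_topology[OF B])
  ultimately show ?thesis unfolding fell_ideal_def openin_pullback_topology by blast
qed

lemma topspace_fell_ideal:
  assumes B: "cstar_subalgebra B"
  shows "topspace (fell_ideal B) = Ideal B"
proof
  show "topspace (fell_ideal B) \<subseteq> Ideal B" by (auto simp: fell_ideal_def topspace_pullback_topology)
  have "openin (fell_ideal B) (Ideal B)"
    using openin_fell_ideal_miss[OF B, of "{}"] by simp
  then show "Ideal B \<subseteq> topspace (fell_ideal B)" by (rule openin_subset)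
qed

context
  fixes \<A> :: "nat \<Rightarrow> 'a::cstar_algebra set"
  assumes \<A>: "\<And>n. cstar_subalgebra (\<A> n)"
begin

lemma openin_fell_trace_component:
  assumes inc: "incseq \<A>" and W: "openin (fell_ideal (\<A> n)) W"
  shows "openin (fell_trace \<A>) {I \<in> Ideal UNIV. I \<inter> \<A> n \<in> W}"
proof -
  let ?P = "product_topology (\<lambda>n. fell_ideal (\<A> n)) UNIV"
  have "continuous_map ?P (fell_ideal (\<A> n)) (\<lambda>J. J n)"
    using continuous_map_product_projection[of n UNIV "\<lambda>n. fell_ideal (\<A> n)"] by simp
  then have "openin ?P {J \<in> topspace ?P. J n \<in> W}"
    using W by (rule openin_continuous_map_preimage)
  then have open_inf: "openin (fell_inf \<A>) ({J \<in> topspace ?P. J n \<in> W} \<inter> Ideal_inf \<A>)"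
    unfolding fell_inf_def openin_subtopology by blast
  have mem: "ideal_trace \<A> I \<in> topspace ?P" "ideal_trace \<A> I \<in> Ideal_inf \<A>" if "I \<in> Ideal UNIV" for I
  proof -
    have I: "I \<inter> \<A> m \<in> Ideal (\<A> m)" for m by (rule Ideal_Int[OF \<A> that])
    then show "ideal_trace \<A> I \<in> topspace ?P"
      by (simp add: ideal_trace_def topspace_fell_ideal[OF \<A>] PiE_UNIV_domain)
    have "\<A> m \<subseteq> \<A> (Suc m)" for m using inc by (simp add: incseq_Suc_iff)
    then show "ideal_trace \<A> I \<in> Ideal_inf \<A>"
      using I by (auto simp: Ideal_inf_def ideal_trace_def PiE_UNIV_domain)
  qed
  have "{I \<in> Ideal UNIV. I \<inter> \<A> n \<in> W}
      = ideal_trace \<A> -` ({J \<in> topspace ?P. J n \<in> W} \<inter> Ideal_inf \<A>) \<inter> Ideal UNIV"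
    using mem by (auto simp: ideal_trace_def)
  then show ?thesis unfolding fell_trace_def openin_pullback_topology using open_inf by blast
qed

text \<open>An element \<open>b = h\<^sup>2\<close> of \<open>L\<close> outside \<open>J\<close> is the limit of squares from the subalgebras, whose distance
  to \<open>L\<close> is small while the distance to \<open>J\<close> is not.  The threshold elements of these squares then
  lie in \<open>L\<close> exactly, but not in \<open>J\<close>.\<close>

lemma ideal_subset_primitive_if_traces:
  assumes dense: "closure (\<Union>n. \<A> n) = UNIV" and L: "L \<in> Ideal UNIV" and J: "J \<in> Prim UNIV"
    and not_sub: "\<not> L \<subseteq> J"
  obtains n where "\<not> L \<inter> \<A> n \<subseteq> J"
proof -
  have JI: "J \<in> Ideal UNIV" by (rule Prim_IdealD[OF cstar_subalgebra_UNIV J])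
  obtain x where x: "x \<in> L" "x \<notin> J" using not_sub by blast
  define q where "q x = (star x * x) * (star x * x)" for x :: 'a
  have qL: "q x \<in> L" using x(1) IdealD(5)[OF L UNIV_I] by (simp add: q_def)
  have "q x \<notin> J" using square_not_mem_primitive_ideal[OF cstar_subalgebra_UNIV J UNIV_I x(2)] by (simp add: q_def)
  then have pos: "0 < infdist (q x) J" by (simp add: infdist_ideal_pos[OF JI])
  define \<delta> where "\<delta> = infdist (q x) J / 2"
  have \<delta>: "0 < \<delta>" using pos by (simp add: \<delta>_def)
  obtain Y where Y: "\<forall>n. Y n \<in> (\<Union>n. \<A> n)" "Y \<longlonglongrightarrow> x" using dense closure_sequential[of x] by blast
  have "(\<lambda>n. q (Y n)) \<longlonglongrightarrow> q x"
    unfolding q_def by (intro tendsto_mult Y bounded_linear.tendsto[OF bounded_linear_star])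
  from tendstoD[OF this \<delta>] obtain k where k: "dist (q (Y k)) (q x) < \<delta>"
    unfolding eventually_sequentially by blast
  obtain n where n: "Y k \<in> \<A> n" using Y(1) by blast
  define h where "h = star (Y k) * Y k"
  have h: "h \<in> \<A> n" "star h = h"
    using \<A>[of n] n by (simp_all add: h_def cstar_subalgebra_def star_mult star_star)
  have hh: "h * h = q (Y k)" by (simp add: h_def q_def)
  obtain f where f: "f \<in> \<A> n"
    and f_mem: "\<And>C I. \<lbrakk>\<A> n \<subseteq> C; I \<in> Ideal C; infdist (h * h) I < \<delta>\<rbrakk> \<Longrightarrow> f \<in> I"
    and f_le: "\<And>C I. \<lbrakk>\<A> n \<subseteq> C; I \<in> Ideal C; f \<in> I\<rbrakk> \<Longrightarrow> infdist (h * h) I \<le> \<delta>"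
    by (rule ideal_threshold_element[OF \<A> h \<delta>]) (rule that)
  have "infdist (h * h) L < \<delta>" using infdist_le[OF qL, of "q (Y k)"] k by (simp add: hh)
  then have "f \<in> L" by (rule f_mem[OF subset_UNIV L])
  moreover have "f \<notin> J"
  proof
    assume "f \<in> J"
    then have "infdist (h * h) J \<le> \<delta>" by (rule f_le[OF subset_UNIV JI])
    moreover have "infdist (q x) J \<le> infdist (q (Y k)) J + dist (q x) (q (Y k))" by (rule infdist_triangle)
    ultimately show False using k by (simp add: hh dist_commute \<delta>_def)
  qed
  ultimately show ?thesis using that[of n] f by blast
qed

text \<open>Let \<open>A\<close> consist of the primitive ideals not containing \<open>L\<close>.  A primitive ideal \<open>J\<^sub>0 \<supseteq> I\<^sub>0\<close> in \<open>A\<close> need not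
  have a primitive trace on \<open>\<A> n\<close>, but some primitive ideal of \<open>\<A> n\<close> above the trace still omits a square
  from \<open>L\<close>; and a square from \<open>L \<inter> \<A> n\<close> outside \<open>I \<inter> \<A> n\<close> is omitted by a primitive ideal above \<open>I\<close>.\<close>

lemma openin_fell_trace_hit:
  assumes inc: "incseq \<A>" and dense: "closure (\<Union>n. \<A> n) = UNIV"
    and A: "openin (jacobson_topology (UNIV :: 'a set)) A"
  shows "openin (fell_trace \<A>) {I \<in> Ideal UNIV. prim_hull UNIV I \<inter> A \<noteq> {}}"
proof (subst openin_subopen, intro ballI)
  note U = cstar_subalgebra_UNIV
  obtain L where L: "L \<in> Ideal UNIV" and A_eq: "A = Prim UNIV - prim_hull UNIV L"
    using A unfolding openin_jacobson_topology[OF U] by blast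
  fix I0 assume "I0 \<in> {I \<in> Ideal UNIV. prim_hull UNIV I \<inter> A \<noteq> {}}"
  then obtain J0 where I0: "I0 \<in> Ideal UNIV" and J0: "J0 \<in> Prim UNIV" "I0 \<subseteq> J0" "\<not> L \<subseteq> J0"
    by (auto simp: A_eq prim_hull_def)
  obtain n where "\<not> L \<inter> \<A> n \<subseteq> J0" by (rule ideal_subset_primitive_if_traces[OF dense L J0(1,3)])
  then obtain y where y: "y \<in> L" "y \<in> \<A> n" "y \<notin> J0" by blast
  have LA: "L \<inter> \<A> n \<in> Ideal (\<A> n)" by (rule Ideal_Int[OF \<A> L])
  define A' where "A' = Prim (\<A> n) - prim_hull (\<A> n) (L \<inter> \<A> n)"
  have A': "openin (jacobson_topology (\<A> n)) A'"
    unfolding openin_jacobson_topology[OF \<A>] A'_def using LA by blast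
  define W where "W = {I \<in> Ideal (\<A> n). prim_hull (\<A> n) I \<inter> A' \<noteq> {}}"
  have W: "openin (fell_ideal (\<A> n)) W" unfolding W_def by (rule openin_fell_ideal_hit[OF \<A> A'])
  obtain h where h: "h \<in> \<A> n" "star h = h" "h * h \<in> L" "h * h \<notin> J0"
    by (rule self_adjoint_square_not_mem[OF U J0(1) \<A> subset_UNIV L y(2,1,3)])
  have hh: "h * h \<in> L \<inter> \<A> n" using h(1,3) \<A>[of n] by (simp add: cstar_subalgebra_def)
  have JA: "J0 \<inter> \<A> n \<in> Ideal (\<A> n)" by (rule Ideal_Int[OF \<A> Prim_IdealD[OF U J0(1)]])
  show "\<exists>T. openin (fell_trace \<A>) T \<and> I0 \<in> T \<and> T \<subseteq> {I \<in> Ideal UNIV. prim_hull UNIV I \<inter> A \<noteq> {}}"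
  proof (intro exI conjI)
    show "openin (fell_trace \<A>) {I \<in> Ideal UNIV. I \<inter> \<A> n \<in> W}" by (rule openin_fell_trace_component[OF inc W])
    obtain J' where J': "J' \<in> Prim (\<A> n)" "J0 \<inter> \<A> n \<subseteq> J'" "h * h \<notin> J'"
      by (rule primitive_ideal_excluding_square[OF \<A> JA h(1,2)]) (use h(4) in auto)
    then have "\<not> L \<inter> \<A> n \<subseteq> J'" using hh by blast
    then have "J' \<in> A'" using J'(1) by (simp add: A'_def prim_hull_def)
    moreover have "I0 \<inter> \<A> n \<subseteq> J'" using J0(2) J'(2) by blast
    ultimately show "I0 \<in> {I \<in> Ideal UNIV. I \<inter> \<A> n \<in> W}"
      using I0 J'(1) Ideal_Int[OF \<A> I0] by (auto simp: W_def prim_hull_def)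
    show "{I \<in> Ideal UNIV. I \<inter> \<A> n \<in> W} \<subseteq> {I \<in> Ideal UNIV. prim_hull UNIV I \<inter> A \<noteq> {}}"
    proof clarify
      fix I assume I: "I \<in> Ideal UNIV" "I \<inter> \<A> n \<in> W" and empty: "prim_hull UNIV I \<inter> A = {}"
      then obtain J where J: "J \<in> Prim (\<A> n)" "I \<inter> \<A> n \<subseteq> J" "\<not> L \<inter> \<A> n \<subseteq> J"
        by (auto simp: W_def A'_def prim_hull_def)
      then obtain z where z: "z \<in> L" "z \<in> \<A> n" "z \<notin> J" by blast
      obtain k where k: "k \<in> \<A> n" "star k = k" "k * k \<in> L \<inter> \<A> n" "k * k \<notin> J"
        by (rule self_adjoint_square_not_mem[OF \<A> J(1) \<A> order_refl LA z(2) _ z(3)]) (use z in auto)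
      then have "k * k \<notin> I" using J(2) by blast
      then obtain J'' where J'': "J'' \<in> Prim UNIV" "I \<subseteq> J''" "k * k \<notin> J''"
        by (rule primitive_ideal_excluding_square[OF U I(1) UNIV_I k(2)])
      then have "J'' \<in> prim_hull UNIV I \<inter> A" using k(3) by (auto simp: A_eq prim_hull_def)
      then show False using empty by blast
    qed
  qed
qed

text \<open>Each \<open>J \<in> K\<close> omits a threshold element \<open>f\<close> of a square \<open>h\<^sup>2 \<in> I0 \<inter> \<A> n\<close>, and finitely many of these \<open>f\<close>
  suffice.  If \<open>I \<inter> \<A> n\<close> misses the primitive ideals of \<open>\<A> n\<close> at distance at least \<open>\<delta>\<close> from \<open>h\<^sup>2\<close>, then
  the trace of every primitive ideal above \<open>I\<close> has distance less than \<open>\<delta>\<close> from \<open>h\<^sup>2\<close>, and so contains \<open>f\<close>.\<close>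

lemma openin_fell_trace_miss:
  assumes inc: "incseq \<A>" and dense: "closure (\<Union>n. \<A> n) = UNIV"
    and K: "compactin (jacobson_topology (UNIV :: 'a set)) K"
  shows "openin (fell_trace \<A>) {I \<in> Ideal UNIV. prim_hull UNIV I \<inter> K = {}}"
proof (subst openin_subopen, intro ballI)
  note U = cstar_subalgebra_UNIV
  fix I0 assume I0K: "I0 \<in> {I \<in> Ideal UNIV. prim_hull UNIV I \<inter> K = {}}"
  then have I0: "I0 \<in> Ideal UNIV" by simp
  have KP: "K \<subseteq> Prim UNIV" using compactin_subset_topspace[OF K] by (simp add: topspace_jacobson_topology[OF U])
  \<comment> \<open>the data \<open>(n, h, \<delta>, f)\<close> of a threshold element \<open>f \<in> \<A> n\<close> at level \<open>\<delta>\<close> for a square \<open>h\<^sup>2 \<in> I0\<close>\<close>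
  define D where "D = {(n, h, \<delta>::real, f). h \<in> \<A> n \<and> star h = h \<and> 0 < \<delta> \<and> h * h \<in> I0 \<and>
    (\<forall>J\<in>Ideal UNIV. infdist (h * h) J < \<delta> \<longrightarrow> f \<in> J)}"
  define off where "off = (\<lambda>(n::nat, h::'a, \<delta>::real, f). {J \<in> Prim (UNIV :: 'a set). f \<notin> J})"
  have cover: "\<exists>d\<in>D. J \<in> off d" if J: "J \<in> K" for J
  proof -
    have JP: "J \<in> Prim UNIV" using J KP by blast
    have JI: "J \<in> Ideal UNIV" by (rule Prim_IdealD[OF U JP])
    have "\<not> I0 \<subseteq> J" using I0K J JP by (auto simp: prim_hull_def)
    then obtain n where "\<not> I0 \<inter> \<A> n \<subseteq> J" by (rule ideal_subset_primitive_if_traces[OF dense I0 JP])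
    then obtain y where y: "y \<in> I0" "y \<in> \<A> n" "y \<notin> J" by blast
    obtain h where h: "h \<in> \<A> n" "star h = h" "h * h \<in> I0" "h * h \<notin> J"
      by (rule self_adjoint_square_not_mem[OF U JP \<A> subset_UNIV I0 y(2,1,3)])
    have pos: "0 < infdist (h * h) J" using h(4) by (simp add: infdist_ideal_pos[OF JI])
    then have \<delta>: "0 < infdist (h * h) J / 2" by simp
    obtain f where f_mem: "\<And>C I. \<lbrakk>\<A> n \<subseteq> C; I \<in> Ideal C; infdist (h * h) I < infdist (h * h) J / 2\<rbrakk> \<Longrightarrow> f \<in> I"
      and f_le: "\<And>C I. \<lbrakk>\<A> n \<subseteq> C; I \<in> Ideal C; f \<in> I\<rbrakk> \<Longrightarrow> infdist (h * h) I \<le> infdist (h * h) J / 2"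
      by (rule ideal_threshold_element[OF \<A> h(1,2) \<delta>]) (rule that)
    have "(n, h, infdist (h * h) J / 2, f) \<in> D"
      using h \<delta> f_mem[OF subset_UNIV] by (simp add: D_def)
    moreover have "f \<notin> J" using f_le[OF subset_UNIV JI] pos by force
    ultimately show ?thesis using JP by (force simp: off_def)
  qed
  have "\<exists>\<F>. finite \<F> \<and> \<F> \<subseteq> off ` D \<and> K \<subseteq> \<Union>\<F>"
  proof (rule compactinD[OF K])
    show "openin (jacobson_topology UNIV) V" if "V \<in> off ` D" for V
      using that openin_jacobson_not_mem[OF U UNIV_I] by (auto simp: off_def)
    show "K \<subseteq> \<Union> (off ` D)" using cover by blast
  qed
  then obtain D' where D': "finite D'" "D' \<subseteq> D" "K \<subseteq> (\<Union>d\<in>D'. off d)"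
    by (metis finite_subset_image)
  define W where "W = (\<lambda>(n, h, \<delta>::real, f::'a). {I \<in> Ideal (\<A> n).
    prim_hull (\<A> n) I \<inter> {J \<in> Prim (\<A> n). \<delta> \<le> infdist (h * h) J} = {}})"
  define N where "N d = {I \<in> Ideal UNIV. I \<inter> \<A> (fst d) \<in> W d}" for d
  have N: "openin (fell_trace \<A>) (N d)" if d: "d \<in> D" for d
  proof -
    obtain n h \<delta> f where d_eq: "d = (n, h, \<delta>, f)" by (cases d)
    have "openin (fell_ideal (\<A> (fst d))) (W d)"
      unfolding W_def d_eq prod.case fst_conv
      by (intro openin_fell_ideal_miss \<A> compactin_infdist_ge) (use d in \<open>simp_all add: D_def d_eq\<close>)
    then show ?thesis unfolding N_def by (rule openin_fell_trace_component[OF inc])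
  qed
  have I0N: "I0 \<in> N d" if d: "d \<in> D" for d
  proof -
    obtain n h \<delta> f where d_eq: "d = (n, h, \<delta>, f)" by (cases d)
    have h: "h \<in> \<A> n" "h * h \<in> I0" "0 < \<delta>" using d by (auto simp: D_def d_eq)
    have "h * h \<in> \<A> n" using h \<A>[of n] by (simp add: cstar_subalgebra_def)
    then have "h * h \<in> I0 \<inter> \<A> n" using h by blast
    then have far: "\<not> \<delta> \<le> infdist (h * h) J" if "I0 \<inter> \<A> n \<subseteq> J" for J
      using that h(3) by (metis infdist_zero not_less subsetD)
    have "prim_hull (\<A> n) (I0 \<inter> \<A> n) \<inter> {J \<in> Prim (\<A> n). \<delta> \<le> infdist (h * h) J} = {}"
      unfolding prim_hull_def using far by blast
    then show ?thesis by (simp add: N_def W_def d_eq I0 Ideal_Int[OF \<A> I0])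
  qed
  have main: "prim_hull UNIV I \<inter> K = {}" if I: "I \<in> Ideal UNIV" "\<And>d. d \<in> D' \<Longrightarrow> I \<in> N d" for I
  proof (rule ccontr)
    assume "prim_hull UNIV I \<inter> K \<noteq> {}"
    then obtain J where J: "J \<in> Prim UNIV" "I \<subseteq> J" "J \<in> K" by (auto simp: prim_hull_def)
    have JI: "J \<in> Ideal UNIV" by (rule Prim_IdealD[OF U J(1)])
    obtain n h \<delta> f where d: "(n, h, \<delta>, f) \<in> D'" "f \<notin> J" using D'(3) J(3) by (auto simp: off_def)
    then have dD: "(n, h, \<delta>, f) \<in> D" using D'(2) by blast
    then have h: "h \<in> \<A> n" "star h = h" "0 < \<delta>" by (auto simp: D_def)
    have "\<delta> \<le> infdist (h * h) J" using dD JI d(2) by (force simp: D_def not_less[symmetric])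
    moreover have JA: "J \<inter> \<A> n \<in> Ideal (\<A> n)" by (rule Ideal_Int[OF \<A> JI])
    moreover have "infdist (h * h) J \<le> infdist (h * h) (J \<inter> \<A> n)"
      using IdealD(2)[OF JA] by (intro infdist_mono) auto
    ultimately have ge: "\<delta> \<le> infdist (h * h) (J \<inter> \<A> n)" by linarith
    then have pos: "0 < infdist (h * h) (J \<inter> \<A> n)" using h(3) by linarith
    obtain J' where J': "J' \<in> Prim (\<A> n)" "J \<inter> \<A> n \<subseteq> J'" "infdist (h * h) (J \<inter> \<A> n) \<le> infdist (h * h) J'"
      by (rule primitive_ideal_attaining_distance[OF \<A> JA h(1,2) pos])
    then have "J' \<in> prim_hull (\<A> n) (I \<inter> \<A> n)" "\<delta> \<le> infdist (h * h) J'"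
      using J(2) ge by (auto simp: prim_hull_def)
    then show False using I(2)[OF d(1)] J'(1) by (auto simp: N_def W_def)
  qed
  define T where "T = \<Inter>(insert (Ideal UNIV) (N ` D'))"
  have "Ideal UNIV = {I \<in> Ideal UNIV. I \<inter> \<A> 0 \<in> Ideal (\<A> 0)}" using Ideal_Int[OF \<A>] by blast
  then have top: "openin (fell_trace \<A>) (Ideal UNIV)"
    using openin_fell_trace_component[OF inc, of 0 "Ideal (\<A> 0)"] openin_topspace[of "fell_ideal (\<A> 0)"]
    by (simp add: topspace_fell_ideal[OF \<A>])
  have "openin (fell_trace \<A>) T"
    unfolding T_def using D'(1,2) N top by (intro openin_Inter) auto
  moreover have "I0 \<in> T" using I0 I0N D'(2) by (auto simp: T_def)
  moreover have "T \<subseteq> {I \<in> Ideal UNIV. prim_hull UNIV I \<inter> K = {}}" using main by (auto simp: T_def)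
  ultimately show "\<exists>T. openin (fell_trace \<A>) T \<and> I0 \<in> T \<and> T \<subseteq> {I \<in> Ideal UNIV. prim_hull UNIV I \<inter> K = {}}"
    by blast
qed

end

theorem proposition3p15:
  fixes \<A> :: "nat \<Rightarrow> 'a::cstar_algebra set"
  assumes "\<And>n. cstar_subalgebra (\<A> n)"
    and "incseq \<A>"
    and "closure (\<Union>n. \<A> n) = UNIV"
  shows "\<forall>U. openin (fell_ideal (UNIV :: 'a set)) U \<longrightarrow> openin (fell_trace \<A>) U"
proof (intro allI impI)
  fix U assume "openin (fell_ideal (UNIV :: 'a set)) U"
  then obtain T where T: "openin (fell_topology (jacobson_topology (UNIV :: 'a set))) T"
    and U: "U = prim_hull UNIV -` T \<inter> Ideal UNIV"
    unfolding fell_ideal_def openin_pullback_topology by blast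
  show "openin (fell_trace \<A>) U"
  proof (subst openin_subopen, intro ballI)
    fix I assume I: "I \<in> U"
    let ?X = "jacobson_topology (UNIV :: 'a set)"
    have "prim_hull UNIV I \<in> T" using I by (simp add: U)
    from bspec[OF T[unfolded openin_fell_topology arbitrary_union_of_alt] this]
    obtain K F V where KF: "compactin ?X K" "finite F" "\<forall>A\<in>F. openin ?X A \<and> A \<noteq> {}"
      and V: "V = fell_basic ?X K F" "prim_hull UNIV I \<in> V" "V \<subseteq> T"
      by (elim exE conjE) (rule that)
    have mem: "prim_hull UNIV I \<in> fell_basic ?X K F" and sub: "fell_basic ?X K F \<subseteq> T"
      using V by simp_all
    define N where "N = \<Inter>(insert {I \<in> Ideal UNIV. prim_hull UNIV I \<inter> K = {}}
        ((\<lambda>A. {I \<in> Ideal UNIV. prim_hull UNIV I \<inter> A \<noteq> {}}) ` F))"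
    have "openin (fell_trace \<A>) N"
      unfolding N_def using KF openin_fell_trace_miss[OF assms KF(1)] openin_fell_trace_hit[OF assms]
      by (intro openin_Inter) auto
    moreover have "I \<in> N" using I mem by (auto simp: N_def U fell_basic_def)
    moreover have "N \<subseteq> U"
    proof
      fix I' assume I': "I' \<in> N"
      then have "closedin ?X (prim_hull UNIV I')"
        unfolding closedin_jacobson_topology[OF cstar_subalgebra_UNIV] by (auto simp: N_def)
      then have "prim_hull UNIV I' \<in> fell_basic ?X K F" using I' by (auto simp: N_def fell_basic_def)
      then show "I' \<in> U" using I' sub by (auto simp: U N_def)
    qed
    ultimately show "\<exists>N. openin (fell_trace \<A>) N \<and> I \<in> N \<and> N \<subseteq> U" by blast
  qed
qed

end
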